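(* Assume $A$ is associative. Fix a domain $G$ in the hypercomplex subspace $M$ of $A$ and a function $\phi:G\to A$ that is left-monogenic with respect to $\mathcal{B}$. Then $\phi$ is harmonic with respect to $\mathcal{B}$ and real analytic. For every $\mathbf{h}\in\mathbb{N}^{m+1}$: the function $\nabla_{\mathcal{B}}^{\mathbf{h}}\phi$ is still left-monogenic with respect to $\mathcal{B}$ and real analytic; given any open ball $B^{m+1}=B^{m+1}(p,R)$ of $M$ whose closure $\overline{B}^{m+1}$ is contained in $G$, \[\nabla_{\mathcal{B}}^{\mathbf{h}}\phi(x)=(-1)^{|\mathbf{h}|}\int_{\partial B^{m+1}}\left(\nabla_{\mathcal{B}}^{\mathbf{h}}E_m\right)(y-x)\,dy^*\,\phi(y)\] for all $x\in B^{m+1}$; and, at the center $p$ of the ball $B^{m+1}$, \[\|\nabla_{\mathcal{B}}^{\mathbf{h}}\phi(p)\|\le\frac{C_m}{R^{|\mathbf{h}|}}\,\max_{\partial B^{m+1}}\|\phi\|,\qquad C_m:=\sigma_m\,\omega^2\,\max_{\partial B^{m+1}(0,1)}\|\nabla_{\mathcal{B}}^{\mathbf{h}}E_m\|.\]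
   Context: $\mathbb{N}$ includes $0$. $A$ is a finite-dimensional (unital) real $*$-algebra: a finite-dimensional real vector space with an $\mathbb{R}$-bilinear multiplication (here associative) and an involutive real-linear antiautomorphism $x\mapsto x^c$; $\mathbb{R}$ is identified with $\mathbb{R}1$. Set $t(x)=x+x^c$, $n(x)=xx^c$, $\mathbb{S}_A=\{x\in A:t(x)=0,\ n(x)=1\}$, assumed nonempty, and $Q_A=\bigcup_{J\in\mathbb{S}_A}(\mathbb{R}+J\mathbb{R})$. A hypercomplex subspace of $A$ is a real vector subspace $M$ with $\mathbb{R}\subsetneq M\subseteq Q_A$; a hypercomplex basis of $M$ is an ordered real basis $(v_0,\ldots,v_m)$ with $m\ge1$, $v_0=1$, $v_s\in\mathbb{S}_A$ and $v_sv_u=-v_uv_s$ for distinct $s,u\in\{1,\ldots,m\}$. Setting. $M$ is a hypercomplex subspace of $A$ with a fixed hypercomplex basis $\mathcal{B}=(v_0,\ldots,v_m)$, completed to a real basis $\mathcal{B}'=(v_0,\ldots,v_d)$ of $A$; $\|\cdot\|$ is the Euclidean norm on $A$ making $\mathcal{B}'$ orthonormal. $\omega:=\max\{\|uv\|:u\in M,\ v\in A,\ \|u\|=1=\|v\|\}$. Points of $M$ are written $x=\sum_{s=0}^mx_sv_s$. A domain is a nonempty connected open subset; $B^{m+1}(p,R)=\{x\in M:\|x-p\|<R\}$. For a $\mathscr{C}^1$ function $\phi:G\to A$: $\partial_s\phi(x)=\lim_{\mathbb{R}\ni\varepsilon\to0}\varepsilon^{-1}(\phi(x+\varepsilon v_s)-\phi(x))$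 and $\overline{\partial}_{\mathcal{B}}\phi=\sum_{s=0}^mv_s\,\partial_s\phi$; $\phi$ is left-monogenic with respect to $\mathcal{B}$ if it is $\mathscr{C}^1$ and $\overline{\partial}_{\mathcal{B}}\phi\equiv0$. A $\mathscr{C}^2$ function $\phi$ is harmonic with respect to $\mathcal{B}$ if $\Delta_{\mathcal{B}}\phi:=\sum_{s=0}^m\partial_s(\partial_s\phi)\equiv0$. For $\mathbf{h}=(h_0,\ldots,h_m)\in\mathbb{N}^{m+1}$: $|\mathbf{h}|=\sum_sh_s$ and $\nabla_{\mathcal{B}}^{\mathbf{h}}\phi=\partial_0^{h_0}\partial_1^{h_1}\cdots\partial_m^{h_m}\phi$. The Cauchy kernel $E_m:M\setminus\{0\}\to A$ is $E_m(x)=\frac{1}{\sigma_m}\frac{x^c}{\|x\|^{m+1}}$, with $\sigma_m=2\,\Gamma(\tfrac12)^{m+1}/\Gamma(\tfrac{m+1}{2})$ (surface volume of the unit $m$-sphere in $\mathbb{R}^{m+1}$). $dy^*=\sum_{s=0}^mv_s\,dy_s^*$ with $dy_s^*=(-1)^sdy_0\wedge\cdots\wedge dy_{s-1}\wedge dy_{s+1}\wedge\cdots\wedge dy_m$; for a bounded domain $G'$ with $\mathscr{C}^1$ boundary, $\int_{\partial G'}\psi\,dy^*\,\phi$ is the integral over $\partial G'$ (oriented as boundary) of the $A$-valued form $\sum_s\psi v_s\phi\,dy_s^*$, i.e. $\int_{\partial G'}\psi\,\nu\,\phi\,dS$ with $\nu$ the outward unit normal regarded as an element of $M\subset A$ and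 $dS$ the surface measure. *)

theory Defs
  imports "HOL-Analysis.Analysis"
begin

text \<open>
  The algebra is the whole type \<open>'a\<close>: class \<open>real_algebra_1\<close> gives an associative unital real
  algebra, class \<open>euclidean_space\<close> gives finite dimension and the Euclidean norm, which
  \<open>orthonormal_completion\<close> below ties to the chosen basis. No compatibility between norm and
  multiplication is assumed.
\<close>

definition star_involution :: "('a::real_algebra_1 \<Rightarrow> 'a) \<Rightarrow> bool" where
  "star_involution c \<longleftrightarrow>
     linear c \<and> (\<forall>x. c (c x) = x) \<and> (\<forall>x y. c (x * y) = c y * c x)"

definition tr :: "('a::real_algebra_1 \<Rightarrow> 'a) \<Rightarrow> 'a \<Rightarrow> 'a" where
  "tr c x = x + c x"

definition nm :: "('a::real_algebra_1 \<Rightarrow> 'a) \<Rightarrow> 'a \<Rightarrow> 'a" where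
  "nm c x = x * c x"

definition imag_units :: "('a::real_algebra_1 \<Rightarrow> 'a) \<Rightarrow> 'a set" where
  "imag_units c = {x. tr c x = 0 \<and> nm c x = 1}"

definition quadratic_cone :: "('a::real_algebra_1 \<Rightarrow> 'a) \<Rightarrow> 'a set" where
  "quadratic_cone c = (\<Union>J\<in>imag_units c. {of_real a + b *\<^sub>R J |a b. True})"

definition hypercomplex_subspace :: "('a::real_algebra_1 \<Rightarrow> 'a) \<Rightarrow> 'a set \<Rightarrow> bool" where
  "hypercomplex_subspace c M \<longleftrightarrow> subspace M \<and> \<real> \<subset> M \<and> M \<subseteq> quadratic_cone c"

text \<open>Ordered bases \<open>(v\<^sub>0, \<dots>, v\<^sub>k)\<close> are functions on \<open>nat\<close>; values beyond index \<open>k\<close> are irrelevant.\<close>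

definition ordered_basis :: "'a::real_vector set \<Rightarrow> (nat \<Rightarrow> 'a) \<Rightarrow> nat \<Rightarrow> bool" where
  "ordered_basis V v k \<longleftrightarrow>
     inj_on v {..k} \<and> independent (v ` {..k}) \<and> span (v ` {..k}) = V"

definition hypercomplex_basis ::
    "('a::real_algebra_1 \<Rightarrow> 'a) \<Rightarrow> 'a set \<Rightarrow> (nat \<Rightarrow> 'a) \<Rightarrow> nat \<Rightarrow> bool" where
  "hypercomplex_basis c M v m \<longleftrightarrow>
     ordered_basis M v m \<and> 1 \<le> m \<and> v 0 = 1 \<and>
     (\<forall>s\<in>{1..m}. v s \<in> imag_units c) \<and>
     (\<forall>s\<in>{1..m}. \<forall>u\<in>{1..m}. s \<noteq> u \<longrightarrow> v s * v u = - (v u * v s))"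

definition orthonormal_completion :: "(nat \<Rightarrow> 'a::euclidean_space) \<Rightarrow> nat \<Rightarrow> nat \<Rightarrow> bool" where
  "orthonormal_completion v m d \<longleftrightarrow>
     m \<le> d \<and> ordered_basis UNIV v d \<and>
     (\<forall>i\<le>d. \<forall>j\<le>d. v i \<bullet> v j = (if i = j then 1 else 0))"

text \<open>The supremum is a maximum: a continuous function on a compact set.\<close>

definition omega :: "'a::{real_algebra_1,euclidean_space} set \<Rightarrow> real" where
  "omega M = Sup {norm (u * w) |u w. u \<in> M \<and> norm u = 1 \<and> norm w = 1}"

definition domain_in :: "'a::euclidean_space set \<Rightarrow> 'a set \<Rightarrow> bool" where
  "domain_in M G \<longleftrightarrow> G \<noteq> {} \<and> connected G \<and> openin (top_of_set M) G"

definition hball :: "'a::euclidean_space set \<Rightarrow> 'a \<Rightarrow> real \<Rightarrow> 'a set" where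
  "hball M p R = {x \<in> M. norm (x - p) < R}"

text \<open>The boundary relative to \<open>M\<close>, not to the ambient algebra.\<close>

definition hsphere :: "'a::euclidean_space set \<Rightarrow> 'a \<Rightarrow> real \<Rightarrow> 'a set" where
  "hsphere M p R = {x \<in> M. norm (x - p) = R}"

text \<open>
  Functions on an open subset \<open>G\<close> of \<open>M\<close> are total functions on \<open>'a\<close> of which only the values on
  \<open>G\<close> matter: the limits below only see points \<open>x + \<epsilon>v\<^sub>s \<in> G\<close> when \<open>x \<in> G\<close>, \<open>s \<le> m\<close>.
\<close>

definition pderiv_dir ::
    "(nat \<Rightarrow> 'a::euclidean_space) \<Rightarrow> nat \<Rightarrow> ('a \<Rightarrow> 'a) \<Rightarrow> 'a \<Rightarrow> 'a" where
  "pderiv_dir v s f x = vector_derivative (\<lambda>\<epsilon>. f (x + \<epsilon> *\<^sub>R v s)) (at 0)"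

definition has_pderiv_dir ::
    "(nat \<Rightarrow> 'a::euclidean_space) \<Rightarrow> nat \<Rightarrow> ('a \<Rightarrow> 'a) \<Rightarrow> 'a \<Rightarrow> bool" where
  "has_pderiv_dir v s f x \<longleftrightarrow> (\<lambda>\<epsilon>. f (x + \<epsilon> *\<^sub>R v s)) differentiable (at 0)"

primrec Ck_on ::
    "(nat \<Rightarrow> 'a::euclidean_space) \<Rightarrow> nat \<Rightarrow> 'a set \<Rightarrow> nat \<Rightarrow> ('a \<Rightarrow> 'a) \<Rightarrow> bool" where
  "Ck_on v m G 0 f \<longleftrightarrow> continuous_on G f"
| "Ck_on v m G (Suc k) f \<longleftrightarrow>
     continuous_on G f \<and>
     (\<forall>s\<le>m. (\<forall>x\<in>G. has_pderiv_dir v s f x) \<and> Ck_on v m G k (pderiv_dir v s f))"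

definition dbar ::
    "(nat \<Rightarrow> 'a::{real_algebra_1,euclidean_space}) \<Rightarrow> nat \<Rightarrow> ('a \<Rightarrow> 'a) \<Rightarrow> 'a \<Rightarrow> 'a" where
  "dbar v m f x = (\<Sum>s\<le>m. v s * pderiv_dir v s f x)"

definition left_monogenic ::
    "(nat \<Rightarrow> 'a::{real_algebra_1,euclidean_space}) \<Rightarrow> nat \<Rightarrow> 'a set \<Rightarrow> ('a \<Rightarrow> 'a) \<Rightarrow> bool" where
  "left_monogenic v m G f \<longleftrightarrow> Ck_on v m G 1 f \<and> (\<forall>x\<in>G. dbar v m f x = 0)"

definition laplacian ::
    "(nat \<Rightarrow> 'a::euclidean_space) \<Rightarrow> nat \<Rightarrow> ('a \<Rightarrow> 'a) \<Rightarrow> 'a \<Rightarrow> 'a" where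
  "laplacian v m f x = (\<Sum>s\<le>m. pderiv_dir v s (pderiv_dir v s f) x)"

definition harmonic_wrt ::
    "(nat \<Rightarrow> 'a::euclidean_space) \<Rightarrow> nat \<Rightarrow> 'a set \<Rightarrow> ('a \<Rightarrow> 'a) \<Rightarrow> bool" where
  "harmonic_wrt v m G f \<longleftrightarrow> Ck_on v m G 2 f \<and> (\<forall>x\<in>G. laplacian v m f x = 0)"

text \<open>
  Local expansion in (unconditionally summable) power series in the coordinates of \<open>x - p\<close>, which
  are the inner products with the \<open>v\<^sub>s\<close> because the basis is orthonormal. Multi-indices in
  \<open>\<nat>\<^bsup>m+1\<^esup>\<close> are functions vanishing beyond \<open>m\<close>.
\<close>

definition real_analytic ::
    "'a::euclidean_space set \<Rightarrow> (nat \<Rightarrow> 'a) \<Rightarrow> nat \<Rightarrow> 'a set \<Rightarrow> ('a \<Rightarrow> 'a) \<Rightarrow> bool" where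
  "real_analytic M v m G f \<longleftrightarrow>
     (\<forall>p\<in>G. \<exists>r>0. \<exists>a :: (nat \<Rightarrow> nat) \<Rightarrow> 'a.
        hball M p r \<subseteq> G \<and>
        (\<forall>x\<in>hball M p r.
           ((\<lambda>k. (\<Prod>s\<le>m. ((x - p) \<bullet> v s) ^ k s) *\<^sub>R a k) has_sum f x) {k. \<forall>s>m. k s = 0}))"

text \<open>\<open>\<partial>\<^sub>0\<^bsup>h 0\<^esup> (\<partial>\<^sub>1\<^bsup>h 1\<^esup> (\<dots> (\<partial>\<^sub>m\<^bsup>h m\<^esup> f)))\<close>; only \<open>h 0, \<dots>, h m\<close> are used.\<close>

definition nabla ::
    "(nat \<Rightarrow> 'a::euclidean_space) \<Rightarrow> nat \<Rightarrow> (nat \<Rightarrow> nat) \<Rightarrow> ('a \<Rightarrow> 'a) \<Rightarrow> ('a \<Rightarrow> 'a)" where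
  "nabla v m h f = foldr (\<lambda>s. pderiv_dir v s ^^ h s) [0..<Suc m] f"

definition mlength :: "nat \<Rightarrow> (nat \<Rightarrow> nat) \<Rightarrow> nat" where
  "mlength m h = (\<Sum>s\<le>m. h s)"

definition sigma :: "nat \<Rightarrow> real" where
  "sigma m = 2 * Gamma (1/2) ^ (m + 1) / Gamma (real (m + 1) / 2)"

definition cauchy_kernel ::
    "('a::{real_algebra_1,euclidean_space} \<Rightarrow> 'a) \<Rightarrow> nat \<Rightarrow> 'a \<Rightarrow> 'a" where
  "cauchy_kernel c m x = (1 / sigma m) *\<^sub>R ((1 / norm x ^ (m + 1)) *\<^sub>R c x)"

text \<open>
  The integral of the form \<open>g dy\<^sub>s\<^sup>*\<close> over the outward oriented sphere of radius \<open>R\<close> in \<open>M\<close>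
  centred at \<open>p\<close>. Up to the null set \<open>y\<^sub>s = p\<^sub>s\<close> this sphere is the union of two graphs over the
  disc \<open>\<bar>z\<bar> < R\<close> in the coordinates \<open>z\<^sub>j\<close>, \<open>j \<le> m\<close>, \<open>j \<noteq> s\<close>, namely
  \<open>y = p + \<Sum>\<^sub>j z\<^sub>j v\<^sub>j \<plusminus> sqrt (R\<^sup>2 - \<bar>z\<bar>\<^sup>2) v\<^sub>s\<close>. On both, \<open>dy\<^sub>s\<^sup>*\<close> pulls back to
  \<open>(-1)\<^sup>s dz\<^sub>0 \<and> \<dots> \<and> dz\<^sub>m\<close> (without \<open>dz\<^sub>s\<close>). The outward normal has \<open>v\<^sub>s\<close>-component of sign \<open>\<plusminus>\<close>, so
  the chart has orientation \<open>\<plusminus>(-1)\<^sup>s\<close>, and the two graphs contribute with signs \<open>+\<close> and \<open>-\<close>.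
  Equivalently \<open>dy\<^sub>s\<^sup>* = \<nu>\<^sub>s dS\<close> on the sphere.
\<close>

definition sphere_chart ::
    "(nat \<Rightarrow> 'a::euclidean_space) \<Rightarrow> nat \<Rightarrow> nat \<Rightarrow> 'a \<Rightarrow> real \<Rightarrow> real \<Rightarrow> (nat \<Rightarrow> real) \<Rightarrow> 'a" where
  "sphere_chart v m s p R e z =
     p + (\<Sum>j\<in>{..m} - {s}. z j *\<^sub>R v j) + (e * sqrt (R\<^sup>2 - (\<Sum>j\<in>{..m} - {s}. (z j)\<^sup>2))) *\<^sub>R v s"

definition sphere_form_integral ::
    "(nat \<Rightarrow> 'a::euclidean_space) \<Rightarrow> nat \<Rightarrow> nat \<Rightarrow> 'a \<Rightarrow> real \<Rightarrow> ('a \<Rightarrow> 'a) \<Rightarrow> 'a" where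
  "sphere_form_integral v m s p R g =
     set_lebesgue_integral (Pi\<^sub>M ({..m} - {s}) (\<lambda>_. lborel))
       {z \<in> space (Pi\<^sub>M ({..m} - {s}) (\<lambda>_. lborel)). (\<Sum>j\<in>{..m} - {s}. (z j)\<^sup>2) < R\<^sup>2}
       (\<lambda>z. g (sphere_chart v m s p R 1 z) - g (sphere_chart v m s p R (-1) z))"

text \<open>\<open>\<integral> \<psi> dy\<^sup>* \<phi>\<close> over the sphere, with \<open>dy\<^sup>* = \<Sum>\<^sub>s v\<^sub>s dy\<^sub>s\<^sup>*\<close>.\<close>

definition sphere_integral ::
    "(nat \<Rightarrow> 'a::{real_algebra_1,euclidean_space}) \<Rightarrow> nat \<Rightarrow> 'a \<Rightarrow> real \<Rightarrow>
     ('a \<Rightarrow> 'a) \<Rightarrow> ('a \<Rightarrow> 'a) \<Rightarrow> 'a" where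
  "sphere_integral v m p R \<psi> \<phi> =
     (\<Sum>s\<le>m. sphere_form_integral v m s p R (\<lambda>y. \<psi> y * v s * \<phi> y))"

text \<open>Suprema of continuous functions on nonempty compact spheres, hence maxima.\<close>

definition max_norm_on_sphere :: "'a::euclidean_space set \<Rightarrow> 'a \<Rightarrow> real \<Rightarrow> ('a \<Rightarrow> 'a) \<Rightarrow> real" where
  "max_norm_on_sphere M p R f = (SUP y\<in>hsphere M p R. norm (f y))"

definition cauchy_const ::
    "('a::{real_algebra_1,euclidean_space} \<Rightarrow> 'a) \<Rightarrow> 'a set \<Rightarrow> (nat \<Rightarrow> 'a) \<Rightarrow> nat \<Rightarrow>
     (nat \<Rightarrow> nat) \<Rightarrow> real" where
  "cauchy_const c M v m h =
     sigma m * (omega M)\<^sup>2 * max_norm_on_sphere M 0 1 (nabla v m h (cauchy_kernel c m))"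

end

theory Submission
  imports Defs
begin

text \<open>
  Everything follows from one integral identity. For \<open>f\<close> left-monogenic near a closed ball and \<open>\<psi>\<close>
  differentiable, the divergence theorem says that the boundary integral of \<open>\<psi> dy\<^sup>* f\<close> is the integral
  over the ball of the right Dirac operator of \<open>\<psi>\<close> times \<open>f\<close> (\<open>gauss_monogenic\<close>). With boundary
  integrals defined by graph charts, the divergence theorem on a ball is only Fubini's theorem
  together with the fundamental theorem of calculus on chords (\<open>divergence_ball\<close>). Two kinds of
  \<open>\<psi>\<close> matter.

  The first is a radial field \<open>w (norm y) *\<^sub>R c y\<close>. For
  \<open>w r = 1 / (\<sigma>\<^sub>m * sqrt (r\<^sup>2 + e) ^ (m + 1))\<close>, a regularised Cauchy kernel, the right Dirac operator
  gives a nonnegative mollifier of total mass \<open>1\<close>. As \<open>e \<rightarrow> 0\<close> the boundary integral converges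
  to the Cauchy integral and the volume integral to the value of \<open>f\<close>. This is the Cauchy formula
  (\<open>cauchy_integral_formula\<close>), at every point of the ball, without cutting out a small ball.

  Differentiating the formula under the integral sign shows that \<open>f\<close> is smooth and gives the formula
  for all derivatives (\<open>nabla_cauchy_formula\<close>). Since second derivatives commute, derivatives of
  monogenic functions are monogenic, and since the products \<open>c (v s) * v t\<close> are antisymmetric for
  \<open>s \<noteq> t\<close>, monogenic functions are harmonic.

  For the estimate at the centre \<open>p\<close> one needs the norm of the sum of the chart integrals over all
  \<open>s\<close>, that is, a surface measure common to all charts. Instead, the second \<open>\<psi>\<close> is
  \<open>norm (y - p) ^ (2 * N)\<close>, a constant on the sphere, times a derivative of the Cauchy kernel. Only the gradient of the
  weight survives under the right Dirac operator, so the boundary integral is a volume integral that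
  can be estimated pointwise, and the limit \<open>N \<rightarrow> \<infinity>\<close> brings back the maximum over
  the sphere with the stated constant (\<open>norm_kernel_integral_le\<close>).

  Finally, the first-order estimate, iterated on shrinking balls, bounds the derivative of order
  \<open>h\<close> by \<open>A * (\<Prod>s\<le>m. B ^ h s * fact (h s))\<close>. Hence the Taylor series, taken in one coordinate after
  the other, is absolutely summable near the centre and represents \<open>f\<close>
  (\<open>real_analytic_left_monogenic\<close>).
\<close>

section \<open>Partial derivatives along the frame\<close>

lemma bounded_bilinear_algebra_mult:
  "bounded_bilinear ((*) :: 'a::{real_algebra_1,euclidean_space} \<Rightarrow> 'a \<Rightarrow> 'a)"
  by (simp add: bilinear_conv_bounded_bilinear[symmetric] bilinear_def linear_iff algebra_simps)

interpretation alg_mult: bounded_bilinear "(*) :: 'a::{real_algebra_1,euclidean_space} \<Rightarrow> 'a \<Rightarrow> 'a"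
  by (rule bounded_bilinear_algebra_mult)

abbreviation has_partial ::
    "(nat \<Rightarrow> 'a::euclidean_space) \<Rightarrow> nat \<Rightarrow> ('a \<Rightarrow> 'b::real_normed_vector) \<Rightarrow> 'b \<Rightarrow> 'a \<Rightarrow> bool" where
  "has_partial v s f D x \<equiv> ((\<lambda>\<epsilon>. f (x + \<epsilon> *\<^sub>R v s)) has_vector_derivative D) (at 0)"

lemma pderiv_dir_eq: "has_partial v s f D x \<Longrightarrow> pderiv_dir v s f x = D"
  unfolding pderiv_dir_def by (rule vector_derivative_at)

lemma has_partial_imp_has_pderiv_dir: "has_partial v s f D x \<Longrightarrow> has_pderiv_dir v s f x"
  unfolding has_pderiv_dir_def using differentiableI_vector by blast

lemma has_partial_pderiv_dir: "has_pderiv_dir v s f x \<Longrightarrow> has_partial v s f (pderiv_dir v s f x) x"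
  unfolding has_pderiv_dir_def pderiv_dir_def by (simp add: vector_derivative_works)

lemma has_vector_derivative_along_line:
  assumes "has_partial v s f D (x + t *\<^sub>R v s)"
  shows "((\<lambda>\<epsilon>. f (x + \<epsilon> *\<^sub>R v s)) has_vector_derivative D) (at t within T)"
proof -
  have "((\<lambda>\<epsilon>. f (x + t *\<^sub>R v s + \<epsilon> *\<^sub>R v s)) has_vector_derivative D) (at (t - t))"
    using assms by simp
  then have "((\<lambda>\<epsilon>. f (x + t *\<^sub>R v s + (\<epsilon> - t) *\<^sub>R v s)) has_vector_derivative 1 *\<^sub>R D) (at t)"
    using vector_diff_chain_at[where f="\<lambda>\<epsilon>. \<epsilon> - t" and f'=1 and x=t
      and g="\<lambda>\<epsilon>. f (x + t *\<^sub>R v s + \<epsilon> *\<^sub>R v s)" and g'=D]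
    using has_vector_derivative_diff[OF has_vector_derivative_id has_vector_derivative_const[of t], of "at t"]
    by (simp add: o_def)
  then have "((\<lambda>\<epsilon>. f (x + \<epsilon> *\<^sub>R v s)) has_vector_derivative D) (at t)"
    by (simp add: algebra_simps)
  then show ?thesis by (rule has_vector_derivative_at_within)
qed

lemma has_partial_mult:
  fixes f g :: "'a::{real_algebra_1,euclidean_space} \<Rightarrow> 'a"
  assumes "has_partial v s f D x" "has_partial v s g D' x"
  shows "has_partial v s (\<lambda>x. f x * g x) (D * g x + f x * D') x"
  using alg_mult.has_vector_derivative[OF assms] by (simp add: add.commute)

text \<open>
  The sets on which differentiation along the frame makes sense: relatively open subsets of \<open>M\<close> as
  well as open subsets of the algebra.
\<close>

definition line_open :: "(nat \<Rightarrow> 'a::euclidean_space) \<Rightarrow> nat \<Rightarrow> 'a set \<Rightarrow> bool" where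
  "line_open v m G \<longleftrightarrow> (\<forall>x\<in>G. \<forall>s\<le>m. eventually (\<lambda>\<epsilon>::real. x + \<epsilon> *\<^sub>R v s \<in> G) (nhds 0))"

lemma line_open_of_open:
  assumes "open G" shows "line_open v m G"
  unfolding line_open_def
proof (intro ballI allI impI)
  fix x s assume x: "x \<in> G"
  have "((\<lambda>\<epsilon>::real. x + \<epsilon> *\<^sub>R v s) \<longlongrightarrow> x + 0 *\<^sub>R v s) (nhds 0)"
    by (intro tendsto_intros filterlim_ident)
  then show "eventually (\<lambda>\<epsilon>::real. x + \<epsilon> *\<^sub>R v s \<in> G) (nhds 0)"
    using x assms by (intro topological_tendstoD) auto
qed

lemma has_partial_cong:
  assumes "line_open v m G" "x \<in> G" "s \<le> m" "\<And>x. x \<in> G \<Longrightarrow> f x = g x"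
  shows "has_partial v s f D x \<longleftrightarrow> has_partial v s g D x"
proof -
  have "eventually (\<lambda>\<epsilon>::real. f (x + \<epsilon> *\<^sub>R v s) = g (x + \<epsilon> *\<^sub>R v s)) (nhds 0)"
    by (rule eventually_mono[OF assms(1)[unfolded line_open_def, rule_format, OF assms(2,3)]]) (rule assms(4))
  then show ?thesis
    using assms by (intro has_vector_derivative_cong_ev) auto
qed

lemma pderiv_dir_cong:
  assumes "line_open v m G" "x \<in> G" "s \<le> m" "\<And>x. x \<in> G \<Longrightarrow> f x = g x"
  shows "pderiv_dir v s f x = pderiv_dir v s g x"
  unfolding pderiv_dir_def vector_derivative_def
  using has_partial_cong[where f=f and g=g, OF assms] by simp

lemma has_pderiv_dir_cong:
  assumes "line_open v m G" "x \<in> G" "s \<le> m" "\<And>x. x \<in> G \<Longrightarrow> f x = g x"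
  shows "has_pderiv_dir v s f x \<longleftrightarrow> has_pderiv_dir v s g x"
proof -
  have "has_pderiv_dir v s f x \<longleftrightarrow> (\<exists>D. has_partial v s f D x)" for f
    using has_partial_pderiv_dir has_partial_imp_has_pderiv_dir by blast
  then show ?thesis using has_partial_cong[where f=f and g=g, OF assms] by simp
qed

lemma Ck_on_cong:
  assumes "line_open v m G" "\<And>x. x \<in> G \<Longrightarrow> f x = g x"
  shows "Ck_on v m G k f \<longleftrightarrow> Ck_on v m G k g"
  using assms(2)
proof (induction k arbitrary: f g)
  case 0
  then show ?case by (simp cong: continuous_on_cong)
next
  case (Suc k)
  have "Ck_on v m G k (pderiv_dir v s f) \<longleftrightarrow> Ck_on v m G k (pderiv_dir v s g)" if "s \<le> m" for s
    using Suc that pderiv_dir_cong[OF assms(1)] by blast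
  moreover have "continuous_on G f \<longleftrightarrow> continuous_on G g"
    using Suc.prems by (rule continuous_on_cong[OF refl])
  moreover have "has_pderiv_dir v s f x \<longleftrightarrow> has_pderiv_dir v s g x" if "s \<le> m" "x \<in> G" for s x
    using has_pderiv_dir_cong[OF assms(1) that(2,1)] Suc.prems by blast
  ultimately show ?case by auto
qed

definition smooth_on :: "(nat \<Rightarrow> 'a::euclidean_space) \<Rightarrow> nat \<Rightarrow> 'a set \<Rightarrow> ('a \<Rightarrow> 'a) \<Rightarrow> bool" where
  "smooth_on v m G f \<longleftrightarrow> (\<forall>k. Ck_on v m G k f)"

lemma smooth_on_pderiv_dir: "smooth_on v m G f \<Longrightarrow> s \<le> m \<Longrightarrow> smooth_on v m G (pderiv_dir v s f)"
  unfolding smooth_on_def by (metis Ck_on.simps(2))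

lemma smooth_on_continuous: "smooth_on v m G f \<Longrightarrow> continuous_on G f"
  unfolding smooth_on_def by (metis Ck_on.simps(1))

lemma smooth_on_has_partial:
  "smooth_on v m G f \<Longrightarrow> s \<le> m \<Longrightarrow> x \<in> G \<Longrightarrow> has_partial v s f (pderiv_dir v s f x) x"
  unfolding smooth_on_def by (metis Ck_on.simps(2) has_partial_pderiv_dir)

text \<open>
  Smoothness by coinduction: for a class of functions given by formulas, such as kernels or integrals
  against them, it suffices to find the first derivatives within the class.
\<close>

lemma smooth_on_coinduct:
  assumes G: "line_open v m G"
    and cont: "\<And>f. Q f \<Longrightarrow> continuous_on G f"
    and deriv: "\<And>f s. Q f \<Longrightarrow> s \<le> m \<Longrightarrow> \<exists>g. Q g \<and> (\<forall>x\<in>G. has_partial v s f (g x) x)"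
    and "Q f"
  shows "smooth_on v m G f"
proof -
  have "Ck_on v m G k f" for k
    using \<open>Q f\<close>
  proof (induction k arbitrary: f)
    case 0
    then show ?case by (simp add: cont)
  next
    case (Suc k)
    have "(\<forall>x\<in>G. has_pderiv_dir v s f x) \<and> Ck_on v m G k (pderiv_dir v s f)" if "s \<le> m" for s
    proof -
      obtain g where g: "Q g" "\<And>x. x \<in> G \<Longrightarrow> has_partial v s f (g x) x"
        using deriv[OF Suc.prems \<open>s \<le> m\<close>] by blast
      have "Ck_on v m G k (pderiv_dir v s f) \<longleftrightarrow> Ck_on v m G k g"
        using g(2) pderiv_dir_eq by (intro Ck_on_cong[OF G]) blast
      then show ?thesis
        using g Suc.IH has_partial_imp_has_pderiv_dir by blast
    qed
    then show ?case using cont[OF Suc.prems] by auto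
  qed
  then show ?thesis unfolding smooth_on_def by blast
qed

text \<open>
  Two functions are differentiated in parallel because the induction is mostly applied to a
  monogenic function together with the kernel that represents it.
\<close>

lemma nabla_induct:
  assumes "P 0 f g"
    and "\<And>k f g s. s \<le> m \<Longrightarrow> P k f g \<Longrightarrow> P (Suc k) (pderiv_dir v s f) (pderiv_dir v s g)"
  shows "P (mlength m h) (nabla v m h f) (nabla v m h g)"
proof -
  have pow: "P (n + k) ((pderiv_dir v s ^^ n) f) ((pderiv_dir v s ^^ n) g)"
    if "P k f g" "s \<le> m" for n k s f g
    using that by (induction n) (auto intro: assms(2))
  have "P (sum_list (map h l)) (foldr (\<lambda>s. pderiv_dir v s ^^ h s) l f)
          (foldr (\<lambda>s. pderiv_dir v s ^^ h s) l g)" if "set l \<subseteq> {..m}" for l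
    using that by (induction l) (auto intro: pow assms(1))
  from this[of "[0..<Suc m]"] show ?thesis
    unfolding nabla_def mlength_def
    by (simp add: interv_sum_list_conv_sum_set_nat atLeast0LessThan lessThan_Suc_atMost subset_iff
        less_Suc_eq_le del: upt_Suc)
qed

section \<open>Lebesgue measure on the subspace\<close>

locale orthonormal_frame =
  fixes v :: "nat \<Rightarrow> 'a::euclidean_space" and m :: nat and M :: "'a set"
  assumes orth: "\<And>i j. i \<le> m \<Longrightarrow> j \<le> m \<Longrightarrow> v i \<bullet> v j = (if i = j then 1 else 0)"
    and M_span: "M = span (v ` {..m})"
begin

definition emb :: "'a \<Rightarrow> (nat \<Rightarrow> real) \<Rightarrow> 'a" where
  "emb p y = p + (\<Sum>j\<le>m. y j *\<^sub>R v j)"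

lemma subspace_M: "subspace M"
  by (simp add: M_span)

lemma closed_M: "closed M"
  by (simp add: M_span closed_subspace)

lemma v_in_M: "s \<le> m \<Longrightarrow> v s \<in> M"
  by (simp add: M_span span_base)

lemma v_ne_0: "s \<le> m \<Longrightarrow> v s \<noteq> 0"
  using orth[of s s] by auto

lemma norm_v: "s \<le> m \<Longrightarrow> norm (v s) = 1"
  using orth[of s s] by (simp add: norm_eq_sqrt_inner)

lemma M_add_line: "x \<in> M \<Longrightarrow> s \<le> m \<Longrightarrow> x + t *\<^sub>R v s \<in> M"
  by (simp add: subspace_M subspace_add subspace_scale v_in_M)

lemma inner_sum_frame: "s \<le> m \<Longrightarrow> (\<Sum>j\<le>m. y j *\<^sub>R v j) \<bullet> v s = y s"
  by (simp add: inner_sum_left orth if_distrib cong: if_cong)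

lemma norm_sum_frame: "(norm (\<Sum>j\<le>m. y j *\<^sub>R v j))\<^sup>2 = (\<Sum>j\<le>m. (y j)\<^sup>2)"
  unfolding power2_norm_eq_inner
  by (simp add: inner_sum_right inner_sum_frame power2_eq_square)

lemma emb_in_M: "p \<in> M \<Longrightarrow> emb p y \<in> M"
  unfolding emb_def by (intro subspace_add subspace_sum subspace_scale subspace_M v_in_M) auto

lemma norm_emb: "(norm (emb p y - p))\<^sup>2 = (\<Sum>j\<le>m. (y j)\<^sup>2)"
  by (simp add: emb_def norm_sum_frame)

lemma frame_expansion:
  assumes "x \<in> M" shows "x = (\<Sum>j\<le>m. (x \<bullet> v j) *\<^sub>R v j)"
proof -
  have inj: "inj_on v {..m}"
    by (rule inj_onI) (metis atMost_iff orth zero_neq_one)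
  obtain u where u: "x = (\<Sum>w\<in>v ` {..m}. u w *\<^sub>R w)"
    using assms span_finite[of "v ` {..m}"] unfolding M_span by auto
  then have u': "x = (\<Sum>j\<le>m. u (v j) *\<^sub>R v j)"
    by (simp add: sum.reindex[OF inj] o_def)
  have "(\<Sum>j\<le>m. u (v j) *\<^sub>R v j) = (\<Sum>j\<le>m. (x \<bullet> v j) *\<^sub>R v j)"
    unfolding u' by (rule sum.cong[OF refl]) (simp add: inner_sum_frame)
  with u' show ?thesis by metis
qed

lemma emb_shift: "p \<in> M \<Longrightarrow> emb p y = emb 0 (\<lambda>j\<in>{..m}. p \<bullet> v j + y j)"
proof -
  assume "p \<in> M"
  then have "emb p y = (\<Sum>j\<le>m. (p \<bullet> v j) *\<^sub>R v j) + (\<Sum>j\<le>m. y j *\<^sub>R v j)"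
    unfolding emb_def by (metis frame_expansion)
  then show ?thesis by (simp add: emb_def scaleR_add_left sum.distrib)
qed

lemma hball_borel [measurable]: "hball M p R \<in> sets borel"
proof -
  have "hball M p R = M \<inter> ball p R" by (auto simp: hball_def dist_norm norm_minus_commute)
  then show ?thesis using closed_M by auto
qed

definition hcball :: "'a \<Rightarrow> real \<Rightarrow> 'a set" where
  "hcball p R = {x \<in> M. norm (x - p) \<le> R}"

lemma compact_hcball: "compact (hcball p R)"
proof -
  have "hcball p R = M \<inter> cball p R" by (auto simp: hcball_def dist_norm norm_minus_commute)
  then show ?thesis using closed_M by (simp add: closed_Int_compact)
qed

lemma compact_hsphere: "compact (hsphere M p R)"
proof -
  have "hsphere M p R = M \<inter> sphere p R" by (auto simp: hsphere_def dist_norm norm_minus_commute)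
  then show ?thesis using closed_M by (simp add: closed_Int_compact)
qed

lemma hcball_borel [measurable]: "hcball p R \<in> sets borel"
  by (simp add: borel_compact compact_hcball)

lemma hsphere_borel [measurable]: "hsphere M p R \<in> sets borel"
  by (simp add: borel_compact compact_hsphere)

lemma hball_subset_hcball: "hball M p R \<subseteq> hcball p R"
  and hsphere_subset_hcball: "hsphere M p R \<subseteq> hcball p R"
  by (auto simp: hball_def hsphere_def hcball_def)

lemma hsphere_nonempty: "p \<in> M \<Longrightarrow> 0 \<le> R \<Longrightarrow> hsphere M p R \<noteq> {}"
  using M_add_line[of p 0 R] norm_v[of 0] by (auto simp: hsphere_def intro!: exI[of _ "p + R *\<^sub>R v 0"])

lemma closure_hball: "p \<in> M \<Longrightarrow> 0 < R \<Longrightarrow> closure (hball M p R) = hcball p R"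
proof
  assume p: "p \<in> M" and R: "0 < R"
  show "closure (hball M p R) \<subseteq> hcball p R"
    by (rule closure_minimal[OF hball_subset_hcball]) (simp add: compact_hcball compact_imp_closed)
  show "hcball p R \<subseteq> closure (hball M p R)"
  proof
    fix x assume x: "x \<in> hcball p R"
    have lim: "(\<lambda>n. p + (1 - 1 / (real n + 1)) *\<^sub>R (x - p)) \<longlonglongrightarrow> p + (1 - 0) *\<^sub>R (x - p)"
      by (intro tendsto_intros LIMSEQ_Suc[OF lim_inverse_n', simplified])
         (use LIMSEQ_Suc[OF lim_1_over_n] in \<open>simp add: add.commute\<close>)
    have "p + (1 - 1 / (real n + 1)) *\<^sub>R (x - p) \<in> hball M p R" for n
    proof -
      have "norm ((1 - 1 / (real n + 1)) *\<^sub>R (x - p)) = (1 - 1 / (real n + 1)) * norm (x - p)"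
        by (subst norm_scaleR) (simp add: field_simps)
      also have "\<dots> \<le> (1 - 1 / (real n + 1)) * R"
        using x by (intro mult_left_mono) (auto simp: hcball_def field_simps)
      also have "\<dots> < R" using R by (simp add: field_simps)
      finally show ?thesis
        using x p subspace_M by (auto simp: hball_def hcball_def intro!: subspace_add subspace_scale subspace_diff)
    qed
    then show "x \<in> closure (hball M p R)"
      using lim unfolding closure_sequential by (intro exI conjI allI) auto
  qed
qed

lemma line_open_of_openin: assumes "openin (top_of_set M) G" shows "line_open v m G"
proof -
  obtain T where T: "open T" "G = M \<inter> T" using assms by (auto simp: openin_open)
  then show ?thesis
    using line_open_of_open[OF T(1), of v m] M_add_line unfolding line_open_def by (auto elim!: eventually_mono)
qed

lemma openin_hball: "openin (top_of_set M) (hball M p R)"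
  unfolding openin_open
  by (rule exI[of _ "ball p R"]) (auto simp: hball_def dist_norm norm_minus_commute)

lemma line_open_hball: "line_open v m (hball M p R)"
  by (rule line_open_of_openin[OF openin_hball])

lemma line_open_M_minus_0: "line_open v m (M - {0})"
  by (rule line_open_of_openin) (auto simp: openin_open intro!: exI[of _ "- {0}"])

lemma hcball_subset_open:
  assumes "openin (top_of_set M) G" "p \<in> G" obtains r where "r > 0" "hcball p r \<subseteq> G"
proof -
  obtain T where T: "open T" "G = M \<inter> T" using assms by (auto simp: openin_open)
  then obtain r where "r > 0" "cball p r \<subseteq> T" using assms open_contains_cball by blast
  then show ?thesis
    using T by (intro that[of r]) (auto simp: hcball_def dist_norm norm_minus_commute subset_iff)
qed

text \<open>
  Lebesgue measure on \<open>M\<close> as a measure on the whole algebra. The product measure behind it allows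
  integration in the direction of a single frame vector.
\<close>

definition vol :: "'a measure" where
  "vol = distr (Pi\<^sub>M {..m} (\<lambda>_. lborel)) borel (emb 0)"

lemma measurable_emb [measurable]: "emb p \<in> borel_measurable (Pi\<^sub>M {..m} (\<lambda>_. lborel))"
  unfolding emb_def by measurable

lemma sets_vol [measurable_cong, simp]: "sets vol = sets borel"
  by (simp add: vol_def)

lemma space_vol [simp]: "space vol = UNIV"
  by (simp add: vol_def)

text \<open>Translation invariance of one-dimensional Lebesgue measure, in every coordinate.\<close>

lemma vol_translate:
  assumes "p \<in> M"
  shows "vol = distr (Pi\<^sub>M {..m} (\<lambda>_. lborel)) borel (emb p)"
proof -
  interpret product_sigma_finite "\<lambda>_::nat. lborel :: real measure" by standard
  let ?L = "Pi\<^sub>M {..m} (\<lambda>_. lborel) :: (nat \<Rightarrow> real) measure"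
  define sh where "sh = (\<lambda>y. \<lambda>j\<in>{..m}. p \<bullet> v j + y j)"
  have [measurable]: "sh \<in> measurable ?L ?L"
    unfolding sh_def by measurable
  have inv: "distr ?L ?L sh = ?L"
  proof (rule PiM_eqI)
    fix A :: "nat \<Rightarrow> real set" assume A: "\<And>i. i \<in> {..m} \<Longrightarrow> A i \<in> sets lborel"
    have vim: "sh -` Pi\<^sub>E {..m} A \<inter> space ?L = Pi\<^sub>E {..m} (\<lambda>i. (+) (p \<bullet> v i) -` A i)"
      by (auto simp: sh_def space_PiM PiE_iff extensional_def)
    have meas: "(+) (p \<bullet> v i) -` A i \<in> sets lborel" if "i \<le> m" for i
      using measurable_sets[of "(+) (p \<bullet> v i)" lborel lborel "A i"] A that by simp
    have "emeasure (distr ?L ?L sh) (Pi\<^sub>E {..m} A) = emeasure ?L (Pi\<^sub>E {..m} (\<lambda>i. (+) (p \<bullet> v i) -` A i))"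
      using A by (subst emeasure_distr) (auto simp: vim intro!: sets_PiM_I_finite)
    also have "\<dots> = (\<Prod>i\<in>{..m}. emeasure lborel ((+) (p \<bullet> v i) -` A i))"
      by (rule emeasure_PiM) (use meas in auto)
    also have "\<dots> = (\<Prod>i\<in>{..m}. emeasure lborel (A i))"
    proof (rule prod.cong[OF refl])
      fix i assume i: "i \<in> {..m}"
      have "emeasure lborel (A i) = emeasure (distr lborel borel ((+) (p \<bullet> v i))) (A i)"
        by (simp add: lborel_distr_plus)
      also have "\<dots> = emeasure lborel ((+) (p \<bullet> v i) -` A i)"
        using A[OF i] by (subst emeasure_distr) auto
      finally show "emeasure lborel ((+) (p \<bullet> v i) -` A i) = emeasure lborel (A i)" ..
    qed
    finally show "emeasure (distr ?L ?L sh) (Pi\<^sub>E {..m} A) = (\<Prod>i\<in>{..m}. emeasure lborel (A i))" .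
  qed simp_all
  have "vol = distr (distr ?L ?L sh) borel (emb 0)"
    by (simp add: inv vol_def)
  also have "\<dots> = distr ?L borel (emb 0 \<circ> sh)"
    by (rule distr_distr) auto
  also have "emb 0 \<circ> sh = emb p"
    using emb_shift[OF assms] by (auto simp: sh_def fun_eq_iff)
  finally show ?thesis .
qed

lemma emb_in_hball_iff:
  assumes "p \<in> M" "R > 0"
  shows "emb p y \<in> hball M p R \<longleftrightarrow> (\<Sum>j\<le>m. (y j)\<^sup>2) < R\<^sup>2"
  using assms emb_in_M[OF assms(1), of y] norm_emb[of p y]
    power_mono_iff[of R "norm (emb p y - p)" 2]
  by (auto simp: hball_def not_le[symmetric])

lemma emb_in_hcball_iff:
  assumes "p \<in> M" "R > 0"
  shows "emb p y \<in> hcball p R \<longleftrightarrow> (\<Sum>j\<le>m. (y j)\<^sup>2) \<le> R\<^sup>2"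
  using assms emb_in_M[OF assms(1), of y] norm_emb[of p y]
    power_mono_iff[of "norm (emb p y - p)" R 2]
  by (auto simp: hcball_def)

lemma emeasure_hcball:
  assumes "p \<in> M" "R > 0"
  shows "emeasure vol (hcball p R) = ennreal (unit_ball_vol (real (m + 1)) * R ^ (m + 1))"
proof -
  let ?L = "Pi\<^sub>M {..m} (\<lambda>_. lborel) :: (nat \<Rightarrow> real) measure"
  have "emeasure vol (hcball p R) = emeasure ?L (emb p -` hcball p R \<inter> space ?L)"
    unfolding vol_translate[OF assms(1)]
    by (rule emeasure_distr) (auto simp: borel_compact compact_hcball)
  also have "emb p -` hcball p R \<inter> space ?L = {f. sqrt (\<Sum>i\<in>{..m}. (f i)\<^sup>2) \<le> R} \<inter> space ?L"
    using assms emb_in_hcball_iff[OF assms] by (auto simp: real_sqrt_le_iff' sum_nonneg)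
  also have "emeasure ?L \<dots> = ennreal (unit_ball_vol (real (card {..m})) * R ^ card {..m})"
    by (rule emeasure_cball_aux) (use assms in auto)
  finally show ?thesis by simp
qed

lemma emeasure_hball_finite: "p \<in> M \<Longrightarrow> emeasure vol (hball M p R) < \<infinity>"
proof -
  assume p: "p \<in> M"
  have "emeasure vol (hball M p R) \<le> emeasure vol (hcball p (max R 1))"
  proof (rule emeasure_mono)
    show "hball M p R \<subseteq> hcball p (max R 1)" by (auto simp: hball_def hcball_def)
  qed simp
  then show ?thesis using emeasure_hcball[OF p, of "max R 1"] by (auto simp: top.not_eq_extremum[symmetric] top_unique)
qed

text \<open>The open ball is exhausted by the closed balls of smaller radius.\<close>

lemma measure_hball:
  assumes "p \<in> M" "R > 0"
  shows "measure vol (hball M p R) = unit_ball_vol (real (m + 1)) * R ^ (m + 1)" (is "_ = ?V * _")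
proof (rule antisym)
  have fm: "hcball p r \<in> fmeasurable vol" if "r > 0" for r
    using emeasure_hcball[OF assms(1) that] by (intro fmeasurableI) (auto simp: borel_compact compact_hcball)
  have fm': "hball M p R \<in> fmeasurable vol"
    using emeasure_hball_finite[OF assms(1)] by (intro fmeasurableI) auto
  have meas: "measure vol (hcball p r) = ?V * r ^ (m + 1)" if "r > 0" for r
    using emeasure_hcball[OF assms(1) that] that by (simp add: measure_def enn2real_ennreal)
  show "measure vol (hball M p R) \<le> ?V * R ^ (m + 1)"
    using measure_mono_fmeasurable[OF hball_subset_hcball _ fm, of R] meas assms by simp
  have "((\<lambda>r. ?V * r ^ (m + 1)) \<longlongrightarrow> ?V * R ^ (m + 1)) (at_left R)"
    by (intro tendsto_intros)
  moreover have "eventually (\<lambda>r. ?V * r ^ (m + 1) \<le> measure vol (hball M p R)) (at_left R)"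
    using eventually_at_left_real[OF assms(2)]
  proof eventually_elim
    case (elim r)
    then have "measure vol (hcball p r) \<le> measure vol (hball M p R)"
      by (intro measure_mono_fmeasurable fm') (auto simp: hcball_def hball_def borel_compact compact_hcball[unfolded hcball_def])
    then show ?case using meas elim by simp
  qed
  ultimately show "?V * R ^ (m + 1) \<le> measure vol (hball M p R)"
    by (rule tendsto_upperbound) simp
qed

end

section \<open>The divergence theorem on balls\<close>

lemma integrable_bounded_on_set:
  fixes f :: "'b \<Rightarrow> 'c::euclidean_space"
  assumes "A \<in> sets N" "(\<lambda>x. indicator A x *\<^sub>R f x) \<in> borel_measurable N"
    "emeasure N A < \<infinity>" "\<And>x. x \<in> A \<Longrightarrow> norm (f x) \<le> K"
  shows "set_integrable N A f"
  unfolding set_integrable_def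
  by (rule integrableI_bounded_set[OF assms(1-3), of K]) (auto simp: assms(4) indicator_def)

lemma measurable_continuous_off_finite:
  fixes f :: "'b::{t1_space} \<Rightarrow> 'c::euclidean_space"
  assumes "A \<in> sets borel" "finite T" "continuous_on (A - T) f"
  shows "(\<lambda>x. indicator A x *\<^sub>R f x) \<in> borel_measurable borel"
proof -
  have T: "U \<in> sets borel" if "U \<subseteq> T" for U
    using that assms(2) by (intro borel_closed finite_imp_closed) (rule finite_subset)
  have "(\<lambda>x. indicator (A - T) x *\<^sub>R f x) \<in> borel_measurable borel"
    using assms T by (intro borel_measurable_continuous_on_indicator) auto
  moreover have "(\<lambda>x. \<Sum>t\<in>A \<inter> T. indicator {t} x *\<^sub>R f t) \<in> borel_measurable borel"
    by measurable
  moreover have "(\<lambda>x. indicator A x *\<^sub>R f x) =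
      (\<lambda>x. indicator (A - T) x *\<^sub>R f x + (\<Sum>t\<in>A \<inter> T. indicator {t} x *\<^sub>R f t))"
  proof
    fix x
    have "(\<Sum>t\<in>A \<inter> T. indicator {t} x *\<^sub>R f t) = (\<Sum>t\<in>A \<inter> T. if t = x then f t else 0)"
      by (rule sum.cong) (auto simp: indicator_def)
    also have "\<dots> = (if x \<in> A \<inter> T then f x else 0)"
      using assms(2) by simp
    finally show "indicator A x *\<^sub>R f x =
        indicator (A - T) x *\<^sub>R f x + (\<Sum>t\<in>A \<inter> T. indicator {t} x *\<^sub>R f t)"
      by (auto simp: indicator_def)
  qed
  ultimately show ?thesis by simp
qed

context orthonormal_frame
begin

abbreviation slice_space :: "nat \<Rightarrow> (nat \<Rightarrow> real) measure" where
  "slice_space s \<equiv> Pi\<^sub>M ({..m} - {s}) (\<lambda>_. lborel)"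

definition disc :: "nat \<Rightarrow> real \<Rightarrow> (nat \<Rightarrow> real) set" where
  "disc s R = {z \<in> space (slice_space s). (\<Sum>j\<in>{..m} - {s}. (z j)\<^sup>2) < R\<^sup>2}"

lemma sphere_form_integral_disc:
  "sphere_form_integral v m s p R g =
    (LINT z:disc s R|slice_space s. g (sphere_chart v m s p R 1 z) - g (sphere_chart v m s p R (-1) z))"
  by (simp add: sphere_form_integral_def disc_def)

lemma disc_sets [measurable]: "disc s R \<in> sets (slice_space s)"
  unfolding disc_def by measurable

lemma emeasure_disc_finite: "emeasure (slice_space s) (disc s R) < \<infinity>"
proof -
  define r where "r = \<bar>R\<bar> + 1"
  have "emeasure (slice_space s) (disc s R) \<le> emeasure (slice_space s)
     ({f. sqrt (\<Sum>i\<in>{..m} - {s}. (f i)\<^sup>2) \<le> r} \<inter> space (slice_space s))"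
  proof (rule emeasure_mono)
    show "disc s R \<subseteq> {f. sqrt (\<Sum>i\<in>{..m} - {s}. (f i)\<^sup>2) \<le> r} \<inter> space (slice_space s)"
    proof (clarsimp simp: disc_def)
      fix z :: "nat \<Rightarrow> real" assume "(\<Sum>j\<in>{..m} - {s}. (z j)\<^sup>2) < R\<^sup>2"
      then have "sqrt (\<Sum>j\<in>{..m} - {s}. (z j)\<^sup>2) \<le> sqrt (R\<^sup>2)" by (intro real_sqrt_le_mono) simp
      then show "sqrt (\<Sum>j\<in>{..m} - {s}. (z j)\<^sup>2) \<le> r" by (simp add: r_def)
    qed
  qed measurable
  also have "\<dots> < \<infinity>"
    using emeasure_cball_aux[of "{..m} - {s}" r] by (auto simp: r_def)
  finally show ?thesis .
qed

lemma measurable_chart [measurable]: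
  "sphere_chart v m s p R e \<in> borel_measurable (slice_space s)"
  unfolding sphere_chart_def by measurable

lemma emb_fun_upd: "s \<le> m \<Longrightarrow> emb p (z(s := t)) = p + (\<Sum>j\<in>{..m} - {s}. z j *\<^sub>R v j) + t *\<^sub>R v s"
  unfolding emb_def by (subst sum.remove[of _ s]) (auto intro!: sum.cong)

lemma sum_sq_fun_upd:
  "s \<le> m \<Longrightarrow> (\<Sum>j\<le>m. ((z(s := t)) j)\<^sup>2) = (\<Sum>j\<in>{..m} - {s}. (z j)\<^sup>2) + (t::real)\<^sup>2"
  by (subst sum.remove[of _ s]) (auto intro!: sum.cong)

lemma chart_eq_emb:
  "s \<le> m \<Longrightarrow> sphere_chart v m s p R e z =
     emb p (z(s := e * sqrt (R\<^sup>2 - (\<Sum>j\<in>{..m} - {s}. (z j)\<^sup>2))))"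
  by (simp add: sphere_chart_def emb_fun_upd)

lemma chart_in_hsphere:
  assumes "p \<in> M" "s \<le> m" "R > 0" "z \<in> disc s R" "e\<^sup>2 = 1"
  shows "sphere_chart v m s p R e z \<in> hsphere M p R"
proof -
  have "(norm (sphere_chart v m s p R e z - p))\<^sup>2 = R\<^sup>2"
    using assms by (simp add: chart_eq_emb norm_emb sum_sq_fun_upd power_mult_distrib disc_def del: fun_upd_apply)
  then have "norm (sphere_chart v m s p R e z - p) = R"
    using assms(3) by (simp add: power2_eq_iff_nonneg)
  then show ?thesis
    using assms emb_in_M by (simp add: hsphere_def chart_eq_emb)
qed

lemma sphere_form_integral_cong:
  assumes "p \<in> M" "s \<le> m" "R > 0" "\<And>y. y \<in> hsphere M p R \<Longrightarrow> f y = g y"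
  shows "sphere_form_integral v m s p R f = sphere_form_integral v m s p R g"
  unfolding sphere_form_integral_disc
  by (rule set_lebesgue_integral_cong) (auto simp: assms(4) chart_in_hsphere[OF assms(1-3)])

lemma measurable_comp_chart:
  fixes f :: "'a \<Rightarrow> 'a"
  assumes "p \<in> M" "s \<le> m" "R > 0" "continuous_on (hsphere M p R) f" "e\<^sup>2 = 1"
  shows "(\<lambda>z. indicator (disc s R) z *\<^sub>R f (sphere_chart v m s p R e z)) \<in> borel_measurable (slice_space s)"
proof -
  have [measurable]: "(\<lambda>x. indicator (hsphere M p R) x *\<^sub>R f x) \<in> borel_measurable borel"
    by (rule borel_measurable_continuous_on_indicator) (auto simp: assms)
  have "(\<lambda>z. indicator (disc s R) z *\<^sub>R (\<lambda>x. indicator (hsphere M p R) x *\<^sub>R f x) (sphere_chart v m s p R e z))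
    \<in> borel_measurable (slice_space s)"
    by measurable
  also have "?this \<longleftrightarrow> ?thesis"
    using chart_in_hsphere[OF assms(1-3) _ assms(5)] by (intro measurable_cong) (auto simp: indicator_def)
  finally show ?thesis .
qed

lemma bounded_on_hsphere:
  fixes f :: "'a \<Rightarrow> 'a"
  assumes "continuous_on (hsphere M p R) f"
  obtains K where "\<And>y. y \<in> hsphere M p R \<Longrightarrow> norm (f y) \<le> K"
  using compact_imp_bounded[OF compact_continuous_image[OF assms compact_hsphere]]
  by (auto simp: bounded_iff)

lemma sphere_form_set_integrable:
  fixes f :: "'a \<Rightarrow> 'a"
  assumes "p \<in> M" "s \<le> m" "R > 0" "continuous_on (hsphere M p R) f"
  shows "set_integrable (slice_space s) (disc s R)
    (\<lambda>z. f (sphere_chart v m s p R 1 z) - f (sphere_chart v m s p R (-1) z))"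
proof -
  obtain K where K: "\<And>y. y \<in> hsphere M p R \<Longrightarrow> norm (f y) \<le> K"
    using bounded_on_hsphere[OF assms(4)] by blast
  have "set_integrable (slice_space s) (disc s R) (\<lambda>z. f (sphere_chart v m s p R e z))"
    if "e\<^sup>2 = 1" for e
    by (rule integrable_bounded_on_set[OF _ measurable_comp_chart emeasure_disc_finite, where K=K])
       (use assms that chart_in_hsphere[OF assms(1-3) _ that] K in auto)
  then show ?thesis by (intro set_integral_diff) auto
qed

lemma sphere_form_integral_diff:
  assumes "p \<in> M" "s \<le> m" "R > 0" "continuous_on (hsphere M p R) f" "continuous_on (hsphere M p R) g"
  shows "sphere_form_integral v m s p R (\<lambda>y. f y - g y) =
    sphere_form_integral v m s p R f - sphere_form_integral v m s p R g"
  unfolding sphere_form_integral_disc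
  using set_integral_diff(2)[OF sphere_form_set_integrable[OF assms(1-4)]
      sphere_form_set_integrable[OF assms(1-3,5)]]
  by (simp add: algebra_simps)

lemma sphere_form_integral_scaleR:
  "sphere_form_integral v m s p R (\<lambda>y. a *\<^sub>R f y) = a *\<^sub>R sphere_form_integral v m s p R f"
  unfolding sphere_form_integral_disc set_lebesgue_integral_def
  by (subst integral_scaleR_right[symmetric]) (simp add: scaleR_diff_right algebra_simps)

text \<open>Dominated convergence on the sphere.\<close>

lemma sphere_form_integral_tendsto:
  assumes "p \<in> M" "s \<le> m" "R > 0"
    and "\<And>n. continuous_on (hsphere M p R) (f n)" "continuous_on (hsphere M p R) g"
    and "\<And>n y. y \<in> hsphere M p R \<Longrightarrow> norm (f n y) \<le> K"
    and "\<And>y. y \<in> hsphere M p R \<Longrightarrow> (\<lambda>n. f n y) \<longlonglongrightarrow> g y"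
  shows "(\<lambda>n. sphere_form_integral v m s p R (f n)) \<longlonglongrightarrow> sphere_form_integral v m s p R g"
  unfolding sphere_form_integral_disc set_lebesgue_integral_def
proof (rule integral_dominated_convergence[where w="\<lambda>z. indicator (disc s R) z *\<^sub>R (2 * K)"])
  let ?N = "slice_space s" and ?c = "sphere_chart v m s p R"
  show "(\<lambda>z. indicator (disc s R) z *\<^sub>R (g (?c 1 z) - g (?c (-1) z))) \<in> borel_measurable ?N"
    using sphere_form_set_integrable[OF assms(1-3,5)] unfolding set_integrable_def
    by (rule borel_measurable_integrable)
  show "(\<lambda>z. indicator (disc s R) z *\<^sub>R (f n (?c 1 z) - f n (?c (-1) z))) \<in> borel_measurable ?N" for n
    using sphere_form_set_integrable[OF assms(1-3) assms(4)] unfolding set_integrable_def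
    by (rule borel_measurable_integrable)
  show "integrable ?N (\<lambda>z. indicator (disc s R) z *\<^sub>R (2 * K))"
    using emeasure_disc_finite[of s R] by (intro integrableI_bounded_set_indicator[where B="2 * \<bar>K\<bar>"]) auto
  have S: "?c 1 z \<in> hsphere M p R" "?c (-1) z \<in> hsphere M p R" if "z \<in> disc s R" for z
    using chart_in_hsphere[OF assms(1-3) that] by auto
  show "AE z in ?N. (\<lambda>n. indicator (disc s R) z *\<^sub>R (f n (?c 1 z) - f n (?c (-1) z)))
      \<longlonglongrightarrow> indicator (disc s R) z *\<^sub>R (g (?c 1 z) - g (?c (-1) z))"
    using S by (intro AE_I2) (auto simp: indicator_def intro!: tendsto_intros assms(7))
  have "norm (f n (?c 1 z) - f n (?c (-1) z)) \<le> 2 * K" if "z \<in> disc s R" for n z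
    using norm_triangle_ineq4[of "f n (?c 1 z)" "f n (?c (-1) z)"]
      assms(6)[OF S(1)[OF that], of n] assms(6)[OF S(2)[OF that], of n] by linarith
  then show "AE z in ?N. norm (indicator (disc s R) z *\<^sub>R (f n (?c 1 z) - f n (?c (-1) z)))
      \<le> indicator (disc s R) z *\<^sub>R (2 * K)" for n
    by (intro AE_I2) (auto simp: indicator_def)
qed

lemma set_integrable_hball:
  fixes f :: "'a \<Rightarrow> 'c::euclidean_space"
  assumes "p \<in> M" "finite T" "continuous_on (hball M p R - T) f"
    "\<And>x. x \<in> hball M p R \<Longrightarrow> norm (f x) \<le> K"
  shows "set_integrable vol (hball M p R) f"
  using assms(1,4) emeasure_hball_finite
  by (intro integrable_bounded_on_set[of _ _ _ K])
     (use measurable_continuous_off_finite[OF hball_borel assms(2,3)] in \<open>auto simp: measurable_def vol_def\<close>)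

text \<open>
  The divergence theorem on a ball is Fubini's theorem in the direction \<open>v s\<close> followed by the
  fundamental theorem of calculus on every chord. Finitely many singular points do no harm: every
  chord meets finitely many of them.
\<close>

lemma divergence_ball:
  fixes F F' :: "'a \<Rightarrow> 'a"
  assumes p: "p \<in> M" and s: "s \<le> m" and R: "R > 0" and T: "finite T"
    and cont: "continuous_on (hcball p R) F"
    and deriv: "\<And>x. x \<in> hball M p R - T \<Longrightarrow> has_partial v s F (F' x) x"
    and cont': "continuous_on (hball M p R - T) F'"
    and bound: "\<And>x. x \<in> hball M p R \<Longrightarrow> norm (F' x) \<le> K"
  shows "sphere_form_integral v m s p R F = (LINT x:hball M p R|vol. F' x)"
proof -
  interpret product_sigma_finite "\<lambda>_::nat. lborel :: real measure" by standard
  let ?L = "Pi\<^sub>M {..m} (\<lambda>_. lborel) :: (nat \<Rightarrow> real) measure"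
  let ?f = "\<lambda>x. indicator (hball M p R) x *\<^sub>R F' x"
  have ins: "insert s ({..m} - {s}) = {..m}" using s by auto
  have fm [measurable]: "?f \<in> borel_measurable borel"
    by (rule measurable_continuous_off_finite[OF hball_borel T cont'])
  have int: "integrable vol ?f"
    using set_integrable_hball[OF p T cont' bound] by (simp add: set_integrable_def)
  then have intL: "integrable ?L (\<lambda>y. ?f (emb p y))"
    unfolding vol_translate[OF p] by (subst (asm) integrable_distr_eq) auto
  have "(LINT x:hball M p R|vol. F' x) = (LINT y|?L. ?f (emb p y))"
    unfolding vol_translate[OF p] set_lebesgue_integral_def by (subst integral_distr) auto
  also have "\<dots> = (LINT z|slice_space s. LINT t|lborel. ?f (emb p (z(s := t))))"
    using product_integral_insert[of "{..m} - {s}" s "\<lambda>y. ?f (emb p y)", unfolded ins] intL by simp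
  also have "\<dots> = (LINT z|slice_space s. indicator (disc s R) z *\<^sub>R
      (F (sphere_chart v m s p R 1 z) - F (sphere_chart v m s p R (-1) z)))"
  proof (rule Bochner_Integration.integral_cong[OF refl])
    fix z assume z: "z \<in> space (slice_space s)"
    define \<rho> where "\<rho> = (\<Sum>j\<in>{..m} - {s}. (z j)\<^sup>2)"
    have in_ball: "emb p (z(s := t)) \<in> hball M p R \<longleftrightarrow> \<rho> + t\<^sup>2 < R\<^sup>2" for t
      using emb_in_hball_iff[OF p R] sum_sq_fun_upd[OF s] by (simp add: \<rho>_def)
    have in_cball: "emb p (z(s := t)) \<in> hcball p R \<longleftrightarrow> \<rho> + t\<^sup>2 \<le> R\<^sup>2" for t
      using emb_in_hcball_iff[OF p R] sum_sq_fun_upd[OF s] by (simp add: \<rho>_def)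
    show "(LINT t|lborel. ?f (emb p (z(s := t)))) = indicator (disc s R) z *\<^sub>R
        (F (sphere_chart v m s p R 1 z) - F (sphere_chart v m s p R (-1) z))"
    proof (cases "\<rho> < R\<^sup>2")
      case False
      then have "z \<notin> disc s R" by (simp add: disc_def \<rho>_def)
      moreover have "emb p (z(s := t)) \<notin> hball M p R" for t
        using False in_ball[of t] zero_le_power2[of t] by linarith
      ultimately show ?thesis by simp
    next
      case True
      define a where "a = sqrt (R\<^sup>2 - \<rho>)"
      define b where "b = p + (\<Sum>j\<in>{..m} - {s}. z j *\<^sub>R v j)"
      have emb: "emb p (z(s := t)) = b + t *\<^sub>R v s" for t
        using emb_fun_upd[OF s] by (simp add: b_def)
      have a: "a > 0" "a\<^sup>2 = R\<^sup>2 - \<rho>" using True by (auto simp: a_def)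
      have ball: "b + t *\<^sub>R v s \<in> hball M p R \<longleftrightarrow> t \<in> {-a<..<a}" for t
      proof -
        have "t \<in> {-a<..<a} \<longleftrightarrow> t\<^sup>2 < a\<^sup>2"
          using a(1) abs_le_square_iff[of a t] by (auto simp: not_le[symmetric])
        then show ?thesis using in_ball[of t] a(2) emb by auto
      qed
      have cball: "b + t *\<^sub>R v s \<in> hcball p R" if "t \<in> {-a..a}" for t
      proof -
        have "t\<^sup>2 \<le> a\<^sup>2" using that a(1) abs_le_square_iff[of t a] by auto
        then show ?thesis using in_cball[of t] a(2) emb by auto
      qed
      define g where "g = (\<lambda>t. F' (b + t *\<^sub>R v s))"
      have ind: "?f (emb p (z(s := t))) = indicator {-a<..<a} t *\<^sub>R g t" for t
        using ball[of t] by (simp add: emb g_def indicator_def)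
      have fin: "finite {t. b + t *\<^sub>R v s \<in> T}"
        by (rule finite_vimageI[OF T, of "\<lambda>t. b + t *\<^sub>R v s", unfolded vimage_def])
           (use v_ne_0[OF s] in \<open>auto simp: inj_on_def\<close>)
      have "(g has_integral (F (b + a *\<^sub>R v s) - F (b + (-a) *\<^sub>R v s))) {-a..a}"
        unfolding g_def
      proof (rule fundamental_theorem_of_calculus_interior_strong[OF fin])
        show "continuous_on {-a..a} (\<lambda>t. F (b + t *\<^sub>R v s))"
          by (rule continuous_on_compose2[OF cont]) (use cball in \<open>auto intro!: continuous_intros\<close>)
        show "((\<lambda>t. F (b + t *\<^sub>R v s)) has_vector_derivative F' (b + x *\<^sub>R v s)) (at x)"
          if "x \<in> {-a<..<a} - {t. b + t *\<^sub>R v s \<in> T}" for x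
          by (rule has_vector_derivative_along_line, rule deriv) (use that ball[of x] in auto)
      qed (use a in auto)
      then have FTC: "(g has_integral (F (b + a *\<^sub>R v s) - F (b + (-a) *\<^sub>R v s))) {-a<..<a}"
        using has_integral_open_interval[of g _ "-a" a] by simp
      have gm: "(\<lambda>t. indicator {-a<..<a} t *\<^sub>R g t) \<in> borel_measurable lborel"
      proof -
        have "(\<lambda>t. ?f (b + t *\<^sub>R v s)) \<in> borel_measurable lborel" by measurable
        also have "(\<lambda>t. ?f (b + t *\<^sub>R v s)) = (\<lambda>t. indicator {-a<..<a} t *\<^sub>R g t)"
          using ind emb by auto
        finally show ?thesis .
      qed
      have gi: "set_integrable lborel {-a<..<a} g"
        by (rule integrable_bounded_on_set[OF _ gm, of K])
           (use a bound ball in \<open>auto simp: g_def ball\<close>)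
      have "(LINT t|lborel. ?f (emb p (z(s := t)))) = (LINT t:{-a<..<a}|lborel. g t)"
        by (simp add: ind set_lebesgue_integral_def)
      also have "\<dots> = F (b + a *\<^sub>R v s) - F (b + (-a) *\<^sub>R v s)"
        using set_borel_integral_eq_integral(2)[OF gi] FTC by (simp add: integral_unique)
      also have "\<dots> = F (sphere_chart v m s p R 1 z) - F (sphere_chart v m s p R (-1) z)"
        by (simp add: sphere_chart_def a_def b_def \<rho>_def)
      finally show ?thesis using True z by (simp add: disc_def \<rho>_def)
    qed
  qed
  also have "\<dots> = sphere_form_integral v m s p R F"
    by (simp add: sphere_form_integral_disc set_lebesgue_integral_def)
  finally show ?thesis ..
qed

end

section \<open>Gauss' theorem for monogenic functions\<close>

text \<open>Both sides are values of the Gamma function, related by its functional equation.\<close>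

lemma sigma_eq_sphere_area: "sigma m = real (m + 1) * unit_ball_vol (real (m + 1))"
proof -
  have "pi powr (real (m + 1) / 2) = sqrt pi ^ (m + 1)"
  proof -
    have "sqrt pi ^ (m + 1) = (pi powr (1 / 2)) powr real (m + 1)"
      using powr_realpow[of "sqrt pi" "m + 1"] by (simp add: powr_half_sqrt)
    then show ?thesis by (simp add: powr_powr)
  qed
  moreover have "Gamma (real (m + 1) / 2 + 1) = real (m + 1) / 2 * Gamma (real (m + 1) / 2)"
    by (rule Gamma_plus1) (auto elim!: nonpos_Ints_cases')
  moreover have "2 * y / g = real n * (y / (real n / 2 * g))"
    if "g > 0" "n > 0" for y g :: real and n :: nat
    using that by (simp add: field_simps)
  from this[of "Gamma (real (m + 1) / 2)" "m + 1" "sqrt pi ^ (m + 1)"]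
  have "2 * sqrt pi ^ (m + 1) / Gamma (real (m + 1) / 2) =
    real (m + 1) * (sqrt pi ^ (m + 1) / (real (m + 1) / 2 * Gamma (real (m + 1) / 2)))"
    using Gamma_real_pos[of "real (m + 1) / 2"] by simp
  ultimately have "2 * sqrt pi ^ (m + 1) / Gamma (real (m + 1) / 2) =
    real (m + 1) * (pi powr (real (m + 1) / 2) / Gamma (real (m + 1) / 2 + 1))"
    by (simp only:)
  then show ?thesis
    unfolding sigma_def unit_ball_vol_def Gamma_one_half_real .
qed

lemma sigma_pos: "sigma m > 0"
  unfolding sigma_eq_sphere_area by simp

lemma has_partial_translate:
  "has_partial v s f D (y - x) \<Longrightarrow> has_partial v s (\<lambda>y. f (y - x)) D y"
  by (simp add: add_diff_eq diff_add_eq)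

lemma has_partial_norm_sq:
  fixes v :: "nat \<Rightarrow> 'a::euclidean_space"
  shows "has_partial v s (\<lambda>y. (norm y)\<^sup>2) (2 * (y \<bullet> v s)) y"
  unfolding power2_norm_eq_inner has_real_derivative_iff_has_vector_derivative[symmetric]
    has_field_derivative_def
  by (auto intro!: derivative_eq_intros simp: inner_commute algebra_simps)

lemma has_partial_compose_real:
  assumes "has_partial v s f D y" "(w has_real_derivative w') (at (f y))"
  shows "has_partial v s (\<lambda>y. w (f y)) (w' * D) y"
proof -
  have "((\<lambda>\<epsilon>. w (f (y + \<epsilon> *\<^sub>R v s))) has_real_derivative w' * D) (at 0)"
    by (rule DERIV_chain2[of w]) (use assms in \<open>simp_all add: has_real_derivative_iff_has_vector_derivative\<close>)
  then show ?thesis by (simp add: has_real_derivative_iff_has_vector_derivative)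
qed

lemma has_partial_scaleR:
  fixes g :: "'a::euclidean_space \<Rightarrow> 'b::real_normed_vector"
  assumes "has_partial v s f D x" "has_partial v s g D' x"
  shows "has_partial v s (\<lambda>x. f x *\<^sub>R g x) (f x *\<^sub>R D' + D *\<^sub>R g x) x"
  using has_vector_derivative_scaleR[OF assms(1)[folded has_real_derivative_iff_has_vector_derivative] assms(2)]
  by simp

lemma has_partial_norm:
  fixes v :: "nat \<Rightarrow> 'a::euclidean_space"
  assumes "y \<noteq> 0"
  shows "has_partial v s norm (y \<bullet> v s / norm y) y"
proof -
  have "has_partial v s (\<lambda>y. sqrt ((norm y)\<^sup>2)) (inverse (sqrt ((norm y)\<^sup>2)) / 2 * (2 * (y \<bullet> v s))) y"
    by (rule has_partial_compose_real[OF has_partial_norm_sq DERIV_real_sqrt]) (use assms in simp)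
  then show ?thesis by (simp add: field_simps)
qed

lemma DERIV_inverse_sqrt_power:
  assumes "t > 0"
  shows "((\<lambda>t. 1 / sqrt t ^ n) has_real_derivative - (real n / (2 * sqrt t ^ (n + 2)))) (at t)"
proof (cases n)
  case (Suc k)
  have "((\<lambda>t. 1 / sqrt t ^ n) has_real_derivative
      - (real n * sqrt t ^ (n - 1) * (inverse (sqrt t) / 2)) / (sqrt t ^ n * sqrt t ^ n)) (at t)"
    using assms by (auto intro!: derivative_eq_intros simp: power2_eq_square)
  moreover have "- (real n * sqrt t ^ (n - 1) * (inverse (sqrt t) / 2)) / (sqrt t ^ n * sqrt t ^ n) =
      - (real n / (2 * sqrt t ^ (n + 2)))"
    using assms by (simp add: Suc field_simps del: real_sqrt_mult_self)
  ultimately show ?thesis by simp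
qed simp

lemma left_monogenic_has_partial:
  "left_monogenic v m G f \<Longrightarrow> s \<le> m \<Longrightarrow> x \<in> G \<Longrightarrow> has_partial v s f (pderiv_dir v s f x) x"
  by (simp add: left_monogenic_def has_partial_pderiv_dir)

lemma left_monogenic_continuous:
  "left_monogenic v m G f \<Longrightarrow> continuous_on G f"
  "left_monogenic v m G f \<Longrightarrow> s \<le> m \<Longrightarrow> continuous_on G (pderiv_dir v s f)"
  by (simp_all add: left_monogenic_def)

text \<open>
  What the analysis needs to know about a hypercomplex basis: the vectors \<open>v s\<close> satisfy the
  multiplication rules of a Clifford system and \<open>M\<close> is stable under conjugation.
\<close>

locale hypercomplex_frame = orthonormal_frame v m M
  for v :: "nat \<Rightarrow> 'a::{real_algebra_1,euclidean_space}" and m :: nat and M :: "'a set" +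
  fixes c :: "'a \<Rightarrow> 'a"
  assumes linear_c: "linear c"
    and c_v_mult_self: "\<And>s. s \<le> m \<Longrightarrow> c (v s) * v s = 1"
    and c_v_mult_anti: "\<And>s t. s \<le> m \<Longrightarrow> t \<le> m \<Longrightarrow> s \<noteq> t \<Longrightarrow> c (v s) * v t + c (v t) * v s = 0"
    and c_in_M: "\<And>x. x \<in> M \<Longrightarrow> c x \<in> M"
begin

lemma bounded_linear_c: "bounded_linear c"
  using linear_c by (simp add: linear_conv_bounded_linear)

sublocale conj: bounded_linear c
  by (rule bounded_linear_c)

lemma continuous_on_conj [continuous_intros]: "continuous_on A f \<Longrightarrow> continuous_on A (\<lambda>x. c (f x))"
  by (rule conj.continuous_on)

text \<open>
  Expanding the product in the frame and adding the same expansion with \<open>s\<close> and \<open>t\<close> exchanged, the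
  mixed terms cancel.
\<close>

lemma c_mult_self:
  assumes "x \<in> M" shows "c x * x = (norm x)\<^sup>2 *\<^sub>R 1"
proof -
  let ?a = "\<lambda>s t. ((x \<bullet> v s) * (x \<bullet> v t)) *\<^sub>R (c (v s) * v t)"
  define y where "y = (\<Sum>j\<le>m. (x \<bullet> v j) *\<^sub>R v j)"
  have xy: "x = y" unfolding y_def by (rule frame_expansion[OF assms])
  have "c y * y = (\<Sum>s\<le>m. \<Sum>t\<le>m. ?a s t)"
    unfolding y_def conj.sum conj.scaleR by (simp add: sum_product mult.commute)
  then have cx: "c x * x = (\<Sum>s\<le>m. \<Sum>t\<le>m. ?a s t)" using xy by simp
  also have "\<dots> = (\<Sum>s\<le>m. \<Sum>t\<le>m. ?a t s)" by (rule sum.swap)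
  finally have "c x * x + c x * x = (\<Sum>s\<le>m. \<Sum>t\<le>m. ?a s t + ?a t s)"
    using cx by (simp add: sum.distrib)
  also have "\<dots> = (\<Sum>s\<le>m. \<Sum>t\<le>m. if t = s then (2 * (x \<bullet> v s)\<^sup>2) *\<^sub>R 1 else 0)"
  proof (intro sum.cong[OF refl])
    fix s t assume "s \<in> {..m}" "t \<in> {..m}"
    then show "?a s t + ?a t s = (if t = s then (2 * (x \<bullet> v s)\<^sup>2) *\<^sub>R 1 else 0)"
    proof (cases "t = s")
      case True
      then show ?thesis
        using c_v_mult_self[OF \<open>s \<in> {..m}\<close>[unfolded atMost_iff]]
        by (simp add: power2_eq_square flip: scaleR_left_distrib)
    next
      case False
      have "?a s t + ?a t s = ((x \<bullet> v s) * (x \<bullet> v t)) *\<^sub>R (c (v s) * v t + c (v t) * v s)"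
        by (simp add: scaleR_add_right mult.commute)
      then show ?thesis
        using False c_v_mult_anti[of s t] \<open>s \<in> {..m}\<close> \<open>t \<in> {..m}\<close> by simp
    qed
  qed
  also have "\<dots> = (2 * (\<Sum>s\<le>m. (x \<bullet> v s)\<^sup>2)) *\<^sub>R 1"
    by (simp add: scaleR_sum_left[symmetric] sum_distrib_left)
  also have "(\<Sum>s\<le>m. (x \<bullet> v s)\<^sup>2) = (norm y)\<^sup>2"
    unfolding y_def by (rule norm_sum_frame[symmetric])
  also have "norm y = norm x" by (simp add: xy)
  finally have "2 *\<^sub>R (c x * x) = 2 *\<^sub>R ((norm x)\<^sup>2 *\<^sub>R 1)"
    by (simp add: scaleR_2)
  from arg_cong[OF this, of "\<lambda>z. (1/2) *\<^sub>R z"] show ?thesis by simp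
qed

lemma sum_c_v_mult_self: "(\<Sum>s\<le>m. c (v s) * v s) = real (m + 1) *\<^sub>R 1"
  by (simp add: c_v_mult_self scaleR_conv_of_real)

lemma has_partial_conj: "has_partial v s c (c (v s)) y"
  unfolding conj.add conj.scaleR by (auto intro!: derivative_eq_intros)

lemma bounded_on_hcball:
  fixes f :: "'a \<Rightarrow> 'a"
  assumes "continuous_on (hcball p R) f"
  obtains K where "K \<ge> 0" "\<And>y. y \<in> hcball p R \<Longrightarrow> norm (f y) \<le> K"
proof -
  obtain K where K: "\<And>y. y \<in> hcball p R \<Longrightarrow> norm (f y) \<le> K"
    using compact_imp_bounded[OF compact_continuous_image[OF assms compact_hcball]]
    by (auto simp: bounded_iff)
  then show ?thesis by (intro that[of "max K 0"]) (auto intro: max.coboundedI1)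
qed

text \<open>
  The divergence theorem for the \<open>A\<close>-valued form \<open>\<psi> dy\<^sup>* f\<close>. Its exterior derivative is the sum of
  the right Dirac operator on \<open>\<psi>\<close> and the left Dirac operator on \<open>f\<close>; for left-monogenic \<open>f\<close> only
  the former survives.
\<close>

lemma gauss_monogenic:
  assumes p: "p \<in> M" and R: "R > 0" and T: "finite T" and G: "hcball p R \<subseteq> G"
    and f: "left_monogenic v m G f"
    and cont: "continuous_on (hcball p R) \<psi>"
    and deriv: "\<And>s x. s \<le> m \<Longrightarrow> x \<in> hball M p R - T \<Longrightarrow> has_partial v s \<psi> (\<psi>' s x) x"
    and cont': "\<And>s. s \<le> m \<Longrightarrow> continuous_on (hball M p R - T) (\<psi>' s)"
    and bound: "\<And>s x. s \<le> m \<Longrightarrow> x \<in> hball M p R \<Longrightarrow> norm (\<psi>' s x) \<le> K s"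
  shows "sphere_integral v m p R \<psi> f = (LINT x:hball M p R|vol. (\<Sum>s\<le>m. \<psi>' s x * v s) * f x)"
proof -
  let ?f' = "\<lambda>s. pderiv_dir v s f"
  let ?F = "\<lambda>s x. \<psi> x * v s * f x" and ?F' = "\<lambda>s x. \<psi>' s x * v s * f x + \<psi> x * v s * ?f' s x"
  have sub: "hball M p R - T \<subseteq> hcball p R" "hball M p R - T \<subseteq> G"
    using hball_subset_hcball[of p R] G by auto
  have fc: "continuous_on (hcball p R) f" "s \<le> m \<Longrightarrow> continuous_on (hcball p R) (?f' s)" for s
    using left_monogenic_continuous[OF f] G by (blast intro: continuous_on_subset)+
  obtain B where B: "B \<ge> 0" "\<And>a b :: 'a. norm (a * b) \<le> norm a * norm b * B"
    using alg_mult.nonneg_bounded by blast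
  (* the norm need not be submultiplicative, whence the constant B *)
  have B3: "norm (a * b * d) \<le> x * y * B * z * B"
    if "norm a \<le> x" "norm b \<le> y" "norm d \<le> z" for a b d :: 'a and x y z
  proof -
    have pos: "0 \<le> x" "0 \<le> y" "0 \<le> z" using that norm_ge_zero order_trans by blast+
    have "norm (a * b) \<le> x * y * B"
      using order_trans[OF B(2)[of a b] mult_right_mono[OF mult_mono[OF that(1,2)] B(1)]] pos by simp
    then show ?thesis
      using order_trans[OF B(2)[of "a * b" d] mult_right_mono[OF mult_mono[OF _ that(3)] B(1)]] pos B(1) by simp
  qed
  have int: "set_integrable vol (hball M p R) (?F' s)"
    and I: "sphere_form_integral v m s p R (?F s) = (LINT x:hball M p R|vol. ?F' s x)" if s: "s \<le> m" for s
  proof -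
    obtain C\<^sub>1 where C\<^sub>1: "\<And>x. x \<in> hcball p R \<Longrightarrow> norm (\<psi> x) \<le> C\<^sub>1"
      using bounded_on_hcball[OF cont] by blast
    obtain C\<^sub>2 where C\<^sub>2: "\<And>x. x \<in> hcball p R \<Longrightarrow> norm (f x) \<le> C\<^sub>2"
      using bounded_on_hcball[OF fc(1)] by blast
    obtain C\<^sub>3 where C\<^sub>3: "\<And>x. x \<in> hcball p R \<Longrightarrow> norm (?f' s x) \<le> C\<^sub>3"
      using bounded_on_hcball[OF fc(2)[OF s]] by blast
    have bF: "norm (?F' s x) \<le> K s * 1 * B * C\<^sub>2 * B + C\<^sub>1 * 1 * B * C\<^sub>3 * B" if "x \<in> hball M p R" for x
      using that hball_subset_hcball[of p R] norm_v[OF s]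
      by (intro norm_triangle_le add_mono B3 bound[OF s] C\<^sub>1 C\<^sub>2 C\<^sub>3) auto
    have cF: "continuous_on (hball M p R - T) (?F' s)"
      by (intro continuous_intros alg_mult.continuous_on cont'[OF s] continuous_on_subset[OF cont sub(1)]
          continuous_on_subset[OF fc(1) sub(1)] continuous_on_subset[OF fc(2)[OF s] sub(1)])
    show "set_integrable vol (hball M p R) (?F' s)"
      by (rule set_integrable_hball[OF p T cF bF])
    show "sphere_form_integral v m s p R (?F s) = (LINT x:hball M p R|vol. ?F' s x)"
    proof (rule divergence_ball[OF p s R T _ _ cF bF])
      show "continuous_on (hcball p R) (?F s)"
        by (intro continuous_intros alg_mult.continuous_on cont fc)
      show "has_partial v s (?F s) (?F' s x) x" if x: "x \<in> hball M p R - T" for x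
      proof -
        have "has_partial v s (\<lambda>x. \<psi> x * v s) (\<psi>' s x * v s + \<psi> x * 0) x"
          by (intro has_partial_mult deriv x s) simp
        moreover have "has_partial v s f (?f' s x) x"
          using left_monogenic_has_partial[OF f s] x sub(2) by blast
        ultimately show ?thesis
          using has_partial_mult[of "\<lambda>x. \<psi> x * v s" x v s _ f] by simp
      qed
    qed
  qed
  have "sphere_integral v m p R \<psi> f = (LINT x:hball M p R|vol. (\<Sum>s\<le>m. ?F' s x))"
    unfolding sphere_integral_def set_lebesgue_integral_def scaleR_sum_right
    by (subst Bochner_Integration.integral_sum)
      (use I int in \<open>auto simp: set_integrable_def set_lebesgue_integral_def intro!: sum.cong\<close>)
  also have "\<dots> = (LINT x:hball M p R|vol. (\<Sum>s\<le>m. \<psi>' s x * v s) * f x)"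
  proof (rule set_lebesgue_integral_cong)
    show "\<forall>x. x \<in> hball M p R \<longrightarrow> (\<Sum>s\<le>m. ?F' s x) = (\<Sum>s\<le>m. \<psi>' s x * v s) * f x"
    proof (intro allI impI)
      fix x assume "x \<in> hball M p R"
      then have "(\<Sum>s\<le>m. v s * ?f' s x) = 0"
        using f G hball_subset_hcball[of p R] by (auto simp: left_monogenic_def dbar_def)
      moreover have "(\<Sum>s\<le>m. ?F' s x) = (\<Sum>s\<le>m. \<psi>' s x * v s) * f x + \<psi> x * (\<Sum>s\<le>m. v s * ?f' s x)"
        by (simp add: sum.distrib sum_distrib_left sum_distrib_right mult.assoc)
      ultimately show "(\<Sum>s\<le>m. ?F' s x) = (\<Sum>s\<le>m. \<psi>' s x * v s) * f x" by simp
    qed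
  qed simp
  finally show ?thesis .
qed

section \<open>Radial kernels and the Cauchy integral formula\<close>

text \<open>The partial derivative of \<open>\<lambda>y. w (norm y) *\<^sub>R c y\<close> off the origin, where \<open>w'\<close> is the derivative of \<open>w\<close>.\<close>

definition radial_partial :: "(real \<Rightarrow> real) \<Rightarrow> (real \<Rightarrow> real) \<Rightarrow> nat \<Rightarrow> 'a \<Rightarrow> 'a" where
  "radial_partial w w' s y = w (norm y) *\<^sub>R c (v s) + (w' (norm y) * (y \<bullet> v s / norm y)) *\<^sub>R c y"

lemma has_partial_radial:
  assumes "y \<noteq> 0" "(w has_real_derivative w' (norm y)) (at (norm y))"
  shows "has_partial v s (\<lambda>y. w (norm y) *\<^sub>R c y) (radial_partial w w' s y) y"
proof -
  have "has_partial v s (\<lambda>y. w (norm y)) (w' (norm y) * (y \<bullet> v s / norm y)) y"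
    by (rule has_partial_compose_real[where f=norm and v=v and s=s and y=y]) (rule has_partial_norm assms)+
  then show ?thesis
    unfolding radial_partial_def
    by (rule has_partial_scaleR[where f="\<lambda>y. w (norm y)" and g=c and v=v and s=s and x=y])
      (rule has_partial_conj)
qed

lemma right_dirac_radial:
  assumes y: "y \<in> M"
  shows "(\<Sum>s\<le>m. radial_partial w w' s y * v s) = (real (m + 1) * w (norm y) + norm y * w' (norm y)) *\<^sub>R 1"
proof -
  have "(\<Sum>s\<le>m. (y \<bullet> v s) *\<^sub>R (c y * v s)) = c y * (\<Sum>s\<le>m. (y \<bullet> v s) *\<^sub>R v s)"
    by (simp add: sum_distrib_left)
  also have "\<dots> = (norm y)\<^sup>2 *\<^sub>R 1"
    using c_mult_self[OF y] by (simp only: frame_expansion[OF y, symmetric])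
  finally have "(\<Sum>s\<le>m. (y \<bullet> v s) *\<^sub>R (c y * v s)) = (norm y)\<^sup>2 *\<^sub>R 1" .
  moreover have "(\<Sum>s\<le>m. radial_partial w w' s y * v s) = w (norm y) *\<^sub>R (\<Sum>s\<le>m. c (v s) * v s) +
      (w' (norm y) / norm y) *\<^sub>R (\<Sum>s\<le>m. (y \<bullet> v s) *\<^sub>R (c y * v s))"
    by (simp add: radial_partial_def distrib_right sum.distrib scaleR_sum_right)
  ultimately show ?thesis
    by (simp only: sum_c_v_mult_self)
      (simp add: scaleR_add_left[symmetric] power2_eq_square mult.commute del: of_nat_add)
qed

text \<open>
  The centre \<open>x\<close> of the radial field need not be the centre of the ball. At \<open>x\<close> itself the field may
  fail to be differentiable, which the exceptional set takes care of.
\<close>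

lemma gauss_radial:
  assumes p: "p \<in> M" and R: "R > 0" and G: "hcball p R \<subseteq> G" and f: "left_monogenic v m G f"
    and x: "x \<in> M" and L: "\<And>y. y \<in> hcball p R \<Longrightarrow> norm (y - x) \<le> L"
    and cont: "continuous_on {0..L} w"
    and deriv: "\<And>r. 0 < r \<Longrightarrow> (w has_real_derivative w' r) (at r)"
    and cont': "continuous_on {0<..} w'"
    and bound: "\<And>r. 0 < r \<Longrightarrow> r \<le> L \<Longrightarrow> \<bar>w' r\<bar> \<le> K"
  shows "sphere_integral v m p R (\<lambda>y. w (norm (y - x)) *\<^sub>R c (y - x)) f =
    (LINT y:hball M p R|vol. (real (m + 1) * w (norm (y - x)) + norm (y - x) * w' (norm (y - x))) *\<^sub>R f y)"
proof -
  have "p \<in> hcball p R" using p R by (simp add: hcball_def)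
  then have L0: "L \<ge> 0" using L norm_ge_zero order_trans by blast
  have "\<exists>B. \<forall>r\<in>{0..L}. \<bar>w r\<bar> \<le> B"
    using compact_imp_bounded[OF compact_continuous_image[OF cont]] by (simp add: bounded_iff)
  then obtain B where B: "\<And>r. r \<in> {0..L} \<Longrightarrow> \<bar>w r\<bar> \<le> B" by blast
  obtain D where D: "D > 0" "\<And>x. norm (c x) \<le> norm x * D" using conj.pos_bounded by blast
  have in_L: "norm (y - x) \<in> {0..L}" if "y \<in> hball M p R" for y
    using L[of y] that hball_subset_hcball by auto
  have "sphere_integral v m p R (\<lambda>y. w (norm (y - x)) *\<^sub>R c (y - x)) f =
      (LINT y:hball M p R|vol. (\<Sum>s\<le>m. radial_partial w w' s (y - x) * v s) * f y)"
  proof (rule gauss_monogenic[OF p R _ G f, where T="{x}" and K="\<lambda>s. B * D + \<bar>K\<bar> * (L * D)"])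
    show "continuous_on (hcball p R) (\<lambda>y. w (norm (y - x)) *\<^sub>R c (y - x))"
      by (intro continuous_intros continuous_on_compose2[OF cont]) (use L in auto)
    fix s assume s: "s \<le> m"
    show "continuous_on (hball M p R - {x}) (\<lambda>y. radial_partial w w' s (y - x))"
      unfolding radial_partial_def
      by (intro continuous_intros continuous_on_compose2[OF cont] continuous_on_compose2[OF cont'])
        (use in_L in auto)
    show "has_partial v s (\<lambda>y. w (norm (y - x)) *\<^sub>R c (y - x)) (radial_partial w w' s (y - x)) y"
      if "y \<in> hball M p R - {x}" for y
      by (rule has_partial_translate[where f="\<lambda>y. w (norm y) *\<^sub>R c y"], rule has_partial_radial, use that in simp,
          rule deriv, use that in simp)
    show "norm (radial_partial w w' s (y - x)) \<le> B * D + \<bar>K\<bar> * (L * D)" if y: "y \<in> hball M p R" for y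
      unfolding radial_partial_def norm_scaleR
    proof (rule norm_triangle_le, rule add_mono)
      show "norm (w (norm (y - x)) *\<^sub>R c (v s)) \<le> B * D"
        unfolding norm_scaleR using B[OF in_L[OF y]] D(2)[of "v s"] norm_v[OF s] by (intro mult_mono) auto
      show "norm ((w' (norm (y - x)) * ((y - x) \<bullet> v s / norm (y - x))) *\<^sub>R c (y - x)) \<le> \<bar>K\<bar> * (L * D)"
      proof (cases "y = x")
        case False
        have "\<bar>(y - x) \<bullet> v s / norm (y - x)\<bar> \<le> 1"
          using Cauchy_Schwarz_ineq2[of "y - x" "v s"] norm_v[OF s] by (simp add: divide_le_eq)
        moreover have "norm (c (y - x)) \<le> L * D"
          using order_trans[OF D(2) mult_right_mono[of _ L D]] in_L[OF y] D(1) by simp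
        moreover have "\<bar>w' (norm (y - x))\<bar> \<le> \<bar>K\<bar>"
          using bound[of "norm (y - x)"] in_L[OF y] False by force
        ultimately have "\<bar>w' (norm (y - x))\<bar> * \<bar>(y - x) \<bullet> v s / norm (y - x)\<bar> * norm (c (y - x)) \<le> \<bar>K\<bar> * 1 * (L * D)"
          by (intro mult_mono) auto
        then show ?thesis by (simp add: abs_mult)
      qed (use L0 D in \<open>simp add: conj.zero\<close>)
    qed
  qed simp
  also have "\<dots> = (LINT y:hball M p R|vol.
      (real (m + 1) * w (norm (y - x)) + norm (y - x) * w' (norm (y - x))) *\<^sub>R f y)"
  proof (rule set_lebesgue_integral_cong)
    have "y - x \<in> M" if "y \<in> hball M p R" for y
      using that x by (auto simp: hball_def intro: subspace_diff[OF subspace_M])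
    then show "\<forall>y. y \<in> hball M p R \<longrightarrow> (\<Sum>s\<le>m. radial_partial w w' s (y - x) * v s) * f y =
        (real (m + 1) * w (norm (y - x)) + norm (y - x) * w' (norm (y - x))) *\<^sub>R f y"
      by (simp add: right_dirac_radial)
  qed simp
  finally show ?thesis .
qed

lemma left_monogenic_const: "left_monogenic v m M (\<lambda>_. a)"
proof -
  have "pderiv_dir v s (\<lambda>_. a) x = 0" "has_pderiv_dir v s (\<lambda>_. a) x" for s x
    by (rule pderiv_dir_eq[of "\<lambda>_. a" x v s] has_partial_imp_has_pderiv_dir[of "\<lambda>_. a" x v s 0], simp)+
  then have "pderiv_dir v s (\<lambda>_. a) = (\<lambda>_. 0)" "has_pderiv_dir v s (\<lambda>_. a) x" for s x
    by auto
  then show ?thesis by (simp add: left_monogenic_def dbar_def)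
qed

text \<open>
  Subtracting the constant \<open>w R\<close> makes the radial field vanish on the sphere, so its divergence
  integrates to zero; the constant contributes a multiple of the volume of the ball.
\<close>

lemma radial_integral:
  fixes w w' :: "real \<Rightarrow> real"
  assumes p: "p \<in> M" and R: "R > 0"
    and cont: "continuous_on {0..R} w"
    and deriv: "\<And>r. 0 < r \<Longrightarrow> (w has_real_derivative w' r) (at r)"
    and cont': "continuous_on {0<..} w'"
    and bound: "\<And>r. 0 < r \<Longrightarrow> r \<le> R \<Longrightarrow> \<bar>w' r\<bar> \<le> K"
  shows "set_integrable vol (hball M p R) (\<lambda>x. real (m + 1) * w (norm (x - p)) + norm (x - p) * w' (norm (x - p)))"
    and "(LINT x:hball M p R|vol. real (m + 1) * w (norm (x - p)) + norm (x - p) * w' (norm (x - p)))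
      = w R * sigma m * R ^ (m + 1)"
proof -
  let ?h = "\<lambda>x. real (m + 1) * w (norm (x - p)) + norm (x - p) * w' (norm (x - p))"
  have "\<exists>B. \<forall>r\<in>{0..R}. \<bar>w r\<bar> \<le> B"
    using compact_imp_bounded[OF compact_continuous_image[OF cont]] by (simp add: bounded_iff)
  then obtain B where B: "\<And>r. r \<in> {0..R} \<Longrightarrow> \<bar>w r\<bar> \<le> B" by blast
  show int: "set_integrable vol (hball M p R) ?h"
  proof (rule set_integrable_hball[OF p, where T="{p}" and K="real (m + 1) * B + R * \<bar>K\<bar>"])
    show "continuous_on (hball M p R - {p}) ?h"
      by (intro continuous_intros continuous_on_compose2[OF cont] continuous_on_compose2[OF cont'])
        (auto simp: hball_def)
    fix x assume "x \<in> hball M p R"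
    then have r: "norm (x - p) < R" by (simp add: hball_def)
    show "norm (?h x) \<le> real (m + 1) * B + R * \<bar>K\<bar>"
    proof (intro norm_triangle_le add_mono)
      show "norm (real (m + 1) * w (norm (x - p))) \<le> real (m + 1) * B"
        unfolding norm_mult using B[of "norm (x - p)"] r by (intro mult_mono) auto
      show "norm (norm (x - p) * w' (norm (x - p))) \<le> R * \<bar>K\<bar>"
        unfolding norm_mult using bound[of "norm (x - p)"] r R
        by (cases "x = p") (auto intro!: mult_mono)
    qed
  qed simp
  have fm: "emeasure vol (hball M p R) < \<infinity>" by (rule emeasure_hball_finite[OF p])
  have const: "set_integrable vol (hball M p R) (\<lambda>x. real (m + 1) * w R)"
    using fm by (simp add: set_integrable_def)
  have "(LINT x:hball M p R|vol. (real (m + 1) * (w (norm (x - p)) - w R) + norm (x - p) * w' (norm (x - p))) *\<^sub>R (1::'a)) =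
      sphere_integral v m p R (\<lambda>x. (w (norm (x - p)) - w R) *\<^sub>R c (x - p)) (\<lambda>_. 1)"
    by (rule gauss_radial[OF p R _ left_monogenic_const p, where w="\<lambda>r. w r - w R" and L=R, symmetric])
      (use cont cont' bound in \<open>auto simp: hcball_def intro!: continuous_intros derivative_eq_intros deriv\<close>)
  also have "\<dots> = (\<Sum>s\<le>m. sphere_form_integral v m s p R (\<lambda>_. 0))"
    unfolding sphere_integral_def
    by (intro sum.cong refl sphere_form_integral_cong[OF p _ R]) (auto simp: hsphere_def)
  also have "\<dots> = 0" using sphere_form_integral_scaleR[of _ p R 0 "\<lambda>_. 0"] by simp
  finally have "(LINT x:hball M p R|vol. (?h x - real (m + 1) * w R) *\<^sub>R (1::'a)) = 0"
    by (simp add: algebra_simps)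
  then have "(LINT x:hball M p R|vol. ?h x - real (m + 1) * w R) *\<^sub>R (1::'a) = 0"
    using integral_scaleR_left[of "1::'a" vol "\<lambda>x. indicator (hball M p R) x *\<^sub>R (?h x - real (m + 1) * w R)"]
      set_integral_diff(1)[OF int const] by (simp add: set_lebesgue_integral_def set_integrable_def)
  then have "(LINT x:hball M p R|vol. ?h x) = (LINT x:hball M p R|vol. real (m + 1) * w R)"
    using set_integral_diff(2)[OF int const] by simp
  also have "\<dots> = w R * sigma m * R ^ (m + 1)"
    using fm measure_hball[OF p R] by (simp add: sigma_eq_sphere_area set_lebesgue_integral_def)
  finally show "(LINT x:hball M p R|vol. ?h x) = w R * sigma m * R ^ (m + 1)" .
qed

text \<open>
  For \<open>e = 0\<close> the weight gives the Cauchy kernel \<open>\<lambda>y. cauchy_weight 0 (norm y) *\<^sub>R c y\<close>; for \<open>e > 0\<close>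
  the singularity is removed, and the right Dirac operator turns the kernel into a nonnegative
  scalar function that concentrates at the origin as \<open>e \<rightarrow> 0\<close>.
\<close>

definition cauchy_weight :: "real \<Rightarrow> real \<Rightarrow> real" where
  "cauchy_weight e r = 1 / sigma m * (1 / sqrt (r\<^sup>2 + e) ^ (m + 1))"

definition cauchy_weight' :: "real \<Rightarrow> real \<Rightarrow> real" where
  "cauchy_weight' e r = 1 / sigma m * (- (real (m + 1) / (2 * sqrt (r\<^sup>2 + e) ^ (m + 1 + 2))) * (2 * r))"

definition mollifier :: "real \<Rightarrow> real \<Rightarrow> real" where
  "mollifier e r = real (m + 1) * e / (sigma m * sqrt (r\<^sup>2 + e) ^ (m + 3))"

lemma cauchy_kernel_eq: "cauchy_kernel c m y = cauchy_weight 0 (norm y) *\<^sub>R c y"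
  by (simp add: cauchy_kernel_def cauchy_weight_def)

lemma DERIV_cauchy_weight:
  assumes "r\<^sup>2 + e > 0"
  shows "(cauchy_weight e has_real_derivative cauchy_weight' e r) (at r)"
  unfolding cauchy_weight_def[abs_def] cauchy_weight'_def
proof (intro DERIV_cmult)
  show "((\<lambda>t. 1 / sqrt (t\<^sup>2 + e) ^ (m + 1)) has_real_derivative
      - (real (m + 1) / (2 * sqrt (r\<^sup>2 + e) ^ (m + 1 + 2))) * (2 * r)) (at r)"
    by (rule DERIV_chain2[where f="\<lambda>t. 1 / sqrt t ^ (m + 1)" and g="\<lambda>t. t\<^sup>2 + e",
          OF DERIV_inverse_sqrt_power[OF assms]]) (auto intro!: derivative_eq_intros)
qed

lemma mollifier_eq:
  assumes "r\<^sup>2 + e > 0"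
  shows "real (m + 1) * cauchy_weight e r + r * cauchy_weight' e r = mollifier e r"
proof -
  let ?q = "sqrt (r\<^sup>2 + e)"
  have q: "?q ^ (m + 3) = ?q ^ (m + 1) * (r\<^sup>2 + e)" "?q ^ (m + 1) \<noteq> 0"
    using assms by (simp_all add: power_add power2_eq_square power3_eq_cube)
  have "n * (1 / a * (1 / b)) + r * (1 / a * (- (n / (2 * d)) * (2 * r))) = n / a * (1 / b - r\<^sup>2 / d)"
    for n a b d :: real
    by (simp add: right_diff_distrib power2_eq_square)
  moreover have "m + 1 + 2 = m + 3" by simp
  ultimately have "real (m + 1) * cauchy_weight e r + r * cauchy_weight' e r =
      real (m + 1) / sigma m * (1 / ?q ^ (m + 1) - r\<^sup>2 / ?q ^ (m + 3))"
    unfolding cauchy_weight_def cauchy_weight'_def by (simp only:)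
  also have "1 / ?q ^ (m + 1) - r\<^sup>2 / ?q ^ (m + 3) = e / ?q ^ (m + 3)"
    unfolding q(1) using assms q(2) by (simp add: divide_simps)
  finally show ?thesis by (simp add: mollifier_def)
qed

lemma continuous_on_cauchy_weight:
  assumes "\<And>r. r \<in> A \<Longrightarrow> r\<^sup>2 + e > 0"
  shows "continuous_on A (cauchy_weight e)" "continuous_on A (cauchy_weight' e)" "continuous_on A (mollifier e)"
proof -
  have nz: "r\<^sup>2 + e \<noteq> 0" if "r \<in> A" for r using assms[OF that] by simp
  have "sigma m \<noteq> 0" using sigma_pos[of m] by simp
  then show "continuous_on A (cauchy_weight e)" "continuous_on A (cauchy_weight' e)" "continuous_on A (mollifier e)"
    unfolding cauchy_weight_def[abs_def] cauchy_weight'_def[abs_def] mollifier_def[abs_def]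
    by (auto intro!: continuous_intros dest: nz)
qed

lemma cauchy_weight_nonneg: "e \<ge> 0 \<Longrightarrow> cauchy_weight e r \<ge> 0"
  and mollifier_nonneg: "e \<ge> 0 \<Longrightarrow> mollifier e r \<ge> 0"
  using sigma_pos[of m] by (simp_all add: cauchy_weight_def mollifier_def)

lemma cauchy_weight_le: "r > 0 \<Longrightarrow> e \<ge> 0 \<Longrightarrow> cauchy_weight e r \<le> cauchy_weight 0 r"
  unfolding cauchy_weight_def using sigma_pos[of m]
  by (intro mult_left_mono divide_left_mono power_mono mult_pos_pos zero_less_power)
    (auto simp: add_pos_nonneg real_le_rsqrt)

lemma mollifier_le:
  assumes "e \<ge> 0" "0 < t" "t \<le> sqrt (r\<^sup>2 + e)"
  shows "mollifier e r \<le> real (m + 1) * e / (sigma m * t ^ (m + 3))"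
proof -
  have "0 < sqrt (r\<^sup>2 + e)" using assms by linarith
  then show ?thesis
    unfolding mollifier_def using assms sigma_pos[of m]
    by (intro divide_left_mono mult_left_mono mult_pos_pos zero_less_power power_mono) auto
qed

text \<open>
  Being a divergence, the mollifier has a mass that is determined by the regularised weight on the
  sphere; it tends to \<open>1\<close> as \<open>e \<rightarrow> 0\<close>.
\<close>

lemma mollifier_mass:
  assumes x: "x \<in> M" and r: "r > 0" and e: "e > 0"
  shows "set_integrable vol (hball M x r) (\<lambda>y. mollifier e (norm (y - x)))"
    and "(LINT y:hball M x r|vol. mollifier e (norm (y - x))) = (r / sqrt (r\<^sup>2 + e)) ^ (m + 1)"
proof -
  have pos: "t\<^sup>2 + e > 0" for t :: real using e by (simp add: add_nonneg_pos)
  have "\<exists>K. \<forall>t\<in>{0..r}. \<bar>cauchy_weight' e t\<bar> \<le> K"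
    using compact_imp_bounded[OF compact_continuous_image[OF continuous_on_cauchy_weight(2)[OF pos], of "{0..r}"]]
    by (simp add: bounded_iff)
  then obtain K where K: "\<And>t. t \<in> {0..r} \<Longrightarrow> \<bar>cauchy_weight' e t\<bar> \<le> K" by blast
  have "cauchy_weight e r * sigma m * r ^ (m + 1) = (r / sqrt (r\<^sup>2 + e)) ^ (m + 1)"
    unfolding cauchy_weight_def using sigma_pos[of m] by (simp add: power_divide)
  moreover note radial_integral[OF x r continuous_on_cauchy_weight(1)[OF pos] DERIV_cauchy_weight[OF pos]
      continuous_on_cauchy_weight(2)[OF pos], of K, unfolded mollifier_eq[OF pos]]
  ultimately show "set_integrable vol (hball M x r) (\<lambda>y. mollifier e (norm (y - x)))"
    "(LINT y:hball M x r|vol. mollifier e (norm (y - x))) = (r / sqrt (r\<^sup>2 + e)) ^ (m + 1)"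
    using K by auto
qed

lemma norm_set_integral_le:
  fixes h :: "'b::euclidean_space \<Rightarrow> 'c::euclidean_space"
  assumes "set_integrable N A h" "set_integrable N A g" "\<And>x. x \<in> A \<Longrightarrow> norm (h x) \<le> g x"
  shows "norm (LINT x:A|N. h x) \<le> (LINT x:A|N. g x)"
  unfolding set_lebesgue_integral_def
  by (rule Bochner_Integration.integral_norm_bound_integral)
     (use assms in \<open>auto simp: set_integrable_def indicator_def\<close>)

text \<open>
  Near \<open>x\<close> the factor \<open>f y - f x\<close> is small, away from \<open>x\<close> the mollifier is; the mass of the mollifier
  on the ball about \<open>p\<close> is squeezed between its masses on two balls about \<open>x\<close>.
\<close>

lemma mollifier_approximates_identity:
  fixes f :: "'a \<Rightarrow> 'a"
  assumes p: "p \<in> M" and R: "R > 0" and x: "x \<in> hball M p R" and f: "continuous_on (hcball p R) f"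
    and e: "\<And>n. e n > 0" "e \<longlonglongrightarrow> 0"
  shows "(\<lambda>n. LINT y:hball M p R|vol. mollifier (e n) (norm (y - x)) *\<^sub>R f y) \<longlonglongrightarrow> f x"
proof -
  let ?A = "hball M p R" and ?\<delta> = "\<lambda>n y. mollifier (e n) (norm (y - x))"
  have xM: "x \<in> M" "norm (x - p) < R" using x by (auto simp: hball_def)
  have A: "?A \<in> fmeasurable vol" using emeasure_hball_finite[OF p] by (intro fmeasurableI) auto
  obtain C where C: "C \<ge> 0" "\<And>y. y \<in> hcball p R \<Longrightarrow> norm (f y) \<le> C"
    using bounded_on_hcball[OF f] by blast
  have xc: "x \<in> hcball p R" using x hball_subset_hcball by blast
  have sub2: "?A \<subseteq> hball M x (2 * R)"
  proof
    fix y assume "y \<in> ?A"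
    then show "y \<in> hball M x (2 * R)"
      using norm_triangle_ineq4[of "y - p" "x - p"] xM by (auto simp: hball_def)
  qed
  have int\<delta>: "set_integrable vol ?A (?\<delta> n)" for n
    by (rule set_integrable_subset[OF mollifier_mass(1)[OF xM(1), of "2 * R"]]) (use R e sub2 in auto)
  have int: "set_integrable vol ?A (\<lambda>y. ?\<delta> n y *\<^sub>R g y)"
    if g: "continuous_on ?A g" "\<And>y. y \<in> ?A \<Longrightarrow> norm (g y) \<le> B" for n B and g :: "'a \<Rightarrow> 'a"
  proof (rule set_integrable_hball[OF p, of "{}" _ _ "real (m + 1) * e n / (sigma m * sqrt (e n) ^ (m + 3)) * \<bar>B\<bar>"])
    have pos: "t\<^sup>2 + e n > 0" for t :: real using e(1) by (simp add: add_nonneg_pos)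
    show "continuous_on (?A - {}) (\<lambda>y. ?\<delta> n y *\<^sub>R g y)"
      using g(1) by (auto intro!: continuous_intros continuous_on_compose2[OF continuous_on_cauchy_weight(3)[OF pos, of UNIV]])
    show "norm (?\<delta> n y *\<^sub>R g y) \<le> real (m + 1) * e n / (sigma m * sqrt (e n) ^ (m + 3)) * \<bar>B\<bar>" if "y \<in> ?A" for y
      unfolding norm_scaleR using g(2)[OF that] mollifier_nonneg[of "e n"] e(1)[of n]
        mollifier_le[of "e n" "sqrt (e n)" "norm (y - x)"] sigma_pos[of m] by (intro mult_mono) auto
  qed simp
  have "\<exists>no. \<forall>n\<ge>no. norm ((LINT y:?A|vol. ?\<delta> n y *\<^sub>R f y) - f x) < \<eta>" if \<eta>: "\<eta> > 0" for \<eta>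
  proof -
    obtain d where d: "d > 0" "\<And>y. y \<in> hcball p R \<Longrightarrow> norm (y - x) < d \<Longrightarrow> norm (f y - f x) < \<eta> / 2"
      using f xc half_gt_zero[OF \<eta>] unfolding continuous_on_iff dist_norm by blast
    define r where "r = min d (R - norm (x - p))"
    have r: "r > 0" "r \<le> d" using d xM by (auto simp: r_def)
    have sub1: "hball M x r \<subseteq> ?A"
    proof
      fix y assume "y \<in> hball M x r"
      then show "y \<in> ?A"
        using norm_triangle_ineq[of "y - x" "x - p"] by (auto simp: hball_def r_def)
    qed
    let ?\<theta> = "\<lambda>n. (r / sqrt (r\<^sup>2 + e n)) ^ (m + 1)" and ?b = "\<lambda>n. real (m + 1) * e n / (sigma m * r ^ (m + 3)) * (2 * C)"
    let ?V = "measure vol ?A"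
    have est: "norm ((LINT y:?A|vol. ?\<delta> n y *\<^sub>R f y) - f x) \<le> \<eta> / 2 + ?b n * ?V + (1 - ?\<theta> n) * norm (f x)" for n
    proof -
      define a where "a = (LINT y:?A|vol. ?\<delta> n y)"
      have en: "e n \<ge> 0" using e(1)[of n] by simp
      have mono: "(LINT y:X|vol. ?\<delta> n y) \<le> (LINT y:Y|vol. ?\<delta> n y)"
        if "X \<subseteq> Y" "set_integrable vol Y (?\<delta> n)" "X \<in> sets vol" for X Y
        unfolding set_lebesgue_integral_def
        using that set_integrable_subset[OF that(2,3,1)] mollifier_nonneg[OF en]
        by (intro integral_mono) (auto simp: set_integrable_def indicator_def)
      have "?\<theta> n \<le> a"
        using mono[OF sub1 int\<delta>] mollifier_mass(2)[OF xM(1) r(1) e(1)] by (simp add: a_def)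
      moreover have "a \<le> (2 * R / sqrt ((2 * R)\<^sup>2 + e n)) ^ (m + 1)"
        using mono[OF sub2 mollifier_mass(1)[OF xM(1) _ e(1)]] mollifier_mass(2)[OF xM(1) _ e(1), of "2 * R"] R
        by (simp add: a_def)
      moreover have "(2 * R / sqrt ((2 * R)\<^sup>2 + e n)) ^ (m + 1) \<le> 1"
        using R en by (intro power_le_one) (auto simp: divide_le_eq_1 real_le_rsqrt add_pos_nonneg)
      ultimately have a: "a \<le> 1" "1 - a \<le> 1 - ?\<theta> n" by auto
      have fc: "continuous_on ?A f" by (rule continuous_on_subset[OF f hball_subset_hcball])
      have fC: "norm (f y) \<le> C" if "y \<in> ?A" for y using C(2) that hball_subset_hcball by blast
      have i1: "set_integrable vol ?A (\<lambda>y. ?\<delta> n y *\<^sub>R f y)" by (rule int[OF fc fC])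
      have i2: "set_integrable vol ?A (\<lambda>y. ?\<delta> n y *\<^sub>R f x)" by (rule int) auto
      have i3: "set_integrable vol ?A (\<lambda>y. ?\<delta> n y * (\<eta> / 2))"
        by (rule set_integrable_mult_left[OF int\<delta>])
      have i4: "set_integrable vol ?A (\<lambda>y. ?b n)"
        using A by (simp add: set_integrable_def fmeasurable_def)
      have "a *\<^sub>R f x = (LINT y:?A|vol. ?\<delta> n y *\<^sub>R f x)"
        unfolding a_def set_lebesgue_integral_def
        using integral_scaleR_left[of "f x" vol "\<lambda>y. indicat_real ?A y *\<^sub>R ?\<delta> n y"] int\<delta>[of n]
        by (simp add: set_integrable_def)
      then have "norm ((LINT y:?A|vol. ?\<delta> n y *\<^sub>R f y) - a *\<^sub>R f x) =
          norm (LINT y:?A|vol. ?\<delta> n y *\<^sub>R f y - ?\<delta> n y *\<^sub>R f x)"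
        using set_integral_diff(2)[OF i1 i2] by simp
      also have "\<dots> \<le> (LINT y:?A|vol. ?\<delta> n y * (\<eta> / 2) + ?b n)"
      proof (rule norm_set_integral_le)
        show "set_integrable vol ?A (\<lambda>y. ?\<delta> n y * (\<eta> / 2) + ?b n)"
          by (rule set_integral_add(1)[OF i3 i4])
        fix y assume y: "y \<in> ?A"
        then have yc: "y \<in> hcball p R" using hball_subset_hcball by blast
        have "norm (?\<delta> n y *\<^sub>R f y - ?\<delta> n y *\<^sub>R f x) = ?\<delta> n y * norm (f y - f x)"
          using mollifier_nonneg[OF en] by (simp add: scaleR_diff_right[symmetric])
        also have "\<dots> \<le> ?\<delta> n y * (\<eta> / 2) + ?b n"
        proof (cases "norm (y - x) < r")
          case True
          then have "?\<delta> n y * norm (f y - f x) \<le> ?\<delta> n y * (\<eta> / 2)"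
            using d(2)[OF yc] r(2) mollifier_nonneg[OF en] by (intro mult_left_mono) auto
          moreover have "?b n \<ge> 0" using C(1) en r sigma_pos[of m] by simp
          ultimately show ?thesis by linarith
        next
          case False
          then have "r \<le> sqrt ((norm (y - x))\<^sup>2 + e n)" using en r by (intro real_le_rsqrt) (simp add: power_mono add_increasing2)
          then have "?\<delta> n y * norm (f y - f x) \<le> ?b n"
            using mollifier_le[OF en r(1)] norm_triangle_ineq4[of "f y" "f x"] C(2)[OF yc] C(2)[OF xc] C(1)
              mollifier_nonneg[OF en] sigma_pos[of m] r(1) en by (intro mult_mono) auto
          moreover have "0 \<le> ?\<delta> n y * (\<eta> / 2)" using mollifier_nonneg[OF en] \<eta> by simp
          ultimately show ?thesis by linarith
        qed
        finally show "norm (?\<delta> n y *\<^sub>R f y - ?\<delta> n y *\<^sub>R f x) \<le> ?\<delta> n y * (\<eta> / 2) + ?b n" .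
      qed (rule set_integral_diff(1)[OF i1 i2])
      also have "\<dots> = a * (\<eta> / 2) + ?b n * ?V"
        unfolding a_def set_integral_add(2)[OF i3 i4]
        using A by (simp add: set_lebesgue_integral_def fmeasurable_def)
      also have "\<dots> \<le> \<eta> / 2 + ?b n * ?V" using a(1) \<eta> by simp
      finally have "norm ((LINT y:?A|vol. ?\<delta> n y *\<^sub>R f y) - a *\<^sub>R f x) \<le> \<eta> / 2 + ?b n * ?V" .
      moreover have "norm (a *\<^sub>R f x - f x) = (1 - a) * norm (f x)"
        using a(1) by (simp add: norm_minus_commute[of "a *\<^sub>R f x"] flip: scaleR_left_diff_distrib[of 1 a "f x", simplified])
      moreover have "(1 - a) * norm (f x) \<le> (1 - ?\<theta> n) * norm (f x)" using a(2) by (rule mult_right_mono) simp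
      ultimately show ?thesis
        using norm_triangle_ineq[of "(LINT y:?A|vol. ?\<delta> n y *\<^sub>R f y) - a *\<^sub>R f x" "a *\<^sub>R f x - f x"] by simp
    qed
    have "(\<lambda>n. \<eta> / 2 + ?b n * ?V + (1 - ?\<theta> n) * norm (f x)) \<longlonglongrightarrow>
        \<eta> / 2 + real (m + 1) * 0 / (sigma m * r ^ (m + 3)) * (2 * C) * ?V
        + (1 - (r / sqrt (r\<^sup>2 + 0)) ^ (m + 1)) * norm (f x)"
      using r sigma_pos[of m] by (intro tendsto_intros e) auto
    then have "(\<lambda>n. \<eta> / 2 + ?b n * ?V + (1 - ?\<theta> n) * norm (f x)) \<longlonglongrightarrow> \<eta> / 2"
      using r by simp
    then have "eventually (\<lambda>n. \<eta> / 2 + ?b n * ?V + (1 - ?\<theta> n) * norm (f x) < \<eta>) sequentially"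
      by (rule order_tendstoD) (use \<eta> in simp)
    then show ?thesis
      using est unfolding eventually_sequentially by (meson le_less_trans)
  qed
  then show ?thesis unfolding LIMSEQ_iff by blast
qed

text \<open>Dominated convergence for the first factor.\<close>

lemma sphere_integral_tendsto:
  assumes p: "p \<in> M" and R: "R > 0"
    and f: "\<And>n. continuous_on (hsphere M p R) (\<psi> n)" "continuous_on (hsphere M p R) \<theta>"
      "continuous_on (hsphere M p R) f"
    and bd: "\<And>n y. y \<in> hsphere M p R \<Longrightarrow> norm (\<psi> n y) \<le> K"
    and lim: "\<And>y. y \<in> hsphere M p R \<Longrightarrow> (\<lambda>n. \<psi> n y) \<longlonglongrightarrow> \<theta> y"
  shows "(\<lambda>n. sphere_integral v m p R (\<psi> n) f) \<longlonglongrightarrow> sphere_integral v m p R \<theta> f"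
  unfolding sphere_integral_def
proof (rule tendsto_sum)
  fix s assume "s \<in> {..m}"
  then have s: "s \<le> m" by simp
  obtain B where B: "B \<ge> 0" "\<And>a b :: 'a. norm (a * b) \<le> norm a * norm b * B"
    using alg_mult.nonneg_bounded by blast
  obtain C where C: "\<And>y. y \<in> hsphere M p R \<Longrightarrow> norm (v s * f y) \<le> C"
    using bounded_on_hsphere[OF alg_mult.continuous_on[OF continuous_on_const f(3)]] by blast
  show "(\<lambda>n. sphere_form_integral v m s p R (\<lambda>y. \<psi> n y * v s * f y))
      \<longlonglongrightarrow> sphere_form_integral v m s p R (\<lambda>y. \<theta> y * v s * f y)"
  proof (rule sphere_form_integral_tendsto[OF p s R, where K="K * C * B"])
    show "norm (\<psi> n y * v s * f y) \<le> K * C * B" if "y \<in> hsphere M p R" for n y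
    proof -
      have "norm (\<psi> n y * v s * f y) \<le> norm (\<psi> n y) * norm (v s * f y) * B"
        using B(2)[of "\<psi> n y" "v s * f y"] by (simp add: mult.assoc)
      also have "\<dots> \<le> K * C * B"
        using bd[OF that, of n] C[OF that] B(1) norm_ge_zero[of "\<psi> n y"]
        by (intro mult_right_mono mult_mono) (auto intro: order_trans[OF norm_ge_zero])
      finally show ?thesis .
    qed
  qed (intro continuous_intros alg_mult.continuous_on alg_mult.tendsto f tendsto_const lim; assumption)+
qed

text \<open>
  Gauss' theorem for the regularised kernel represents a mollification of \<open>f\<close> as a boundary
  integral; let the regularisation tend to zero.
\<close>

theorem cauchy_integral_formula:
  assumes p: "p \<in> M" and R: "R > 0" and G: "hcball p R \<subseteq> G"
    and f: "left_monogenic v m G f" and x: "x \<in> hball M p R"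
  shows "sphere_integral v m p R (\<lambda>y. cauchy_kernel c m (y - x)) f = f x"
proof -
  define e where "e n = 1 / real (Suc n)" for n
  have e: "e n > 0" for n by (simp add: e_def)
  have e0: "e \<longlonglongrightarrow> 0" unfolding e_def using LIMSEQ_Suc[OF lim_1_over_n] by simp
  have pos: "t\<^sup>2 + e n > 0" for t n using e[of n] by (simp add: add_nonneg_pos)
  have fc: "continuous_on (hcball p R) f"
    by (rule continuous_on_subset[OF left_monogenic_continuous(1)[OF f] G])
  let ?E = "\<lambda>n y. cauchy_weight (e n) (norm (y - x)) *\<^sub>R c (y - x)"
  have nx: "norm (y - x) > 0" if "y \<in> hsphere M p R" for y
    using that x by (auto simp: hball_def hsphere_def)
  have cE: "continuous_on (hsphere M p R) (\<lambda>y. cauchy_kernel c m (y - x))"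
    unfolding cauchy_kernel_eq
    by (intro continuous_intros continuous_on_compose2[OF continuous_on_cauchy_weight(1), of "{0<..}"])
      (use nx in auto)
  obtain K where K: "\<And>y. y \<in> hsphere M p R \<Longrightarrow> norm (cauchy_kernel c m (y - x)) \<le> K"
    using bounded_on_hsphere[OF cE] by blast
  have "(\<lambda>n. sphere_integral v m p R (?E n) f) \<longlonglongrightarrow> sphere_integral v m p R (\<lambda>y. cauchy_kernel c m (y - x)) f"
  proof (rule sphere_integral_tendsto[OF p R _ cE, where K=K])
    show "continuous_on (hsphere M p R) (?E n)" for n
      by (intro continuous_intros continuous_on_compose2[OF continuous_on_cauchy_weight(1)[OF pos, of UNIV]]) auto
    show "continuous_on (hsphere M p R) f"
      by (rule continuous_on_subset[OF fc hsphere_subset_hcball])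
    fix y assume y: "y \<in> hsphere M p R"
    show "norm (?E n y) \<le> K" for n
    proof -
      have "norm (?E n y) \<le> norm (cauchy_kernel c m (y - x))"
        unfolding cauchy_kernel_eq norm_scaleR
        using cauchy_weight_le[OF nx[OF y], of "e n"] cauchy_weight_nonneg[of "e n"] cauchy_weight_nonneg[of 0] e[of n]
        by (intro mult_right_mono) auto
      then show ?thesis using K[OF y] by linarith
    qed
    show "(\<lambda>n. ?E n y) \<longlonglongrightarrow> cauchy_kernel c m (y - x)"
      unfolding cauchy_kernel_eq cauchy_weight_def
      using nx[OF y] by (intro tendsto_intros e0) auto
  qed
  moreover have "sphere_integral v m p R (?E n) f = (LINT y:hball M p R|vol. mollifier (e n) (norm (y - x)) *\<^sub>R f y)" for n
  proof -
    have "\<exists>K. \<forall>t\<in>{0..2 * R}. \<bar>cauchy_weight' (e n) t\<bar> \<le> K"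
      using compact_imp_bounded[OF compact_continuous_image[OF continuous_on_cauchy_weight(2)[OF pos], of "{0..2 * R}"]]
      by (simp add: bounded_iff)
    then obtain K where K: "\<And>t. t \<in> {0..2 * R} \<Longrightarrow> \<bar>cauchy_weight' (e n) t\<bar> \<le> K" by blast
    have L: "norm (y - x) \<le> 2 * R" if "y \<in> hcball p R" for y
      using norm_triangle_ineq4[of "y - p" "x - p"] that x by (simp add: hcball_def hball_def)
    have xM: "x \<in> M" using x by (simp add: hball_def)
    show ?thesis
      unfolding mollifier_eq[OF pos, symmetric]
      by (rule gauss_radial[OF p R G f xM L continuous_on_cauchy_weight(1)[OF pos] DERIV_cauchy_weight[OF pos]
          continuous_on_cauchy_weight(2)[OF pos], where K=K]) (use K in auto)
  qed
  ultimately show ?thesis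
    using mollifier_approximates_identity[OF p R x fc e e0] LIMSEQ_unique by fastforce
qed

end

section \<open>Symmetry of second derivatives\<close>

text \<open>
  The second difference over a small square, evaluated by the mean value theorem in either order,
  equals the side length squared times a value of either mixed derivative.
\<close>

lemma mixed_partials_real:
  fixes g gs gt gst gts :: "real \<Rightarrow> real \<Rightarrow> real"
  assumes "\<delta> > 0"
    and ds: "\<And>a b. \<bar>a\<bar> < \<delta> \<Longrightarrow> \<bar>b\<bar> < \<delta> \<Longrightarrow> ((\<lambda>a. g a b) has_real_derivative gs a b) (at a)"
    and dt: "\<And>a b. \<bar>a\<bar> < \<delta> \<Longrightarrow> \<bar>b\<bar> < \<delta> \<Longrightarrow> ((\<lambda>b. g a b) has_real_derivative gt a b) (at b)"
    and dst: "\<And>a b. \<bar>a\<bar> < \<delta> \<Longrightarrow> \<bar>b\<bar> < \<delta> \<Longrightarrow> ((\<lambda>b. gs a b) has_real_derivative gst a b) (at b)"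
    and dts: "\<And>a b. \<bar>a\<bar> < \<delta> \<Longrightarrow> \<bar>b\<bar> < \<delta> \<Longrightarrow> ((\<lambda>a. gt a b) has_real_derivative gts a b) (at a)"
    and cst: "\<And>X Y. X \<longlonglongrightarrow> 0 \<Longrightarrow> Y \<longlonglongrightarrow> 0 \<Longrightarrow> (\<lambda>n. gst (X n) (Y n)) \<longlonglongrightarrow> gst 0 0"
    and cts: "\<And>X Y. X \<longlonglongrightarrow> 0 \<Longrightarrow> Y \<longlonglongrightarrow> 0 \<Longrightarrow> (\<lambda>n. gts (X n) (Y n)) \<longlonglongrightarrow> gts 0 0"
  shows "gst 0 0 = gts 0 0"
proof -
  have ex: "\<exists>a b a' b'. 0 < a \<and> a < h \<and> 0 < b \<and> b < h \<and> 0 < a' \<and> a' < h \<and> 0 < b' \<and> b' < h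
      \<and> gst a b = gts a' b'" if h: "0 < h" "h < \<delta>" for h
  proof -
    have 1: "\<exists>a. 0 < a \<and> a < h \<and> (g h h - g h 0) - (g 0 h - g 0 0) = (h - 0) * (gs a h - gs a 0)"
      using h by (intro MVT2[where f="\<lambda>a. g a h - g a 0"]) (auto intro!: DERIV_diff ds)
    then obtain a where a: "0 < a" "a < h" "(g h h - g h 0) - (g 0 h - g 0 0) = h * (gs a h - gs a 0)"
      by auto
    have "\<exists>b. 0 < b \<and> b < h \<and> gs a h - gs a 0 = (h - 0) * gst a b"
      using h a by (intro MVT2) (auto intro!: dst)
    then obtain b where b: "0 < b" "b < h" "gs a h - gs a 0 = h * gst a b" by auto
    have 2: "\<exists>b. 0 < b \<and> b < h \<and> (g h h - g 0 h) - (g h 0 - g 0 0) = (h - 0) * (gt h b - gt 0 b)"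
      using h by (intro MVT2[where f="\<lambda>b. g h b - g 0 b"]) (auto intro!: DERIV_diff dt)
    then obtain b' where b': "0 < b'" "b' < h" "(g h h - g 0 h) - (g h 0 - g 0 0) = h * (gt h b' - gt 0 b')"
      by auto
    have "\<exists>a. 0 < a \<and> a < h \<and> gt h b' - gt 0 b' = (h - 0) * gts a b'"
      using h b' by (intro MVT2) (auto intro!: dts)
    then obtain a' where a': "0 < a'" "a' < h" "gt h b' - gt 0 b' = h * gts a' b'" by auto
    have "h * (h * gst a b) = h * (h * gts a' b')"
      using a(3)[unfolded b(3)] b'(3)[unfolded a'(3)] by linarith
    then have "gst a b = gts a' b'" using h by simp
    then show ?thesis using a b a' b' by blast
  qed
  define h where "h n = \<delta> / real (n + 2)" for n
  have h: "0 < h n" "h n < \<delta>" for n using assms(1) by (auto simp: h_def field_simps intro: add_pos_nonneg)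
  have h0: "h \<longlonglongrightarrow> 0"
    unfolding h_def using LIMSEQ_ignore_initial_segment[OF lim_const_over_n[of \<delta>], of 2] by simp
  obtain A B A' B' where AB: "\<And>n. 0 < A n \<and> A n < h n \<and> 0 < B n \<and> B n < h n \<and> 0 < A' n \<and> A' n < h n
      \<and> 0 < B' n \<and> B' n < h n \<and> gst (A n) (B n) = gts (A' n) (B' n)"
    using ex[OF h] by metis
  have sq: "X \<longlonglongrightarrow> 0" if "\<And>n. 0 < X n \<and> X n < h n" for X
    by (rule tendsto_sandwich[OF _ _ tendsto_const h0]) (use that in \<open>auto intro!: always_eventually simp: less_imp_le\<close>)
  have "A \<longlonglongrightarrow> 0" "B \<longlonglongrightarrow> 0" "A' \<longlonglongrightarrow> 0" "B' \<longlonglongrightarrow> 0" using AB by (auto intro!: sq)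
  then show ?thesis
    using cst[of A B] cts[of A' B'] AB LIMSEQ_unique by auto
qed

lemma real_derivative_along_line:
  assumes "has_partial v s f D (x + t *\<^sub>R v s)"
  shows "((\<lambda>\<epsilon>. f (x + \<epsilon> *\<^sub>R v s) \<bullet> w) has_real_derivative D \<bullet> w) (at t)"
  unfolding has_real_derivative_iff_has_vector_derivative
  using bounded_linear.has_vector_derivative[OF bounded_linear_inner_left has_vector_derivative_along_line[where v=v and s=s and f=f, OF assms]] .

context orthonormal_frame
begin

theorem pderiv_dir_commute:
  assumes G: "openin (top_of_set M) G" and f: "Ck_on v m G 2 f" and st: "s \<le> m" "t \<le> m" and x: "x \<in> G"
  shows "pderiv_dir v s (pderiv_dir v t f) x = pderiv_dir v t (pderiv_dir v s f) x"
proof (rule vector_eq_rdot[THEN iffD1], rule allI)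
  fix w :: 'a
  obtain r where r: "r > 0" "hcball x r \<subseteq> G" using hcball_subset_open[OF G x] by blast
  have xM: "x \<in> M" using G x by (auto simp: openin_open)
  define P where "P a b = x + a *\<^sub>R v s + b *\<^sub>R v t" for a b
  have PG: "P a b \<in> G" if "\<bar>a\<bar> < r / 2" "\<bar>b\<bar> < r / 2" for a b
  proof -
    have "norm (P a b - x) \<le> \<bar>a\<bar> + \<bar>b\<bar>"
      using norm_triangle_ineq[of "a *\<^sub>R v s" "b *\<^sub>R v t"] st by (simp add: P_def norm_v)
    then have "P a b \<in> hcball x r"
      using that xM st by (simp add: hcball_def P_def M_add_line)
    then show ?thesis using r by blast
  qed
  have f2: "Ck_on v m G (Suc (Suc 0)) f" using f by (simp add: numeral_2_eq_2)
  have d1: "has_partial v u f (pderiv_dir v u f y) y" if "u \<le> m" "y \<in> G" for u y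
    using f2 that by (simp add: has_partial_pderiv_dir)
  have d2: "has_partial v u (pderiv_dir v u' f) (pderiv_dir v u (pderiv_dir v u' f) y) y"
    if "u \<le> m" "u' \<le> m" "y \<in> G" for u u' y
    using f2 that by (simp add: has_partial_pderiv_dir)
  have c2: "continuous_on G (pderiv_dir v u (pderiv_dir v u' f))" if "u \<le> m" "u' \<le> m" for u u'
    using f2 that by simp
  have P1: "P a b = (x + b *\<^sub>R v t) + a *\<^sub>R v s" and P2: "P a b = (x + a *\<^sub>R v s) + b *\<^sub>R v t" for a b
    by (simp_all add: P_def algebra_simps)
  have lim: "(\<lambda>n. g (P (X n) (Y n)) \<bullet> w) \<longlonglongrightarrow> g (P 0 0) \<bullet> w"
    if g: "continuous_on G g" and X: "X \<longlonglongrightarrow> 0" and Y: "Y \<longlonglongrightarrow> 0" for g :: "'a \<Rightarrow> 'a" and X Y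
  proof -
    have "(\<lambda>n. P (X n) (Y n)) \<longlonglongrightarrow> P 0 0"
      unfolding P_def by (intro tendsto_intros X Y)
    moreover have "eventually (\<lambda>n. P (X n) (Y n) \<in> G) sequentially"
      using tendstoD[OF X half_gt_zero[OF r(1)]] tendstoD[OF Y half_gt_zero[OF r(1)]]
      by eventually_elim (rule PG; simp add: dist_real_def)
    ultimately have "(\<lambda>n. g (P (X n) (Y n))) \<longlonglongrightarrow> g (P 0 0)"
      using continuous_on_tendsto_compose[OF g] PG[of 0 0] r(1) by simp
    then show ?thesis by (intro tendsto_intros)
  qed
  have "pderiv_dir v t (pderiv_dir v s f) (P 0 0) \<bullet> w = pderiv_dir v s (pderiv_dir v t f) (P 0 0) \<bullet> w"
  proof (rule mixed_partials_real[where \<delta>="r / 2" and g="\<lambda>a b. f (P a b) \<bullet> w"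
      and gs="\<lambda>a b. pderiv_dir v s f (P a b) \<bullet> w" and gt="\<lambda>a b. pderiv_dir v t f (P a b) \<bullet> w"
      and gst="\<lambda>a b. pderiv_dir v t (pderiv_dir v s f) (P a b) \<bullet> w"
      and gts="\<lambda>a b. pderiv_dir v s (pderiv_dir v t f) (P a b) \<bullet> w"])
    fix a b :: real assume "\<bar>a\<bar> < r / 2" "\<bar>b\<bar> < r / 2"
    note in_G = PG[OF this]
    show "((\<lambda>a. f (P a b) \<bullet> w) has_real_derivative pderiv_dir v s f (P a b) \<bullet> w) (at a)"
      unfolding P1 by (rule real_derivative_along_line) (use d1[OF st(1) in_G] in \<open>simp add: P1\<close>)
    show "((\<lambda>b. f (P a b) \<bullet> w) has_real_derivative pderiv_dir v t f (P a b) \<bullet> w) (at b)"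
      unfolding P2 by (rule real_derivative_along_line) (use d1[OF st(2) in_G] in \<open>simp add: P2\<close>)
    show "((\<lambda>b. pderiv_dir v s f (P a b) \<bullet> w) has_real_derivative pderiv_dir v t (pderiv_dir v s f) (P a b) \<bullet> w) (at b)"
      unfolding P2 by (rule real_derivative_along_line) (use d2[OF st(2,1) in_G] in \<open>simp add: P2\<close>)
    show "((\<lambda>a. pderiv_dir v t f (P a b) \<bullet> w) has_real_derivative pderiv_dir v s (pderiv_dir v t f) (P a b) \<bullet> w) (at a)"
      unfolding P1 by (rule real_derivative_along_line) (use d2[OF st in_G] in \<open>simp add: P1\<close>)
  qed (use r(1) lim[OF c2[OF st]] lim[OF c2[OF st(2,1)]] in auto)
  then show "pderiv_dir v s (pderiv_dir v t f) x \<bullet> w = pderiv_dir v t (pderiv_dir v s f) x \<bullet> w"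
    by (simp add: P_def)
qed

end

section \<open>Smoothness of the Cauchy kernel\<close>

text \<open>An algebra of scalar functions off the origin that is closed under differentiation.\<close>

inductive radial_rational :: "('a::euclidean_space \<Rightarrow> real) \<Rightarrow> bool" where
  const: "radial_rational (\<lambda>x. a)"
| inner: "radial_rational (\<lambda>x. x \<bullet> a)"
| inverse_norm: "radial_rational (\<lambda>x. 1 / norm x)"
| add: "radial_rational f \<Longrightarrow> radial_rational g \<Longrightarrow> radial_rational (\<lambda>x. f x + g x)"
| mult: "radial_rational f \<Longrightarrow> radial_rational g \<Longrightarrow> radial_rational (\<lambda>x. f x * g x)"

lemma radial_rational_continuous: "radial_rational f \<Longrightarrow> continuous_on (- {0}) f"
  by (induction rule: radial_rational.induct) (auto intro!: continuous_intros)

lemma radial_rational_power: "radial_rational f \<Longrightarrow> radial_rational (\<lambda>x. f x ^ n)"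
  by (induction n) (auto intro: radial_rational.intros)

lemma radial_rational_partial:
  assumes "radial_rational f"
  shows "\<exists>g. radial_rational g \<and> (\<forall>x\<in>- {0}. has_partial v s f (g x) x)"
  using assms
proof induction
  case (const a)
  then show ?case by (intro exI[of _ "\<lambda>x. 0"]) (auto intro: radial_rational.intros)
next
  case (inner a)
  have "has_partial v s (\<lambda>x. x \<bullet> a) (v s \<bullet> a) x" for x
    by (simp add: inner_add_left) (auto intro!: derivative_eq_intros)
  then show ?case by (intro exI[of _ "\<lambda>x. v s \<bullet> a"]) (auto intro: radial_rational.intros)
next
  case inverse_norm
  have "has_partial v s (\<lambda>x. 1 / norm x) (- 1 * ((x \<bullet> v s) * (1 / norm x) ^ 3)) x" if "x \<noteq> 0" for x
  proof -
    have "((\<lambda>t. 1 / t) has_real_derivative - 1 / (norm x)\<^sup>2) (at (norm x))"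
      using that by (auto intro!: derivative_eq_intros simp: power2_eq_square)
    with has_partial_norm[OF that]
    have "has_partial v s (\<lambda>x. 1 / norm x) (- 1 / (norm x)\<^sup>2 * (x \<bullet> v s / norm x)) x"
      by (rule has_partial_compose_real[where f=norm and v=v and s=s and y=x])
    then show ?thesis by (simp add: power2_eq_square power3_eq_cube)
  qed
  moreover have "radial_rational (\<lambda>x. - 1 * ((x \<bullet> v s) * (1 / norm x) ^ 3))"
    by (intro radial_rational.intros radial_rational_power)
  ultimately show ?case by blast
next
  case (add f g)
  then obtain f' g' where "radial_rational f'" "radial_rational g'"
    "\<And>x. x \<in> - {0} \<Longrightarrow> has_partial v s f (f' x) x" "\<And>x. x \<in> - {0} \<Longrightarrow> has_partial v s g (g' x) x"
    by blast
  then show ?case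
    by (intro exI[of _ "\<lambda>x. f' x + g' x"]) (auto intro: radial_rational.intros has_vector_derivative_add)
next
  case (mult f g)
  then obtain f' g' where "radial_rational f'" "radial_rational g'"
    "\<And>x. x \<in> - {0} \<Longrightarrow> has_partial v s f (f' x) x" "\<And>x. x \<in> - {0} \<Longrightarrow> has_partial v s g (g' x) x"
    by blast
  moreover from this have "has_partial v s (\<lambda>x. f x * g x) (f x * g' x + f' x * g x) x" if "x \<in> - {0}" for x
    using has_partial_scaleR[where f=f and g=g and v=v and s=s and x=x] that by simp
  ultimately show ?case using mult.hyps
    by (intro exI[of _ "\<lambda>x. f x * g' x + f' x * g x"]) (auto intro!: radial_rational.intros)
qed

lemma smooth_on_radial_rational:
  fixes f :: "'a::euclidean_space \<Rightarrow> 'a"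
  assumes "\<And>b. b \<in> Basis \<Longrightarrow> radial_rational (\<lambda>x. f x \<bullet> b)"
  shows "smooth_on v m (- {0}) f"
proof -
  show ?thesis
  proof (rule smooth_on_coinduct[OF line_open_of_open, where Q="\<lambda>f. \<forall>b\<in>Basis. radial_rational (\<lambda>x. f x \<bullet> b)"])
    fix f :: "'a \<Rightarrow> 'a" assume f: "\<forall>b\<in>Basis. radial_rational (\<lambda>x. f x \<bullet> b)"
    show "continuous_on (- {0}) f"
      by (rule continuous_on_componentwise[THEN iffD2]) (use f radial_rational_continuous in blast)
    fix s
    have "\<exists>g. \<forall>b\<in>Basis. radial_rational (g b) \<and> (\<forall>x\<in>- {0}. has_partial v s (\<lambda>x. f x \<bullet> b) (g b x) x)"
      using f radial_rational_partial by (intro bchoice) blast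
    then obtain g where g: "\<And>b. b \<in> Basis \<Longrightarrow> radial_rational (g b)"
      "\<And>b x. b \<in> Basis \<Longrightarrow> x \<in> - {0} \<Longrightarrow> has_partial v s (\<lambda>x. f x \<bullet> b) (g b x) x" by blast
    have "has_partial v s f (\<Sum>b\<in>Basis. g b x *\<^sub>R b) x" if "x \<in> - {0}" for x
    proof -
      have "has_partial v s (\<lambda>x. \<Sum>b\<in>Basis. (f x \<bullet> b) *\<^sub>R b) (\<Sum>b\<in>Basis. g b x *\<^sub>R b) x"
      proof (rule has_vector_derivative_sum)
        fix b :: 'a assume b: "b \<in> Basis"
        show "has_partial v s (\<lambda>x. (f x \<bullet> b) *\<^sub>R b) (g b x *\<^sub>R b) x"
          using has_vector_derivative_scaleR[OF g(2)[OF b that, folded has_real_derivative_iff_has_vector_derivative]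
              has_vector_derivative_const[of b]] by simp
      qed
      then show ?thesis by (simp add: euclidean_representation)
    qed
    moreover have "radial_rational (\<lambda>x. (\<Sum>b\<in>Basis. g b x *\<^sub>R b) \<bullet> b')" if "b' \<in> Basis" for b'
      using g(1)[OF that] that by (simp add: inner_sum_left_Basis)
    ultimately show "\<exists>g. (\<forall>b\<in>Basis. radial_rational (\<lambda>x. g x \<bullet> b)) \<and> (\<forall>x\<in>- {0}. has_partial v s f (g x) x)"
      by (intro exI[of _ "\<lambda>x. \<Sum>b\<in>Basis. g b x *\<^sub>R b"]) blast
  qed (use assms in auto)
qed

lemma (in hypercomplex_frame) smooth_on_cauchy_kernel: "smooth_on v m (- {0}) (cauchy_kernel c m)"
proof (rule smooth_on_radial_rational)
  fix b :: 'a assume "b \<in> Basis"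
  have "(\<lambda>x. cauchy_kernel c m x \<bullet> b) = (\<lambda>x. 1 / sigma m * ((1 / norm x) ^ (m + 1) * (x \<bullet> adjoint c b)))"
    by (simp add: fun_eq_iff cauchy_kernel_def adjoint_works[OF linear_c] power_divide)
  then show "radial_rational (\<lambda>x. cauchy_kernel c m x \<bullet> b)"
    by (auto intro!: radial_rational.intros radial_rational_power simp only:)
qed

section \<open>Differentiation of the Cauchy integral\<close>

text \<open>The form in which dominated convergence along sequences applies to a derivative.\<close>

lemma has_vector_derivative_iff_quotient:
  "(f has_vector_derivative D) (at a) \<longleftrightarrow> ((\<lambda>h. (1 / h) *\<^sub>R (f (a + h) - f a)) \<longlongrightarrow> D) (at 0)"
proof -
  have "eventually (\<lambda>h. norm (f (a + h) - f a - h *\<^sub>R D) / norm h = norm ((1 / h) *\<^sub>R (f (a + h) - f a) - D)) (at 0)"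
    unfolding eventually_at_filter
  proof (rule always_eventually, intro allI impI)
    fix h :: real assume h: "h \<noteq> 0"
    then have "(1 / h) *\<^sub>R (f (a + h) - f a) - D = (1 / h) *\<^sub>R (f (a + h) - f a - h *\<^sub>R D)"
      by (simp add: scaleR_diff_right)
    then show "norm (f (a + h) - f a - h *\<^sub>R D) / norm h = norm ((1 / h) *\<^sub>R (f (a + h) - f a) - D)"
      by (simp only: norm_scaleR) simp
  qed
  then show ?thesis
    unfolding has_vector_derivative_def has_derivative_at
    by (simp add: tendsto_cong tendsto_norm_zero_iff LIM_zero_iff bounded_linear_scaleR_left)
qed

context hypercomplex_frame
begin

lemma sphere_integral_diff:
  assumes "p \<in> M" "R > 0" "continuous_on (hsphere M p R) \<psi>" "continuous_on (hsphere M p R) \<theta>"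
    "continuous_on (hsphere M p R) f"
  shows "sphere_integral v m p R (\<lambda>y. \<psi> y - \<theta> y) f = sphere_integral v m p R \<psi> f - sphere_integral v m p R \<theta> f"
  unfolding sphere_integral_def sum_subtractf[symmetric] left_diff_distrib
  using assms
  by (intro sum.cong refl sphere_form_integral_diff) (auto intro!: alg_mult.continuous_on continuous_intros)

lemma sphere_integral_scaleR:
  "sphere_integral v m p R (\<lambda>y. a *\<^sub>R \<psi> y) f = a *\<^sub>R sphere_integral v m p R \<psi> f"
  unfolding sphere_integral_def by (simp add: sphere_form_integral_scaleR scaleR_sum_right)

lemma kernel_bounded:
  fixes K :: "'a \<Rightarrow> 'a"
  assumes "continuous_on (- {0}) K" "compact S" "S \<subseteq> hball M p R"
  shows "\<exists>B. \<forall>y\<in>hsphere M p R. \<forall>z\<in>S. norm (K (y - z)) \<le> B"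
proof -
  have "continuous_on (hsphere M p R \<times> S) (\<lambda>w. K (fst w - snd w))"
    by (rule continuous_on_compose2[OF assms(1)])
      (use assms(3) in \<open>auto intro!: continuous_intros simp: hball_def hsphere_def\<close>)
  from compact_imp_bounded[OF compact_continuous_image[OF this compact_Times[OF compact_hsphere assms(2)]]]
  show ?thesis by (fastforce simp: bounded_iff)
qed

lemma continuous_on_translated_kernel:
  fixes K :: "'a \<Rightarrow> 'a"
  assumes "continuous_on (- {0}) K" "z \<in> hball M p R"
  shows "continuous_on (hsphere M p R) (\<lambda>y. K (y - z))"
  by (rule continuous_on_compose2[OF assms(1)])
    (use assms(2) in \<open>auto intro!: continuous_intros simp: hball_def hsphere_def\<close>)

lemma continuous_on_kernel_integral:
  fixes K :: "'a \<Rightarrow> 'a"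
  assumes p: "p \<in> M" and R: "R > 0" and K: "continuous_on (- {0}) K" and f: "continuous_on (hsphere M p R) f"
  shows "continuous_on (hball M p R) (\<lambda>x. sphere_integral v m p R (\<lambda>y. K (y - x)) f)"
proof (rule continuous_on_sequentiallyI)
  fix u a assume u: "\<forall>n. u n \<in> hball M p R" and a: "a \<in> hball M p R" and lim: "u \<longlonglongrightarrow> a"
  have sub: "insert a (range u) \<subseteq> hball M p R" using u a by auto
  obtain B where B: "\<forall>y\<in>hsphere M p R. \<forall>z\<in>insert a (range u). norm (K (y - z)) \<le> B"
    using kernel_bounded[OF K compact_sequence_with_limit[OF lim] sub] ..
  show "(\<lambda>n. sphere_integral v m p R (\<lambda>y. K (y - u n)) f) \<longlonglongrightarrow> sphere_integral v m p R (\<lambda>y. K (y - a)) f"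
  proof (rule sphere_integral_tendsto[OF p R _ _ f, where K=B])
    show "(\<lambda>n. K (y - u n)) \<longlonglongrightarrow> K (y - a)" if "y \<in> hsphere M p R" for y
      by (rule continuous_on_tendsto_compose[OF K])
        (use that a u in \<open>auto intro!: tendsto_intros lim always_eventually simp: hball_def hsphere_def\<close>)
  qed (use B u a in \<open>auto intro!: continuous_on_translated_kernel K\<close>)
qed

text \<open>
  Differentiation under the integral sign: the difference quotients of the kernel are dominated by
  its derivative on a compact neighbourhood that avoids the singularity.
\<close>

lemma has_partial_kernel_integral:
  fixes K :: "'a \<Rightarrow> 'a"
  assumes p: "p \<in> M" and R: "R > 0" and K: "smooth_on v m (- {0}) K"
    and f: "continuous_on (hsphere M p R) f" and s: "s \<le> m" and x: "x \<in> hball M p R"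
  shows "has_partial v s (\<lambda>x. sphere_integral v m p R (\<lambda>y. K (y - x)) f)
    (- sphere_integral v m p R (\<lambda>y. pderiv_dir v s K (y - x)) f) x"
proof -
  let ?F = "\<lambda>x. sphere_integral v m p R (\<lambda>y. K (y - x)) f"
  let ?K' = "pderiv_dir v s K"
  note cK = smooth_on_continuous[OF K]
  note cK' = smooth_on_continuous[OF smooth_on_pderiv_dir[OF K s]]
  define \<delta> where "\<delta> = (R - norm (x - p)) / 2"
  have \<delta>: "\<delta> > 0" using x by (simp add: \<delta>_def hball_def)
  define S where "S = (\<lambda>t. x + t *\<^sub>R v s) ` {-\<delta>..\<delta>}"
  have S: "compact S" unfolding S_def by (intro compact_continuous_image continuous_intros) simp
  have in_ball: "x + t *\<^sub>R v s \<in> hball M p R" if "\<bar>t\<bar> \<le> \<delta>" for t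
  proof -
    have "norm (x + t *\<^sub>R v s - p) \<le> norm (x - p) + \<bar>t\<bar>"
      using norm_triangle_ineq[of "x - p" "t *\<^sub>R v s"] norm_v[OF s] by (simp add: algebra_simps)
    then show ?thesis using that x s \<delta> by (simp add: hball_def M_add_line \<delta>_def)
  qed
  then have Sb: "S \<subseteq> hball M p R" by (auto simp: S_def)
  obtain B where B: "\<forall>y\<in>hsphere M p R. \<forall>z\<in>S. norm (?K' (y - z)) \<le> B"
    using kernel_bounded[OF cK' S Sb] ..
  have minus_add_eq: "y - x + (- t) *\<^sub>R v s = y - (x + t *\<^sub>R v s)" for y t
    by simp
  have deriv: "((\<lambda>t. K (y - (x + t *\<^sub>R v s))) has_vector_derivative - ?K' (y - (x + t *\<^sub>R v s))) (at t within T)"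
    if y: "y \<in> hsphere M p R" and t: "\<bar>t\<bar> \<le> \<delta>" for y t T
  proof -
    have "y - (x + t *\<^sub>R v s) \<in> - {0}"
      using in_ball[OF t] y by (auto simp: hball_def hsphere_def)
    then have "has_partial v s K (?K' (y - (x + t *\<^sub>R v s))) ((y - x) + (- t) *\<^sub>R v s)"
      using smooth_on_has_partial[OF K s] by (simp only: minus_add_eq)
    then have "((\<lambda>\<epsilon>. K ((y - x) + \<epsilon> *\<^sub>R v s)) has_vector_derivative ?K' (y - (x + t *\<^sub>R v s))) (at (- t))"
      by (rule has_vector_derivative_along_line)
    moreover have "((\<lambda>t. - t) has_vector_derivative - 1) (at t)"
      by (auto intro!: derivative_eq_intros)
    ultimately have "(((\<lambda>\<epsilon>. K ((y - x) + \<epsilon> *\<^sub>R v s)) \<circ> (\<lambda>t. - t)) has_vector_derivative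
        (-1) *\<^sub>R ?K' (y - (x + t *\<^sub>R v s))) (at t)"
      by (intro vector_diff_chain_at)
    then show ?thesis
      unfolding o_def minus_add_eq scaleR_minus1_left by (rule has_vector_derivative_at_within)
  qed
  (* sequences in this interval stay inside the ball *)
  have at0: "at (0::real) = at 0 within {-\<delta><..<\<delta>}"
    by (rule at_within_open[symmetric]) (use \<delta> in auto)
  show ?thesis
    unfolding has_vector_derivative_iff_quotient
    unfolding at0 tendsto_at_iff_sequentially
  proof (intro allI impI)
    fix X assume X: "\<forall>i. X i \<in> {-\<delta><..<\<delta>} - {0}" and X0: "X \<longlonglongrightarrow> 0"
    have Xn: "X n \<noteq> 0" "\<bar>X n\<bar> \<le> \<delta>" for n using X[rule_format, of n] by auto
    let ?\<psi> = "\<lambda>n y. (1 / X n) *\<^sub>R (K (y - (x + X n *\<^sub>R v s)) - K (y - x))"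
    have x0: "x \<in> hball M p R" by (rule x)
    have "(\<lambda>n. sphere_integral v m p R (?\<psi> n) f) \<longlonglongrightarrow> sphere_integral v m p R (\<lambda>y. - ?K' (y - x)) f"
    proof (rule sphere_integral_tendsto[OF p R _ _ f, where K=B])
      show "continuous_on (hsphere M p R) (?\<psi> n)" for n
        by (intro continuous_intros continuous_on_translated_kernel cK x in_ball Xn)
      show "continuous_on (hsphere M p R) (\<lambda>y. - ?K' (y - x))"
        by (intro continuous_intros continuous_on_translated_kernel cK' x)
      fix y assume y: "y \<in> hsphere M p R"
      show "norm (?\<psi> n y) \<le> B" for n
      proof -
        have "norm (K (y - (x + X n *\<^sub>R v s)) - K (y - (x + 0 *\<^sub>R v s))) \<le> B * norm (X n - 0)"
        proof (rule differentiable_bound[where S="{-\<delta>..\<delta>}" and f'="\<lambda>t h. h *\<^sub>R (- ?K' (y - (x + t *\<^sub>R v s)))"])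
          fix t assume t: "t \<in> {-\<delta>..\<delta>}"
          show "((\<lambda>t. K (y - (x + t *\<^sub>R v s))) has_derivative (\<lambda>h. h *\<^sub>R (- ?K' (y - (x + t *\<^sub>R v s))))) (at t within {-\<delta>..\<delta>})"
            using deriv[OF y, of t] t unfolding has_vector_derivative_def by auto
          have "norm (?K' (y - (x + t *\<^sub>R v s))) \<le> B"
            using B y t by (simp add: S_def)
          then show "onorm (\<lambda>h. h *\<^sub>R (- ?K' (y - (x + t *\<^sub>R v s)))) \<le> B"
            by (intro onorm_le) (simp add: mult.commute[of B] mult_left_mono)
        qed (use Xn[of n] \<delta> in auto)
        then show ?thesis using Xn[of n] by (simp add: divide_le_eq mult.commute)
      qed
      have "((\<lambda>h. (1 / h) *\<^sub>R (K (y - (x + h *\<^sub>R v s)) - K (y - x))) \<longlongrightarrow> - ?K' (y - x)) (at 0)"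
        using deriv[OF y, of 0 UNIV] \<delta> unfolding has_vector_derivative_iff_quotient by simp
      then show "(\<lambda>n. ?\<psi> n y) \<longlonglongrightarrow> - ?K' (y - x)"
        unfolding tendsto_at_iff_sequentially using Xn(1) X0 by (auto simp: o_def)
    qed
    moreover have "sphere_integral v m p R (?\<psi> n) f = (1 / X n) *\<^sub>R (?F (x + X n *\<^sub>R v s) - ?F x)" for n
      unfolding sphere_integral_scaleR
      by (subst sphere_integral_diff[OF p R _ _ f]) (auto intro!: continuous_on_translated_kernel cK x in_ball Xn)
    moreover have "sphere_integral v m p R (\<lambda>y. - ?K' (y - x)) f = - sphere_integral v m p R (\<lambda>y. ?K' (y - x)) f"
      using sphere_integral_scaleR[of p R "-1"] by simp
    ultimately show "((\<lambda>h. (1 / h) *\<^sub>R (?F (x + (0 + h) *\<^sub>R v s) - ?F (x + 0 *\<^sub>R v s))) \<circ> X)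
        \<longlonglongrightarrow> - sphere_integral v m p R (\<lambda>y. ?K' (y - x)) f"
      by (simp add: o_def)
  qed
qed

text \<open>
  The kernel depends on \<open>y - x\<close>, so every derivative in \<open>x\<close> costs a sign.
\<close>

theorem nabla_cauchy_formula:
  assumes p: "p \<in> M" and R: "R > 0" and G: "hcball p R \<subseteq> G" and f: "left_monogenic v m G f"
    and x: "x \<in> hball M p R"
  shows "nabla v m h f x = (-1) ^ mlength m h *\<^sub>R
    sphere_integral v m p R (\<lambda>y. nabla v m h (cauchy_kernel c m) (y - x)) f"
proof -
  let ?P = "\<lambda>k f' K. smooth_on v m (- {0}) K \<and>
    (\<forall>x\<in>hball M p R. f' x = (-1) ^ k *\<^sub>R sphere_integral v m p R (\<lambda>y. K (y - x)) f)"
  have fc: "continuous_on (hsphere M p R) f"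
    by (rule continuous_on_subset[OF left_monogenic_continuous(1)[OF f]]) (use G hsphere_subset_hcball in blast)
  have "?P (mlength m h) (nabla v m h f) (nabla v m h (cauchy_kernel c m))"
  proof (rule nabla_induct[where P="?P"])
    show "?P 0 f (cauchy_kernel c m)"
      using smooth_on_cauchy_kernel cauchy_integral_formula[OF p R G f] by simp
    fix k f' K s assume s: "s \<le> m" and IH: "?P k f' K"
    let ?F = "\<lambda>x. (-1) ^ k *\<^sub>R sphere_integral v m p R (\<lambda>y. K (y - x)) f"
    have "pderiv_dir v s f' x = (-1) ^ Suc k *\<^sub>R sphere_integral v m p R (\<lambda>y. pderiv_dir v s K (y - x)) f"
      if x: "x \<in> hball M p R" for x
    proof -
      have "pderiv_dir v s f' x = pderiv_dir v s ?F x"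
        using IH by (intro pderiv_dir_cong[OF line_open_hball x s]) auto
      also have "\<dots> = (-1) ^ k *\<^sub>R (- sphere_integral v m p R (\<lambda>y. pderiv_dir v s K (y - x)) f)"
        by (rule pderiv_dir_eq[where f="?F"], rule bounded_linear.has_vector_derivative[OF bounded_linear_scaleR_right
              has_partial_kernel_integral[OF p R conjunct1[OF IH] fc s x]])
      finally show ?thesis by simp
    qed
    then show "?P (Suc k) (pderiv_dir v s f') (pderiv_dir v s K)"
      using IH smooth_on_pderiv_dir s by blast
  qed
  then show ?thesis using x by blast
qed

text \<open>
  On the ball \<open>f\<close> belongs to the class of integrals against smooth kernels, which is closed under
  differentiation.
\<close>

lemma smooth_on_left_monogenic_ball:
  assumes p: "p \<in> M" and R: "R > 0" and G: "hcball p R \<subseteq> G" and f: "left_monogenic v m G f"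
  shows "smooth_on v m (hball M p R) f"
proof -
  let ?F = "\<lambda>K x. sphere_integral v m p R (\<lambda>y. K (y - x)) f"
  let ?Q = "\<lambda>g. \<exists>a K. smooth_on v m (- {0}) K \<and> (\<forall>x\<in>hball M p R. g x = a *\<^sub>R ?F K x)"
  have fc: "continuous_on (hsphere M p R) f"
    by (rule continuous_on_subset[OF left_monogenic_continuous(1)[OF f]]) (use G hsphere_subset_hcball in blast)
  show ?thesis
  proof (rule smooth_on_coinduct[OF line_open_hball, where Q="?Q"])
    show "?Q f"
      using smooth_on_cauchy_kernel cauchy_integral_formula[OF p R G f]
      by (intro exI[of _ 1] exI[of _ "cauchy_kernel c m"]) simp
    fix g assume "?Q g"
    then obtain a K where K: "smooth_on v m (- {0}) K" and g: "\<And>x. x \<in> hball M p R \<Longrightarrow> g x = a *\<^sub>R ?F K x"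
      by blast
    have "continuous_on (hball M p R) (\<lambda>x. a *\<^sub>R ?F K x)"
      by (intro continuous_intros continuous_on_kernel_integral p R smooth_on_continuous[OF K] fc)
    then show "continuous_on (hball M p R) g"
      using g by (simp cong: continuous_on_cong)
    fix s assume s: "s \<le> m"
    have "has_partial v s g ((- a) *\<^sub>R ?F (pderiv_dir v s K) x) x" if x: "x \<in> hball M p R" for x
    proof -
      have "has_partial v s (\<lambda>x. a *\<^sub>R ?F K x) (a *\<^sub>R (- ?F (pderiv_dir v s K) x)) x"
        by (rule bounded_linear.has_vector_derivative[OF bounded_linear_scaleR_right
              has_partial_kernel_integral[OF p R K fc s x]])
      then show ?thesis
        using has_partial_cong[where f=g and g="\<lambda>x. a *\<^sub>R ?F K x", OF line_open_hball x s g] by simp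
    qed
    then show "\<exists>g'. ?Q g' \<and> (\<forall>x\<in>hball M p R. has_partial v s g (g' x) x)"
      using smooth_on_pderiv_dir[OF K s]
      by (intro exI[of _ "\<lambda>x. (- a) *\<^sub>R ?F (pderiv_dir v s K) x"]) blast
  qed
qed

end

lemma Ck_on_subset: "Ck_on v m G k f \<Longrightarrow> U \<subseteq> G \<Longrightarrow> Ck_on v m U k f"
  by (induction k arbitrary: f) (auto intro: continuous_on_subset)

lemma smooth_on_subset: "smooth_on v m G f \<Longrightarrow> U \<subseteq> G \<Longrightarrow> smooth_on v m U f"
  unfolding smooth_on_def using Ck_on_subset by blast

lemma Ck_on_local:
  fixes f :: "'a::euclidean_space \<Rightarrow> 'a"
  assumes "G \<subseteq> M" "\<And>x. x \<in> G \<Longrightarrow> \<exists>U. x \<in> U \<and> openin (top_of_set M) U \<and> Ck_on v m U k f"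
  shows "Ck_on v m G k f"
proof -
  have cont: "continuous_on G f"
    if U: "\<And>x. x \<in> G \<Longrightarrow> \<exists>U. x \<in> U \<and> openin (top_of_set M) U \<and> continuous_on U f" for f :: "'a \<Rightarrow> 'a"
  proof (rule continuous_on_sequentiallyI)
    fix u a assume u: "\<forall>n. u n \<in> G" and a: "a \<in> G" and lim: "u \<longlonglongrightarrow> a"
    obtain T where T: "open T" "a \<in> M \<inter> T" "continuous_on (M \<inter> T) f"
      using U[OF a] by (auto simp: openin_open)
    have "eventually (\<lambda>n. u n \<in> T) sequentially"
      using T by (intro topological_tendstoD[OF lim]) auto
    then have "eventually (\<lambda>n. u n \<in> M \<inter> T) sequentially"
      by eventually_elim (use u assms(1) in blast)
    then show "(\<lambda>n. f (u n)) \<longlonglongrightarrow> f a"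
      using continuous_on_tendsto_compose[OF T(3) lim T(2)] by simp
  qed
  show ?thesis
    using assms(2)
  proof (induction k arbitrary: f)
    case 0
    then show ?case by (auto intro: cont)
  next
    case (Suc k)
    have nbhd: "\<exists>U. x \<in> U \<and> openin (top_of_set M) U \<and> continuous_on U f \<and>
        (\<forall>s\<le>m. (\<forall>x\<in>U. has_pderiv_dir v s f x) \<and> Ck_on v m U k (pderiv_dir v s f))" if "x \<in> G" for x
      using Suc.prems[OF that] by simp
    have "continuous_on G f"
      by (rule cont) (use nbhd in blast)
    moreover have "has_pderiv_dir v s f x" if "s \<le> m" "x \<in> G" for s x
      using nbhd[OF that(2)] that by blast
    moreover have "Ck_on v m G k (pderiv_dir v s f)" if "s \<le> m" for s
      by (rule Suc.IH) (use nbhd that in blast)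
    ultimately show ?case by simp
  qed
qed

context hypercomplex_frame
begin

section \<open>Derivatives of monogenic functions\<close>

theorem smooth_on_left_monogenic:
  assumes G: "openin (top_of_set M) G" and f: "left_monogenic v m G f"
  shows "smooth_on v m G f"
  unfolding smooth_on_def
proof (intro allI Ck_on_local)
  show "G \<subseteq> M" using G by (auto simp: openin_open)
  fix k x assume x: "x \<in> G"
  obtain r where r: "r > 0" "hcball x r \<subseteq> G" using hcball_subset_open[OF G x] by blast
  have xM: "x \<in> M" using G x by (auto simp: openin_open)
  have "Ck_on v m (hball M x r) k f"
    using smooth_on_left_monogenic_ball[OF xM r f] by (simp add: smooth_on_def)
  moreover have "x \<in> hball M x r" using xM r by (simp add: hball_def)
  ultimately show "\<exists>U. x \<in> U \<and> openin (top_of_set M) U \<and> Ck_on v m U k f"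
    using openin_hball by blast
qed

lemma has_partial_sum_mult:
  fixes g :: "nat \<Rightarrow> 'a \<Rightarrow> 'a"
  assumes "\<And>t. t \<le> m \<Longrightarrow> has_partial v s (g t) (D t) x"
  shows "has_partial v s (\<lambda>x. \<Sum>t\<le>m. a t * g t x) (\<Sum>t\<le>m. a t * D t) x"
    and "has_partial v s (\<lambda>x. \<Sum>t\<le>m. g t x * a t) (\<Sum>t\<le>m. D t * a t) x"
proof -
  show "has_partial v s (\<lambda>x. \<Sum>t\<le>m. a t * g t x) (\<Sum>t\<le>m. a t * D t) x"
    by (intro has_vector_derivative_sum
        bounded_linear.has_vector_derivative[OF alg_mult.bounded_linear_right] assms) simp
  show "has_partial v s (\<lambda>x. \<Sum>t\<le>m. g t x * a t) (\<Sum>t\<le>m. D t * a t) x"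
    by (intro has_vector_derivative_sum
        bounded_linear.has_vector_derivative[OF alg_mult.bounded_linear_left] assms) simp
qed

text \<open>The derivative of the identity \<open>dbar v m f = 0\<close>.\<close>

lemma pderiv_dbar:
  assumes G: "openin (top_of_set M) G" and f: "left_monogenic v m G f" and s: "s \<le> m" and x: "x \<in> G"
  shows "(\<Sum>t\<le>m. v t * pderiv_dir v s (pderiv_dir v t f) x) = 0"
proof -
  have sm: "smooth_on v m G f" by (rule smooth_on_left_monogenic[OF G f])
  have "pderiv_dir v s (\<lambda>x. \<Sum>t\<le>m. v t * pderiv_dir v t f x) x =
      (\<Sum>t\<le>m. v t * pderiv_dir v s (pderiv_dir v t f) x)"
    by (rule pderiv_dir_eq[where f="\<lambda>x. \<Sum>t\<le>m. v t * pderiv_dir v t f x"], rule has_partial_sum_mult(1))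
      (rule smooth_on_has_partial[OF smooth_on_pderiv_dir[OF sm] s x])
  moreover have "pderiv_dir v s (\<lambda>x. \<Sum>t\<le>m. v t * pderiv_dir v t f x) x = pderiv_dir v s (\<lambda>x. 0) x"
    by (rule pderiv_dir_cong[OF line_open_of_openin[OF G] x s])
      (use f in \<open>simp add: left_monogenic_def dbar_def\<close>)
  moreover have "pderiv_dir v s (\<lambda>x. 0 :: 'a) x = 0"
    by (rule pderiv_dir_eq) simp
  ultimately show ?thesis by simp
qed

lemma left_monogenic_pderiv_dir:
  assumes G: "openin (top_of_set M) G" and f: "left_monogenic v m G f" and s: "s \<le> m"
  shows "left_monogenic v m G (pderiv_dir v s f)"
proof -
  have sm: "smooth_on v m G f" by (rule smooth_on_left_monogenic[OF G f])
  have "dbar v m (pderiv_dir v s f) x = 0" if x: "x \<in> G" for x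
  proof -
    have "dbar v m (pderiv_dir v s f) x = (\<Sum>t\<le>m. v t * pderiv_dir v s (pderiv_dir v t f) x)"
      unfolding dbar_def
      by (intro sum.cong refl arg_cong2[of _ _ _ _ "(*)"] pderiv_dir_commute[OF G _ _ s x])
        (use sm in \<open>auto simp: smooth_on_def\<close>)
    then show ?thesis using pderiv_dbar[OF G f s x] by simp
  qed
  moreover have "Ck_on v m G 1 (pderiv_dir v s f)"
    using smooth_on_pderiv_dir[OF sm s] unfolding smooth_on_def by blast
  ultimately show ?thesis unfolding left_monogenic_def by blast
qed

theorem left_monogenic_nabla:
  assumes G: "openin (top_of_set M) G" and f: "left_monogenic v m G f"
  shows "left_monogenic v m G (nabla v m h f)"
  by (rule nabla_induct[where P="\<lambda>k f g. left_monogenic v m G f" and g=f])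
    (use f left_monogenic_pderiv_dir[OF G] in auto)

text \<open>
  The Laplacian is the conjugate Dirac operator composed with the Dirac operator, because the mixed
  terms \<open>c (v s) * v t\<close> are antisymmetric whereas second derivatives are symmetric.
\<close>

theorem harmonic_left_monogenic:
  assumes G: "openin (top_of_set M) G" and f: "left_monogenic v m G f"
  shows "harmonic_wrt v m G f"
proof -
  have sm: "smooth_on v m G f" by (rule smooth_on_left_monogenic[OF G f])
  have "laplacian v m f x = 0" if x: "x \<in> G" for x
  proof -
    let ?D = "\<lambda>s t. pderiv_dir v s (pderiv_dir v t f) x"
    have sym: "?D s t = ?D t s" if "s \<le> m" "t \<le> m" for s t
      by (rule pderiv_dir_commute[OF G _ that x]) (use sm in \<open>simp add: smooth_on_def\<close>)
    have zero: "(\<Sum>s\<le>m. \<Sum>t\<le>m. c (v s) * v t * ?D s t) = 0"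
      using pderiv_dbar[OF G f _ x] by (simp add: mult.assoc flip: sum_distrib_left)
    then have "(\<Sum>s\<le>m. \<Sum>t\<le>m. c (v t) * v s * ?D t s) = 0"
      by (subst sum.swap)
    with zero have "0 = (\<Sum>s\<le>m. \<Sum>t\<le>m. c (v s) * v t * ?D s t + c (v t) * v s * ?D t s)"
      by (simp add: sum.distrib)
    also have "\<dots> = (\<Sum>s\<le>m. \<Sum>t\<le>m. if s = t then 2 *\<^sub>R ?D s s else 0)"
    proof (intro sum.cong[OF refl])
      fix s t assume st: "s \<in> {..m}" "t \<in> {..m}"
      have eq: "c (v s) * v t * ?D s t + c (v t) * v s * ?D t s = (c (v s) * v t + c (v t) * v s) * ?D s t"
        using sym[of t s] st by (simp add: distrib_right)
      show "c (v s) * v t * ?D s t + c (v t) * v s * ?D t s = (if s = t then 2 *\<^sub>R ?D s s else 0)"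
        unfolding eq using c_v_mult_self[of s] c_v_mult_anti[of s t] st
        by (cases "s = t") (simp_all add: distrib_right scaleR_2 mult_2)
    qed
    also have "\<dots> = 2 *\<^sub>R laplacian v m f x"
      by (simp add: laplacian_def scaleR_sum_right)
    finally show ?thesis by simp
  qed
  then show ?thesis using sm by (simp add: harmonic_wrt_def smooth_on_def)
qed

section \<open>The estimate at the centre\<close>

lemma norm_mult_le_omega:
  assumes "u \<in> M" shows "norm (u * w) \<le> omega M * norm u * norm w"
proof (cases "u = 0 \<or> w = 0")
  case False
  let ?S = "{norm (u * w) |u w. u \<in> M \<and> norm u = 1 \<and> norm (w::'a) = 1}"
  obtain B where B: "\<And>a b :: 'a. norm (a * b) \<le> norm a * norm b * B"
    using alg_mult.nonneg_bounded by blast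
  have bdd: "bdd_above ?S"
  proof (rule bdd_aboveI[of _ B])
    fix t assume "t \<in> ?S"
    then obtain a b where "t = norm (a * b)" "norm a = 1" "norm (b :: 'a) = 1" by auto
    then show "t \<le> B" using B[of a b] by simp
  qed
  define u' w' where "u' = (1 / norm u) *\<^sub>R u" and "w' = (1 / norm w) *\<^sub>R w"
  have "u' \<in> M" "norm u' = 1" "norm w' = 1"
    using False assms subspace_M unfolding u'_def w'_def by (auto intro: subspace_scale)
  then have "norm (u' * w') \<in> ?S" by blast
  then have "norm (u' * w') \<le> omega M"
    unfolding omega_def by (rule cSup_upper[OF _ bdd])
  moreover have "norm (u' * w') = norm (u * w) / (norm u * norm w)"
    unfolding u'_def w'_def by simp
  ultimately show ?thesis using False by (simp add: divide_le_eq mult.assoc)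
qed auto

lemma omega_nonneg: "omega M \<ge> 0"
proof -
  have "0 \<le> omega M * norm (v 0) * norm (v 0)"
    using norm_mult_le_omega[OF v_in_M[of 0], of "v 0"] norm_ge_zero order_trans by blast
  then show ?thesis using norm_v[of 0] by simp
qed

lemma norm_le_max_norm_on_sphere:
  fixes f :: "'a \<Rightarrow> 'a"
  assumes "continuous_on (hsphere M p R) f" "y \<in> hsphere M p R"
  shows "norm (f y) \<le> max_norm_on_sphere M p R f"
  unfolding max_norm_on_sphere_def
proof (rule cSUP_upper[OF assms(2)])
  obtain K where "\<And>y. y \<in> hsphere M p R \<Longrightarrow> norm (f y) \<le> K"
    using bounded_on_hsphere[OF assms(1)] by blast
  then show "bdd_above ((\<lambda>y. norm (f y)) ` hsphere M p R)" by (auto intro!: bdd_aboveI[of _ K])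
qed

text \<open>
  The properties that the Cauchy kernel shares with its derivatives of order \<open>k\<close>: smoothness, right
  monogenicity, values in \<open>M\<close> (so that \<open>omega M\<close> bounds products with it) and homogeneity.
\<close>

definition cauchy_type_kernel :: "nat \<Rightarrow> ('a \<Rightarrow> 'a) \<Rightarrow> bool" where
  "cauchy_type_kernel k K \<longleftrightarrow> smooth_on v m (- {0}) K \<and>
    (\<forall>x\<in>M - {0}. (\<Sum>s\<le>m. pderiv_dir v s K x * v s) = 0 \<and> K x \<in> M \<and>
      (\<forall>r>0. K (r *\<^sub>R x) = (1 / r ^ (m + k)) *\<^sub>R K x))"

lemma cauchy_type_kernel_cauchy_kernel: "cauchy_type_kernel 0 (cauchy_kernel c m)"
  unfolding cauchy_type_kernel_def
proof (intro conjI ballI allI impI smooth_on_cauchy_kernel)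
  fix x assume x: "x \<in> M - {0}"
  then have pos: "(norm x)\<^sup>2 + 0 > 0" by simp
  have "pderiv_dir v s (cauchy_kernel c m) x = radial_partial (cauchy_weight 0) (cauchy_weight' 0) s x" for s
    unfolding cauchy_kernel_eq[abs_def]
    by (rule pderiv_dir_eq[where f="\<lambda>y. cauchy_weight 0 (norm y) *\<^sub>R c y"], rule has_partial_radial)
      (use x DERIV_cauchy_weight[OF pos] in auto)
  then show "(\<Sum>s\<le>m. pderiv_dir v s (cauchy_kernel c m) x * v s) = 0"
    using right_dirac_radial[of x "cauchy_weight 0" "cauchy_weight' 0"] mollifier_eq[OF pos] x
    by (simp add: mollifier_def)
  show "cauchy_kernel c m x \<in> M"
    using x unfolding cauchy_kernel_def by (intro subspace_scale[OF subspace_M] c_in_M) simp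
  show "cauchy_kernel c m (r *\<^sub>R x) = (1 / r ^ (m + 0)) *\<^sub>R cauchy_kernel c m x" if "r > 0" for r
    using that x by (simp add: cauchy_kernel_def conj.scaleR power_mult_distrib field_simps)
qed

text \<open>
  Right monogenicity is inherited because derivatives commute, values in \<open>M\<close> because \<open>M\<close> is closed
  and difference quotients stay in \<open>M\<close>; differentiation lowers the degree of homogeneity by one.
\<close>

lemma cauchy_type_kernel_pderiv_dir:
  assumes K: "cauchy_type_kernel k K" and s: "s \<le> m"
  shows "cauchy_type_kernel (Suc k) (pderiv_dir v s K)"
  unfolding cauchy_type_kernel_def
proof (intro conjI ballI allI impI)
  have sm: "smooth_on v m (- {0}) K" using K by (simp add: cauchy_type_kernel_def)
  show sm': "smooth_on v m (- {0}) (pderiv_dir v s K)" by (rule smooth_on_pderiv_dir[OF sm s])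
  have op: "openin (top_of_set M) (M - {0})" by (auto simp: openin_open intro!: exI[of _ "- {0}"])
  have sM: "smooth_on v m (M - {0}) K" by (rule smooth_on_subset[OF sm]) auto
  fix x assume x: "x \<in> M - {0}"
  have d: "has_partial v s K (pderiv_dir v s K x) x"
    by (rule smooth_on_has_partial[OF sm s]) (use x in auto)
  have ev: "eventually (\<lambda>\<epsilon>::real. x + \<epsilon> *\<^sub>R v s \<in> M - {0}) (nhds 0)"
    using line_open_M_minus_0 x s unfolding line_open_def by blast
  show "(\<Sum>t\<le>m. pderiv_dir v t (pderiv_dir v s K) x * v t) = 0"
  proof -
    have "pderiv_dir v s (\<lambda>x. \<Sum>t\<le>m. pderiv_dir v t K x * v t) x =
        (\<Sum>t\<le>m. pderiv_dir v s (pderiv_dir v t K) x * v t)"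
      by (rule pderiv_dir_eq[where f="\<lambda>x. \<Sum>t\<le>m. pderiv_dir v t K x * v t"], rule has_partial_sum_mult(2))
        (rule smooth_on_has_partial[OF smooth_on_pderiv_dir[OF sM] s x])
    moreover have "pderiv_dir v s (\<lambda>x. \<Sum>t\<le>m. pderiv_dir v t K x * v t) x = pderiv_dir v s (\<lambda>x. 0) x"
      by (rule pderiv_dir_cong[OF line_open_M_minus_0 x s])
        (use K in \<open>simp add: cauchy_type_kernel_def\<close>)
    moreover have "pderiv_dir v s (\<lambda>x. 0 :: 'a) x = 0"
      by (rule pderiv_dir_eq) simp
    moreover have "(\<Sum>t\<le>m. pderiv_dir v t (pderiv_dir v s K) x * v t) =
        (\<Sum>t\<le>m. pderiv_dir v s (pderiv_dir v t K) x * v t)"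
      by (intro sum.cong refl arg_cong2[of _ _ _ _ "(*)"] pderiv_dir_commute[OF op _ _ s x])
        (use sM in \<open>auto simp: smooth_on_def\<close>)
    ultimately show ?thesis by simp
  qed
  show "pderiv_dir v s K x \<in> M"
  proof (rule Lim_in_closed_set[OF closed_M _ _ d[unfolded has_vector_derivative_iff_quotient]])
    show "eventually (\<lambda>h. (1 / h) *\<^sub>R (K (x + (0 + h) *\<^sub>R v s) - K (x + 0 *\<^sub>R v s)) \<in> M) (at 0)"
    proof -
      have "eventually (\<lambda>\<epsilon>::real. x + \<epsilon> *\<^sub>R v s \<in> M - {0}) (at 0)"
        using ev by (simp add: eventually_at_filter eventually_mono)
      then show ?thesis
        by eventually_elim (use K x in \<open>auto simp: cauchy_type_kernel_def intro!: subspace_scale subspace_diff subspace_M\<close>)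
    qed
  qed simp
  fix r :: real assume r: "r > 0"
  have "((\<lambda>\<epsilon>. (1 / r ^ (m + k)) *\<^sub>R K (x + (\<epsilon> / r) *\<^sub>R v s)) has_vector_derivative
      (1 / r ^ (m + k)) *\<^sub>R ((1 / r) *\<^sub>R pderiv_dir v s K x)) (at 0)"
  proof (rule bounded_linear.has_vector_derivative[OF bounded_linear_scaleR_right])
    have "((\<lambda>\<epsilon>. \<epsilon> / r) has_vector_derivative 1 / r) (at 0)"
      by (auto intro!: derivative_eq_intros)
    moreover have "((\<lambda>\<epsilon>. K (x + \<epsilon> *\<^sub>R v s)) has_vector_derivative pderiv_dir v s K x) (at (0 / r))"
      using d by simp
    ultimately have "((\<lambda>\<epsilon>. K (x + \<epsilon> *\<^sub>R v s)) \<circ> (\<lambda>\<epsilon>. \<epsilon> / r) has_vector_derivative (1 / r) *\<^sub>R pderiv_dir v s K x) (at 0)"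
      by (rule vector_diff_chain_at)
    then show "((\<lambda>\<epsilon>. K (x + (\<epsilon> / r) *\<^sub>R v s)) has_vector_derivative (1 / r) *\<^sub>R pderiv_dir v s K x) (at 0)"
      by (simp add: o_def)
  qed
  moreover have "eventually (\<lambda>\<epsilon>. K (r *\<^sub>R x + \<epsilon> *\<^sub>R v s) = (1 / r ^ (m + k)) *\<^sub>R K (x + (\<epsilon> / r) *\<^sub>R v s)) (nhds 0)"
  proof -
    have "((\<lambda>\<epsilon>. \<epsilon> / r) \<longlongrightarrow> 0 / r) (nhds 0)" using r by (intro tendsto_intros filterlim_ident) auto
    then have "eventually (\<lambda>\<epsilon>. x + (\<epsilon> / r) *\<^sub>R v s \<in> M - {0}) (nhds 0)"
      using eventually_compose_filterlim[OF ev, of "\<lambda>\<epsilon>. \<epsilon> / r"] by simp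
    then show ?thesis
    proof eventually_elim
      case (elim \<epsilon>)
      then have "K (r *\<^sub>R (x + (\<epsilon> / r) *\<^sub>R v s)) = (1 / r ^ (m + k)) *\<^sub>R K (x + (\<epsilon> / r) *\<^sub>R v s)"
        using K r by (simp add: cauchy_type_kernel_def)
      then show ?case using r by (simp add: scaleR_add_right)
    qed
  qed
  moreover from eventually_nhds_x_imp_x[OF this] have "K (r *\<^sub>R x) = (1 / r ^ (m + k)) *\<^sub>R K x"
    by simp
  ultimately have "has_partial v s K ((1 / r ^ (m + k)) *\<^sub>R ((1 / r) *\<^sub>R pderiv_dir v s K x)) (r *\<^sub>R x)"
    using has_vector_derivative_cong_ev[where x=0 and S=UNIV and f="\<lambda>\<epsilon>. K (r *\<^sub>R x + \<epsilon> *\<^sub>R v s)"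
        and g="\<lambda>\<epsilon>. (1 / r ^ (m + k)) *\<^sub>R K (x + (\<epsilon> / r) *\<^sub>R v s)"]
    by simp
  from pderiv_dir_eq[where f=K and v=v and s=s and x="r *\<^sub>R x", OF this]
  show "pderiv_dir v s K (r *\<^sub>R x) = (1 / r ^ (m + Suc k)) *\<^sub>R pderiv_dir v s K x"
    by (simp add: mult.commute)
qed

lemma cauchy_type_kernel_nabla: "cauchy_type_kernel (mlength m h) (nabla v m h (cauchy_kernel c m))"
  by (rule nabla_induct[where P="\<lambda>k f g. cauchy_type_kernel k f" and g="cauchy_kernel c m"])
    (auto intro: cauchy_type_kernel_cauchy_kernel cauchy_type_kernel_pderiv_dir)

lemma norm_cauchy_type_kernel_le:
  assumes K: "cauchy_type_kernel k K" and y: "y \<in> M - {0}"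
  shows "norm (K y) \<le> max_norm_on_sphere M 0 1 K / norm y ^ (m + k)"
proof -
  define z where "z = (1 / norm y) *\<^sub>R y"
  have z: "z \<in> hsphere M 0 1" "z \<in> M - {0}" and yz: "y = norm y *\<^sub>R z"
    using y subspace_M by (auto simp: z_def hsphere_def subspace_scale)
  have "K y = (1 / norm y ^ (m + k)) *\<^sub>R K z"
    using K z(2) y by (subst yz) (simp add: cauchy_type_kernel_def)
  moreover have "norm (K z) \<le> max_norm_on_sphere M 0 1 K"
    by (rule norm_le_max_norm_on_sphere[OF continuous_on_subset[OF smooth_on_continuous] z(1)])
      (use K in \<open>auto simp: cauchy_type_kernel_def hsphere_def\<close>)
  ultimately show ?thesis by (simp add: divide_right_mono)
qed

lemma max_norm_on_sphere_nonneg: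
  fixes f :: "'a \<Rightarrow> 'a"
  assumes "p \<in> M" "R \<ge> 0" "continuous_on (hsphere M p R) f"
  shows "max_norm_on_sphere M p R f \<ge> 0"
  using hsphere_nonempty[OF assms(1,2)] norm_le_max_norm_on_sphere[OF assms(3)] norm_ge_zero order_trans
  by blast

text \<open>Every point near the sphere is close to its radial projection to the sphere.\<close>

lemma norm_near_sphere_le:
  fixes f :: "'a \<Rightarrow> 'a"
  assumes p: "p \<in> M" and R: "R > 0" and f: "continuous_on (hcball p R) f" and \<eta>: "\<eta> > 0"
  obtains r where "0 < r" "r < R" "\<And>y. y \<in> hcball p R \<Longrightarrow> r \<le> norm (y - p) \<Longrightarrow>
    norm (f y) \<le> max_norm_on_sphere M p R f + \<eta>"
proof -
  have "uniformly_continuous_on (hcball p R) f"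
    by (rule compact_uniformly_continuous[OF f compact_hcball])
  then obtain \<delta> where \<delta>: "\<delta> > 0"
    "\<And>y z. y \<in> hcball p R \<Longrightarrow> z \<in> hcball p R \<Longrightarrow> dist z y < \<delta> \<Longrightarrow> dist (f z) (f y) < \<eta>"
    using \<eta> unfolding uniformly_continuous_on_def by metis
  define r where "r = max (R / 2) (R - \<delta> / 2)"
  show ?thesis
  proof (rule that[of r])
    show "0 < r" "r < R" using R \<delta> by (auto simp: r_def)
    fix y assume y: "y \<in> hcball p R" "r \<le> norm (y - p)"
    define \<rho> where "\<rho> = norm (y - p)"
    have \<rho>: "0 < \<rho>" "\<rho> \<le> R" "R - \<rho> < \<delta>"
      using y R \<delta> by (auto simp: r_def \<rho>_def hcball_def)
    define z where "z = p + (R / \<rho>) *\<^sub>R (y - p)"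
    have z: "z \<in> hsphere M p R"
      using y p \<rho> R subspace_M
      by (auto simp: z_def hsphere_def hcball_def \<rho>_def[symmetric] intro!: subspace_add subspace_scale subspace_diff)
    have "z - y = ((R - \<rho>) / \<rho>) *\<^sub>R (y - p)"
      using \<rho> by (simp add: z_def diff_divide_distrib scaleR_diff_left)
    then have "norm (z - y) = R - \<rho>" using \<rho> by (simp add: \<rho>_def[symmetric])
    then have "dist (f z) (f y) < \<eta>"
      using \<rho> y z hsphere_subset_hcball by (intro \<delta>(2)) (auto simp: dist_norm)
    then have "norm (f y) \<le> norm (f z) + \<eta>"
      using norm_triangle_sub[of "f y" "f z"] by (simp add: dist_norm norm_minus_commute)
    also have "norm (f z) \<le> max_norm_on_sphere M p R f"
      by (rule norm_le_max_norm_on_sphere[OF continuous_on_subset[OF f hsphere_subset_hcball] z])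
    finally show "norm (f y) \<le> max_norm_on_sphere M p R f + \<eta>" by simp
  qed
qed

text \<open>For \<open>w r = r ^ a\<close> the divergence of the radial field is a multiple of \<open>w\<close>.\<close>

lemma integral_norm_power:
  assumes p: "p \<in> M" and R: "R > 0" and a: "a \<ge> 1"
  shows "set_integrable vol (hball M p R) (\<lambda>y. norm (y - p) ^ a)"
    and "(LINT y:hball M p R|vol. norm (y - p) ^ a) = sigma m * R ^ (a + m + 1) / real (m + 1 + a)"
proof -
  have bd: "\<bar>real a * r ^ (a - 1)\<bar> \<le> real a * R ^ (a - 1)" if "0 < r" "r \<le> R" for r
    using that by (auto simp: abs_mult intro!: mult_left_mono power_mono)
  have "(LINT y:hball M p R|vol. real (m + 1) * norm (y - p) ^ a + norm (y - p) * (real a * norm (y - p) ^ (a - 1)))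
      = R ^ a * sigma m * R ^ (m + 1)"
    by (rule radial_integral(2)[OF p R _ _ _ bd]) (auto intro!: continuous_intros derivative_eq_intros)
  moreover have "real (m + 1) * t ^ a + t * (real a * t ^ (a - 1)) = real (m + 1 + a) * t ^ a" for t :: real
    using a by (cases a) (auto simp: algebra_simps)
  ultimately have "(LINT y:hball M p R|vol. real (m + 1 + a) * norm (y - p) ^ a) = R ^ a * sigma m * R ^ (m + 1)"
    by (simp only:)
  then have "real (m + 1 + a) * (LINT y:hball M p R|vol. norm (y - p) ^ a) = sigma m * R ^ (a + m + 1)"
    by (simp add: power_add mult.commute mult.left_commute)
  then show "(LINT y:hball M p R|vol. norm (y - p) ^ a) = sigma m * R ^ (a + m + 1) / real (m + 1 + a)"
    by (simp add: field_simps)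
  show "set_integrable vol (hball M p R) (\<lambda>y. norm (y - p) ^ a)"
    by (rule set_integrable_hball[OF p, where T="{}" and K="R ^ a"])
      (auto intro!: continuous_intros power_mono simp: hball_def)
qed

lemma norm_power_kernel_le:
  assumes K: "cauchy_type_kernel i K" and y: "y \<in> M - {0}" "norm y \<le> R" and j: "m + i \<le> j"
  shows "norm y ^ j * norm (K y) \<le> R ^ (j - (m + i)) * max_norm_on_sphere M 0 1 K"
proof -
  let ?C = "max_norm_on_sphere M 0 1 K"
  have "continuous_on (hsphere M 0 1) K"
    by (rule continuous_on_subset[OF smooth_on_continuous])
      (use K in \<open>auto simp: cauchy_type_kernel_def hsphere_def\<close>)
  then have C: "?C \<ge> 0" using subspace_0[OF subspace_M] by (intro max_norm_on_sphere_nonneg) auto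
  have "norm y ^ j * norm (K y) \<le> norm y ^ j * (?C / norm y ^ (m + i))"
    using norm_cauchy_type_kernel_le[OF K y(1)] by (intro mult_left_mono) auto
  also have "\<dots> = norm y ^ (j - (m + i)) * ?C"
    using j y(1) by (simp add: power_diff)
  also have "\<dots> \<le> R ^ (j - (m + i)) * ?C"
    using y C by (intro mult_right_mono power_mono) auto
  finally show ?thesis .
qed

text \<open>
  On the sphere the weight \<open>norm (y - p) ^ (2 * N)\<close> is constant, and at \<open>p\<close> it removes the
  singularity, so it turns the boundary integral into a volume integral over the whole ball. Both
  functions being monogenic, only the gradient of the weight contributes. Since the weight
  concentrates at the sphere as \<open>N\<close> grows, any bound \<open>b\<close> on \<open>f\<close> matters near the sphere only.
\<close>

lemma norm_kernel_integral_le_weighted: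
  assumes p: "p \<in> M" and R: "R > 0" and G: "hcball p R \<subseteq> G" and f: "left_monogenic v m G f"
    and K: "cauchy_type_kernel k K" and N: "N \<ge> m + k + 2" and a: "a = 2 * N - 1 - m - k"
    and bd: "\<And>y. y \<in> hball M p R \<Longrightarrow> norm (f y) \<le> b y"
    and b: "set_integrable vol (hball M p R) (\<lambda>y. norm (y - p) ^ a * b y)"
  shows "R ^ (2 * N) * norm (sphere_integral v m p R (\<lambda>y. K (y - p)) f) \<le>
    2 * real N * (omega M)\<^sup>2 * max_norm_on_sphere M 0 1 K * (LINT y:hball M p R|vol. norm (y - p) ^ a * b y)"
proof -
  define C where "C = max_norm_on_sphere M 0 1 K"
  let ?A = "hball M p R" and ?n = "\<lambda>y. norm (y - p)" and ?K' = "\<lambda>s. pderiv_dir v s K"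
  let ?\<psi> = "\<lambda>y. ?n y ^ (2 * N) *\<^sub>R K (y - p)" and ?g = "\<lambda>y. 2 * real N * ?n y ^ (2 * N - 2)"
  let ?\<psi>' = "\<lambda>s y. ?n y ^ (2 * N) *\<^sub>R ?K' s (y - p) + (?g y * ((y - p) \<bullet> v s)) *\<^sub>R K (y - p)"
  have sm: "smooth_on v m (- {0}) K" using K by (simp add: cauchy_type_kernel_def)
  note K_cont = smooth_on_continuous[OF sm]
  have yM: "y - p \<in> M - {0}" "?n y \<le> R" if "y \<in> hcball p R" "y \<noteq> p" for y
    using that p subspace_M by (auto simp: hcball_def subspace_diff)
  have N': "2 * N \<noteq> 0" "2 * N - 2 \<noteq> 0" using N by auto
  have pow: "?n y ^ (2 * N) = ?n y * ?n y ^ (2 * N - 1)" "?n y ^ (2 * N - 2) * ?n y = ?n y ^ (2 * N - 1)" for y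
  proof -
    obtain n where "N = Suc n" using N by (cases N) auto
    then show "?n y ^ (2 * N) = ?n y * ?n y ^ (2 * N - 1)" "?n y ^ (2 * N - 2) * ?n y = ?n y ^ (2 * N - 1)"
      by simp_all
  qed
  have b\<^sub>0: "?n y ^ (2 * N - 1) * norm (K (y - p)) \<le> R ^ a * C" if "y \<in> hcball p R" "y \<noteq> p" for y
    using norm_power_kernel_le[OF K yM[OF that], of "2 * N - 1"] N a by (simp add: C_def)
  have fc: "continuous_on (hcball p R) f"
    by (rule continuous_on_subset[OF left_monogenic_continuous(1)[OF f] G])
  obtain Cf where Cf: "\<And>y. y \<in> hcball p R \<Longrightarrow> norm (f y) \<le> Cf" using bounded_on_hcball[OF fc] by blast
  have C0: "0 \<le> R ^ a * C" and Cnn: "C \<ge> 0"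
  proof -
    show "C \<ge> 0" unfolding C_def
      by (rule max_norm_on_sphere_nonneg)
        (auto intro!: continuous_on_subset[OF K_cont] subspace_0 subspace_M simp: hsphere_def)
    then show "0 \<le> R ^ a * C" using R by simp
  qed
  have "R ^ (2 * N) *\<^sub>R sphere_integral v m p R (\<lambda>y. K (y - p)) f = sphere_integral v m p R ?\<psi> f"
    unfolding sphere_integral_scaleR[symmetric] unfolding sphere_integral_def
    by (intro sum.cong refl sphere_form_integral_cong[OF p _ R]) (auto simp: hsphere_def)
  also have "\<dots> = (LINT y:?A|vol. (\<Sum>s\<le>m. ?\<psi>' s y * v s) * f y)"
  proof (rule gauss_monogenic[OF p R _ G f, where T="{p}"])
    show "continuous_on (hcball p R) ?\<psi>"
      unfolding continuous_on_eq_continuous_within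
    proof
      fix y assume y: "y \<in> hcball p R"
      show "continuous (at y within hcball p R) ?\<psi>"
      proof (cases "y = p")
        case False
        have "continuous_on (- {p}) ?\<psi>"
          by (intro continuous_intros continuous_on_compose2[OF K_cont]) auto
        then have "continuous (at y) ?\<psi>"
          using False continuous_on_eq_continuous_at[OF open_Compl[OF closed_singleton[of p]]] by blast
        then show ?thesis by (rule continuous_at_imp_continuous_at_within)
      next
        case True
        have "norm (?\<psi> y) \<le> ?n y * (R ^ a * C)" if "y \<in> hcball p R" "y \<noteq> p" for y
          using mult_left_mono[OF b\<^sub>0[OF that], of "?n y"] unfolding pow(1) by (simp add: mult.assoc)
        then have "eventually (\<lambda>y. norm (?\<psi> y) \<le> ?n y * (R ^ a * C)) (at p within hcball p R)"
          unfolding eventually_at_filter by (intro always_eventually) auto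
        moreover have "((\<lambda>y. ?n y * (R ^ a * C)) \<longlongrightarrow> norm (p - p) * (R ^ a * C)) (at p within hcball p R)"
          by (intro tendsto_intros)
        then have "((\<lambda>y. ?n y * (R ^ a * C)) \<longlongrightarrow> 0) (at p within hcball p R)" by simp
        ultimately have "(?\<psi> \<longlongrightarrow> 0) (at p within hcball p R)"
          by (rule Lim_null_comparison)
        moreover have "?\<psi> p = 0" using N' by simp
        ultimately show ?thesis unfolding True continuous_within by (simp only:)
      qed
    qed
    fix s assume s: "s \<le> m"
    show "continuous_on (?A - {p}) (?\<psi>' s)"
      by (intro continuous_intros continuous_on_compose2[OF K_cont]
          continuous_on_compose2[OF smooth_on_continuous[OF smooth_on_pderiv_dir[OF sm s]]]) auto
    fix y
    show "has_partial v s ?\<psi> (?\<psi>' s y) y" if "y \<in> ?A - {p}"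
    proof -
      have "has_partial v s (\<lambda>y. (?n y)\<^sup>2) (2 * ((y - p) \<bullet> v s)) y"
        by (rule has_partial_translate[where f="\<lambda>y. (norm y)\<^sup>2"], rule has_partial_norm_sq)
      moreover have "((\<lambda>t. t ^ N) has_real_derivative real N * ((?n y)\<^sup>2) ^ (N - 1)) (at ((?n y)\<^sup>2))"
        using DERIV_pow[of N "(?n y)\<^sup>2"] by simp
      ultimately have "has_partial v s (\<lambda>y. ((?n y)\<^sup>2) ^ N) (real N * ((?n y)\<^sup>2) ^ (N - 1) * (2 * ((y - p) \<bullet> v s))) y"
        by (rule has_partial_compose_real[where f="\<lambda>y. (?n y)\<^sup>2" and v=v and s=s and y=y])
      moreover have "((?n y)\<^sup>2) ^ N = ?n y ^ (2 * N)" "((?n y)\<^sup>2) ^ (N - 1) = ?n y ^ (2 * N - 2)" for y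
        by (simp_all add: diff_mult_distrib2 flip: power_mult)
      moreover have "real N * z * (2 * t) = 2 * real N * z * t" for z t :: real by simp
      ultimately have "has_partial v s (\<lambda>y. ?n y ^ (2 * N)) (?g y * ((y - p) \<bullet> v s)) y"
        by (simp only:)
      moreover have "has_partial v s (\<lambda>y. K (y - p)) (?K' s (y - p)) y"
        by (rule has_partial_translate[where f=K], rule smooth_on_has_partial[OF sm s]) (use that in auto)
      ultimately show ?thesis
        by (rule has_partial_scaleR[where f="\<lambda>y. ?n y ^ (2 * N)" and g="\<lambda>y. K (y - p)" and v=v and s=s and x=y])
    qed
    let ?C' = "R ^ (2 * N - (m + Suc k)) * max_norm_on_sphere M 0 1 (?K' s)"
    show "norm (?\<psi>' s y) \<le> \<bar>?C'\<bar> + 2 * real N * (R ^ a * C)" if y: "y \<in> ?A"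
    proof (cases "y = p")
      case True
      then have "norm (?\<psi>' s y) = 0" using N' by simp
      then show ?thesis using C0 by simp
    next
      case False
      have yc: "y \<in> hcball p R" using y hball_subset_hcball by blast
      show ?thesis
      proof (intro norm_triangle_le add_mono)
        show "norm (?n y ^ (2 * N) *\<^sub>R ?K' s (y - p)) \<le> \<bar>?C'\<bar>"
          using norm_power_kernel_le[OF cauchy_type_kernel_pderiv_dir[OF K s] yM[OF yc False], of "2 * N"] N by simp
        have "\<bar>(y - p) \<bullet> v s\<bar> \<le> ?n y"
          using Cauchy_Schwarz_ineq2[of "y - p" "v s"] norm_v[OF s] by simp
        then have "norm ((?g y * ((y - p) \<bullet> v s)) *\<^sub>R K (y - p)) \<le> ?g y * ?n y * norm (K (y - p))"
          unfolding norm_scaleR abs_mult by (intro mult_right_mono mult_mono) auto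
        also have "\<dots> = 2 * real N * (?n y ^ (2 * N - 1) * norm (K (y - p)))"
          by (simp only: pow(2)[symmetric] mult.assoc)
        also have "\<dots> \<le> 2 * real N * (R ^ a * C)"
          by (intro mult_left_mono b\<^sub>0[OF yc False]) simp
        finally show "norm ((?g y * ((y - p) \<bullet> v s)) *\<^sub>R K (y - p)) \<le> 2 * real N * (R ^ a * C)" .
      qed
    qed
  qed simp
  also have "\<dots> = (LINT y:?A|vol. (?g y *\<^sub>R K (y - p)) * ((y - p) * f y))"
  proof (rule set_lebesgue_integral_cong)
    show "\<forall>y. y \<in> ?A \<longrightarrow> (\<Sum>s\<le>m. ?\<psi>' s y * v s) * f y = (?g y *\<^sub>R K (y - p)) * ((y - p) * f y)"
    proof (intro allI impI)
      fix y assume y: "y \<in> ?A"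
      have "(\<Sum>s\<le>m. ?\<psi>' s y * v s) = ?n y ^ (2 * N) *\<^sub>R (\<Sum>s\<le>m. ?K' s (y - p) * v s) +
          ?g y *\<^sub>R (\<Sum>s\<le>m. K (y - p) * (((y - p) \<bullet> v s) *\<^sub>R v s))"
        by (simp add: distrib_right sum.distrib scaleR_sum_right)
      also have "?n y ^ (2 * N) *\<^sub>R (\<Sum>s\<le>m. ?K' s (y - p) * v s) = 0"
        using K N' yM[of y] y hball_subset_hcball[of p R]
        by (cases "y = p") (auto simp: cauchy_type_kernel_def)
      also have "(\<Sum>s\<le>m. K (y - p) * (((y - p) \<bullet> v s) *\<^sub>R v s)) = K (y - p) * (y - p)"
      proof -
        have "y - p \<in> M" using y p subspace_M by (simp add: hball_def subspace_diff)
        then show ?thesis by (simp only: sum_distrib_left[symmetric] frame_expansion[symmetric])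
      qed
      finally show "(\<Sum>s\<le>m. ?\<psi>' s y * v s) * f y = (?g y *\<^sub>R K (y - p)) * ((y - p) * f y)"
        by (simp add: mult.assoc)
    qed
  qed simp
  finally have SI: "R ^ (2 * N) *\<^sub>R sphere_integral v m p R (\<lambda>y. K (y - p)) f =
      (LINT y:?A|vol. (?g y *\<^sub>R K (y - p)) * ((y - p) * f y))" .
  let ?c = "2 * real N * (omega M)\<^sup>2 * C"
  have c: "?c \<ge> 0" using Cnn by simp
  have pt: "norm ((?g y *\<^sub>R K (y - p)) * ((y - p) * f y)) \<le> ?c * (?n y ^ a * norm (f y))" if y: "y \<in> ?A" for y
  proof (cases "y = p")
    case True
    then have "norm ((?g y *\<^sub>R K (y - p)) * ((y - p) * f y)) = 0" by simp
    also have "0 \<le> ?c * (?n y ^ a * norm (f y))" by (rule mult_nonneg_nonneg[OF c]) simp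
    finally show ?thesis .
  next
    case False
    have yM: "y - p \<in> M - {0}" using yM False y hball_subset_hcball by blast
    then have KM: "?g y *\<^sub>R K (y - p) \<in> M"
      using K subspace_M by (auto simp: cauchy_type_kernel_def intro: subspace_scale)
    have "norm ((?g y *\<^sub>R K (y - p)) * ((y - p) * f y)) \<le>
        omega M * norm (?g y *\<^sub>R K (y - p)) * (omega M * ?n y * norm (f y))"
      using yM by (intro order_trans[OF norm_mult_le_omega[OF KM]] mult_left_mono norm_mult_le_omega
          mult_nonneg_nonneg omega_nonneg) auto
    also have "\<dots> = 2 * real N * (omega M)\<^sup>2 * (?n y ^ (2 * N - 2) * ?n y * norm (K (y - p))) * norm (f y)"
      by (simp add: power2_eq_square)
    also have "\<dots> \<le> 2 * real N * (omega M)\<^sup>2 * (?n y ^ (2 * N - 2) * ?n y * (C / ?n y ^ (m + k))) * norm (f y)"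
      unfolding C_def by (intro mult_left_mono mult_right_mono norm_cauchy_type_kernel_le[OF K yM]) auto
    also have "?n y ^ (2 * N - 2) * ?n y * (C / ?n y ^ (m + k)) = C * ?n y ^ a"
    proof -
      have "2 * N - 1 = a + (m + k)" using N a by simp
      then have "?n y ^ (2 * N - 1) = ?n y ^ a * ?n y ^ (m + k)" by (simp only: power_add)
      then show ?thesis using yM by (simp add: pow(2))
    qed
    finally show ?thesis by (simp only: mult.assoc)
  qed
  have "norm (LINT y:?A|vol. (?g y *\<^sub>R K (y - p)) * ((y - p) * f y)) \<le> (LINT y:?A|vol. ?c * (?n y ^ a * b y))"
  proof (rule norm_set_integral_le)
    show "set_integrable vol ?A (\<lambda>y. (?g y *\<^sub>R K (y - p)) * ((y - p) * f y))"
    proof (rule set_integrable_hball[OF p, where T="{p}" and K="?c * (R ^ a * \<bar>Cf\<bar>)"])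
      show "continuous_on (?A - {p}) (\<lambda>y. (?g y *\<^sub>R K (y - p)) * ((y - p) * f y))"
        using hball_subset_hcball[of p R]
        by (intro alg_mult.continuous_on continuous_intros continuous_on_compose2[OF K_cont]
            continuous_on_subset[OF fc]) auto
      show "norm ((?g y *\<^sub>R K (y - p)) * ((y - p) * f y)) \<le> ?c * (R ^ a * \<bar>Cf\<bar>)" if "y \<in> ?A" for y
      proof (rule order_trans[OF pt[OF that] mult_left_mono[OF _ c]], rule mult_mono)
        show "norm (f y) \<le> \<bar>Cf\<bar>" using Cf[of y] that hball_subset_hcball by fastforce
      qed (use that R in \<open>auto simp: hball_def intro: power_mono\<close>)
    qed simp
    show "set_integrable vol ?A (\<lambda>y. ?c * (?n y ^ a * b y))"
      by (intro set_integrable_mult_right b)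
    show "norm ((?g y *\<^sub>R K (y - p)) * ((y - p) * f y)) \<le> ?c * (?n y ^ a * b y)" if "y \<in> ?A" for y
      by (rule order_trans[OF pt[OF that] mult_left_mono[OF _ c]]) (use bd[OF that] in \<open>simp add: mult_left_mono\<close>)
  qed
  then show ?thesis
    unfolding SI[symmetric] using R by (simp add: C_def)
qed

text \<open>
  By continuity \<open>f\<close> is at most its maximum on the sphere plus \<open>\<eta>\<close> on a shell \<open>r \<le> norm (y - p)\<close>;
  further inside any bound \<open>C\<close> will do, because its contribution decays like \<open>(r / R) ^ (2 * N)\<close>.
  Then \<open>N \<rightarrow> \<infinity>\<close> and \<open>\<eta> \<rightarrow> 0\<close>.
\<close>

theorem norm_kernel_integral_le:
  assumes p: "p \<in> M" and R: "R > 0" and G: "hcball p R \<subseteq> G" and f: "left_monogenic v m G f"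
    and K: "cauchy_type_kernel k K"
  shows "norm (sphere_integral v m p R (\<lambda>y. K (y - p)) f) \<le>
    sigma m * (omega M)\<^sup>2 * max_norm_on_sphere M 0 1 K / R ^ k * max_norm_on_sphere M p R f"
proof -
  let ?S = "norm (sphere_integral v m p R (\<lambda>y. K (y - p)) f)"
  define mf where "mf = max_norm_on_sphere M p R f"
  define W where "W = (omega M)\<^sup>2 * max_norm_on_sphere M 0 1 K * sigma m / R ^ k"
  have fc: "continuous_on (hcball p R) f"
    by (rule continuous_on_subset[OF left_monogenic_continuous(1)[OF f] G])
  have "continuous_on (hsphere M 0 1) K"
    by (rule continuous_on_subset[OF smooth_on_continuous])
      (use K in \<open>auto simp: cauchy_type_kernel_def hsphere_def\<close>)
  then have W: "W \<ge> 0"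
    unfolding W_def using sigma_pos[of m] R subspace_0[OF subspace_M]
    by (intro divide_nonneg_nonneg mult_nonneg_nonneg max_norm_on_sphere_nonneg) auto
  obtain C where C: "C \<ge> 0" "\<And>y. y \<in> hcball p R \<Longrightarrow> norm (f y) \<le> C"
    using bounded_on_hcball[OF fc] by blast
  have est: "?S \<le> W * (mf + \<eta>)" if \<eta>: "\<eta> > 0" for \<eta>
  proof -
    obtain r where r: "0 < r" "r < R"
      "\<And>y. y \<in> hcball p R \<Longrightarrow> r \<le> norm (y - p) \<Longrightarrow> norm (f y) \<le> mf + \<eta>"
      using norm_near_sphere_le[OF p R fc \<eta>] unfolding mf_def by blast
    have mf: "mf + \<eta> \<ge> 0"
      using max_norm_on_sphere_nonneg[OF p less_imp_le[OF R] continuous_on_subset[OF fc hsphere_subset_hcball]] \<eta>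
      by (simp add: mf_def)
    have bound: "?S \<le> W * (1 + real k * (1 / real (Suc n))) * ((mf + \<eta>) + C * (r / R) ^ (2 * n))" for n
    proof -
      define N where "N = n + m + k + 2"
      define a where "a = 2 * N - 1 - m - k"
      (* D = 2 * N - k is the exponent of the radius in the integral of norm (y - p) ^ a *)
      define D where "D = 2 * n + 2 * m + k + 4"
      have a: "a \<ge> 1" "a + m + 1 = D" "2 * N = D + k" "D = m + 1 + a" by (auto simp: a_def N_def D_def)
      define b where "b y = (mf + \<eta>) + C * indicator (hball M p r) y" for y
      let ?I = "\<lambda>\<rho>. LINT y:hball M p \<rho>|vol. norm (y - p) ^ a"
      note pow = integral_norm_power[OF p _ a(1)]
      have sub: "hball M p r \<subseteq> hball M p R" using r(2) by (auto simp: hball_def)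
      have eq: "(\<lambda>y. indicator (hball M p R) y *\<^sub>R (norm (y - p) ^ a * b y)) =
          (\<lambda>y. (mf + \<eta>) * (indicator (hball M p R) y *\<^sub>R norm (y - p) ^ a) +
               C * (indicator (hball M p r) y *\<^sub>R norm (y - p) ^ a))"
        using sub by (auto simp: fun_eq_iff b_def indicator_def algebra_simps)
      have b_int: "set_integrable vol (hball M p R) (\<lambda>y. norm (y - p) ^ a * b y)"
        unfolding set_integrable_def eq
        using pow(1)[OF R] pow(1)[OF r(1)] unfolding set_integrable_def by (intro Bochner_Integration.integrable_add integrable_mult_right) auto
      have "(LINT y:hball M p R|vol. norm (y - p) ^ a * b y) = (mf + \<eta>) * ?I R + C * ?I r"
        unfolding set_lebesgue_integral_def eq
        using pow(1)[OF R] pow(1)[OF r(1)] unfolding set_integrable_def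
        by (subst Bochner_Integration.integral_add) auto
      also have "\<dots> = (mf + \<eta>) * (sigma m * R ^ D / real D) + C * (sigma m * r ^ D / real D)"
        by (simp only: pow(2)[OF R] pow(2)[OF r(1)] a(2) a(4)[symmetric])
      finally have I: "(LINT y:hball M p R|vol. norm (y - p) ^ a * b y) = \<dots>" .
      have "R ^ (2 * N) * ?S \<le> 2 * real N * (omega M)\<^sup>2 * max_norm_on_sphere M 0 1 K *
          (LINT y:hball M p R|vol. norm (y - p) ^ a * b y)"
      proof (rule norm_kernel_integral_le_weighted[OF p R G f K _ a_def _ b_int])
        show "m + k + 2 \<le> N" by (simp add: N_def)
        show "norm (f y) \<le> b y" if y: "y \<in> hball M p R" for y
        proof (cases "y \<in> hball M p r")
          case True
          then show ?thesis using C(2)[of y] y hball_subset_hcball[of p R] mf by (auto simp: b_def)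
        next
          case False
          then have "r \<le> norm (y - p)" using y by (auto simp: hball_def)
          then show ?thesis using r(3)[of y] y hball_subset_hcball[of p R] False by (auto simp: b_def)
        qed
      qed
      then have "?S \<le> 2 * real N * (omega M)\<^sup>2 * max_norm_on_sphere M 0 1 K *
          (LINT y:hball M p R|vol. norm (y - p) ^ a * b y) / R ^ (2 * N)"
        using R by (simp add: le_divide_eq mult.commute)
      also have "\<dots> = W * (2 * real N / real D) * ((mf + \<eta>) + C * (r / R) ^ D)"
      proof -
        have "R ^ (2 * N) = R ^ D * R ^ k" by (simp add: a(3) power_add)
        moreover have "real D > 0" by (simp add: D_def)
        ultimately show ?thesis
          unfolding I W_def using R by (simp add: power_divide field_simps)
      qed
      also have "\<dots> \<le> W * (1 + real k * (1 / real (Suc n))) * ((mf + \<eta>) + C * (r / R) ^ (2 * n))"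
      proof (rule mult_mono)
        have "real k / real D \<le> real k / real (Suc n)"
          by (intro divide_left_mono) (auto simp: D_def)
        moreover have "2 * real N = real D + real k"
          using a(3) by (metis of_nat_add of_nat_mult of_nat_numeral)
        moreover have "real D > 0" by (simp add: D_def)
        ultimately have "2 * real N / real D \<le> 1 + real k * (1 / real (Suc n))"
          by (simp add: add_divide_distrib)
        then show "W * (2 * real N / real D) \<le> W * (1 + real k * (1 / real (Suc n)))"
          using W by (rule mult_left_mono)
        have "(r / R) ^ D \<le> (r / R) ^ (2 * n)"
          using r by (intro power_decreasing) (auto simp: D_def)
        then show "(mf + \<eta>) + C * (r / R) ^ D \<le> (mf + \<eta>) + C * (r / R) ^ (2 * n)"
          using C by (simp add: mult_left_mono)
        show "0 \<le> W * (1 + real k * (1 / real (Suc n)))" using W by simp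
        show "0 \<le> (mf + \<eta>) + C * (r / R) ^ D" using mf C r by simp
      qed
      finally show ?thesis .
    qed
    have q: "\<bar>(r / R)\<^sup>2\<bar> < 1"
      using r by (simp add: power_less_one_iff abs_square_less_1)
    have "(\<lambda>n. W * (1 + real k * (1 / real (Suc n))) * ((mf + \<eta>) + C * ((r / R)\<^sup>2) ^ n)) \<longlonglongrightarrow>
        W * (1 + real k * 0) * ((mf + \<eta>) + C * 0)"
      by (intro tendsto_intros LIMSEQ_Suc[OF lim_1_over_n] LIMSEQ_power_zero) (use q in simp)
    then have "(\<lambda>n. W * (1 + real k * (1 / real (Suc n))) * ((mf + \<eta>) + C * (r / R) ^ (2 * n))) \<longlonglongrightarrow> W * (mf + \<eta>)"
      by (simp add: power_mult)
    then show ?thesis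
      by (rule LIMSEQ_le_const) (use bound in blast)
  qed
  have "((\<lambda>\<eta>. W * (mf + \<eta>)) \<longlongrightarrow> W * (mf + 0)) (at_right 0)"
    by (intro tendsto_intros)
  moreover have "eventually (\<lambda>\<eta>. ?S \<le> W * (mf + \<eta>)) (at_right 0)"
    using eventually_at_right_less[of 0] by eventually_elim (rule est)
  ultimately have "?S \<le> W * (mf + 0)"
    by (rule tendsto_lowerbound) simp
  then show ?thesis by (simp add: W_def mf_def mult.commute mult.left_commute)
qed

theorem nabla_estimate:
  assumes p: "p \<in> M" and R: "R > 0" and G: "hcball p R \<subseteq> G" and f: "left_monogenic v m G f"
  shows "norm (nabla v m h f p) \<le> cauchy_const c M v m h / R ^ mlength m h * max_norm_on_sphere M p R f"
proof -
  have "p \<in> hball M p R" using p R by (simp add: hball_def)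
  from nabla_cauchy_formula[OF p R G f this, of h]
  have "norm (nabla v m h f p) =
      norm (sphere_integral v m p R (\<lambda>y. nabla v m h (cauchy_kernel c m) (y - p)) f)"
    by (simp add: power_abs)
  also have "\<dots> \<le> cauchy_const c M v m h / R ^ mlength m h * max_norm_on_sphere M p R f"
    using norm_kernel_integral_le[OF p R G f cauchy_type_kernel_nabla[of h]]
    by (simp add: cauchy_const_def)
  finally show ?thesis .
qed

end

section \<open>Real analyticity\<close>

text \<open>One term of the exponential series is at most its sum.\<close>

lemma power_self_le_exp_fact: "real n ^ n \<le> exp 1 ^ n * fact n"
proof -
  have "real n ^ n /\<^sub>R fact n \<le> (\<Sum>k. real n ^ k /\<^sub>R fact k)"
    using sum_le_suminf[OF summable_exp_generic[of "real n"], of "{n}"] by simp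
  then have "real n ^ n / fact n \<le> exp (real n)"
    by (simp add: exp_def divide_inverse mult.commute)
  also have "exp (real n) = exp 1 ^ n"
    using exp_of_nat_mult[of n "1::real"] by simp
  finally show ?thesis by (simp add: divide_le_eq)
qed

lemma summable_on_times_geometric:
  fixes g :: "'b \<Rightarrow> real"
  assumes "g summable_on S" "\<And>k. k \<in> S \<Longrightarrow> g k \<ge> 0"
  shows "(\<lambda>(k, n::nat). g k * (1/2) ^ n) summable_on S \<times> UNIV"
proof -
  have geo: "((\<lambda>n. (1/2) ^ n :: real) has_sum 2) UNIV"
    using norm_summable_imp_has_sum[of "\<lambda>n. (1/2) ^ n :: real" 2] geometric_sums[of "1/2 :: real"]
    by (simp add: summable_geometric)
  have row: "((\<lambda>n. norm (g k * (1/2) ^ n)) has_sum (g k * 2)) UNIV" if "k \<in> S" for k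
    using has_sum_cmult_right[OF geo, of "g k"] assms(2)[OF that] by (simp add: abs_mult)
  have "(\<lambda>x. norm (case x of (k, n::nat) \<Rightarrow> g k * (1/2) ^ n)) summable_on S \<times> UNIV"
    unfolding Infinite_Sum.abs_summable_on_Sigma_iff
  proof (intro conjI ballI)
    show "(\<lambda>n. norm (case (k, n::nat) of (k, n) \<Rightarrow> g k * (1/2) ^ n)) summable_on UNIV" if "k \<in> S" for k
      using row[OF that] by (auto simp: summable_on_def)
    have "(\<lambda>k. \<Sum>\<^sub>\<infinity>n::nat. norm (case (k, n) of (k, n) \<Rightarrow> g k * (1/2) ^ n)) summable_on S \<longleftrightarrow>
        (\<lambda>k. g k * 2) summable_on S"
      by (intro summable_on_cong) (use row infsumI in fastforce)
    moreover have "(\<lambda>k. g k * 2) summable_on S"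
      by (rule summable_on_cmult_left[OF assms(1)])
    moreover have "(\<lambda>k. norm (\<Sum>\<^sub>\<infinity>n::nat. norm (case (k, n) of (k, n) \<Rightarrow> g k * (1/2) ^ n))) =
      (\<lambda>k. \<Sum>\<^sub>\<infinity>n::nat. norm (case (k, n) of (k, n) \<Rightarrow> g k * (1/2) ^ n))"
      by (intro ext) (simp add: infsum_nonneg)
    ultimately show "(\<lambda>k. norm (\<Sum>\<^sub>\<infinity>n::nat. norm (case (k, n) of (k, n) \<Rightarrow> g k * (1/2) ^ n))) summable_on S"
      by simp
  qed
  then show ?thesis by (rule abs_summable_summable)
qed

definition multi_indices :: "'i set \<Rightarrow> ('i \<Rightarrow> nat) set" where
  "multi_indices I = {k. \<forall>s. s \<notin> I \<longrightarrow> k s = 0}"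

lemma multi_indices_empty: "multi_indices {} = {\<lambda>_. 0}"
  by (auto simp: multi_indices_def)

lemma bij_betw_multi_indices_insert:
  assumes "s \<notin> I"
  shows "bij_betw (\<lambda>(k, n). k(s := n)) (multi_indices I \<times> UNIV) (multi_indices (insert s I))"
proof (rule bij_betw_byWitness[where f'="\<lambda>k. (k(s := 0), k s)"])
  show "\<forall>a\<in>multi_indices I \<times> UNIV. (\<lambda>k. (k(s := 0), k s)) ((\<lambda>(k, n). k(s := n)) a) = a"
    using assms by (auto simp: multi_indices_def fun_eq_iff)
qed (auto simp: multi_indices_def split: if_splits)

lemma prod_fun_upd_insert:
  fixes F :: "'i \<Rightarrow> nat \<Rightarrow> 'c::comm_monoid_mult"
  assumes "finite I" "s \<notin> I"
  shows "(\<Prod>j\<in>insert s I. F j ((k(s := n)) j)) = F s n * (\<Prod>j\<in>I. F j (k j))"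
proof -
  have "(\<Prod>j\<in>I. F j ((k(s := n)) j)) = (\<Prod>j\<in>I. F j (k j))"
    using assms by (intro prod.cong) auto
  then show ?thesis using assms by simp
qed

lemma summable_on_multi_geometric:
  "finite I \<Longrightarrow> (\<lambda>k. \<Prod>s\<in>I. (1/2 :: real) ^ k s) summable_on multi_indices I"
proof (induction I rule: finite_induct)
  case empty
  then show ?case by (simp add: multi_indices_empty)
next
  case (insert s I)
  have "(\<lambda>(k, n::nat). (\<Prod>s\<in>I. (1/2 :: real) ^ k s) * (1/2) ^ n) summable_on multi_indices I \<times> UNIV"
    by (rule summable_on_times_geometric[OF insert.IH]) (simp add: prod_nonneg)
  also have "(\<lambda>(k, n::nat). (\<Prod>s\<in>I. (1/2 :: real) ^ k s) * (1/2) ^ n) =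
      (\<lambda>x. (\<lambda>k. \<Prod>s\<in>insert s I. (1/2 :: real) ^ k s) ((\<lambda>(k, n). k(s := n)) x))"
    using prod_fun_upd_insert[OF insert.hyps, of "\<lambda>j n. (1/2 :: real) ^ n"]
    by (auto simp: fun_eq_iff mult.commute simp del: prod.insert)
  also have "\<dots> summable_on multi_indices I \<times> UNIV \<longleftrightarrow>
      (\<lambda>k. \<Prod>s\<in>insert s I. (1/2 :: real) ^ k s) summable_on multi_indices (insert s I)"
    by (rule summable_on_reindex_bij_betw[OF bij_betw_multi_indices_insert[OF insert.hyps(2)]])
  finally show ?case .
qed

context hypercomplex_frame
begin

text \<open>
  Derivatives with respect to a list of coordinates interpolate between the function and \<open>nabla\<close>,
  which makes induction over the coordinates possible.
\<close>

definition iterated_partial :: "nat list \<Rightarrow> (nat \<Rightarrow> nat) \<Rightarrow> ('a \<Rightarrow> 'a) \<Rightarrow> 'a \<Rightarrow> 'a" where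
  "iterated_partial l k f = foldr (\<lambda>s. pderiv_dir v s ^^ k s) l f"

lemma iterated_partial_simps:
  "iterated_partial [] k f = f"
  "iterated_partial (s # l) k f = (pderiv_dir v s ^^ k s) (iterated_partial l k f)"
  by (simp_all add: iterated_partial_def)

lemma iterated_partial_cong:
  "(\<And>s. s \<in> set l \<Longrightarrow> k s = k' s) \<Longrightarrow> iterated_partial l k f = iterated_partial l k' f"
  by (induction l) (simp_all add: iterated_partial_simps)

lemma left_monogenic_power_pderiv:
  "openin (top_of_set M) G \<Longrightarrow> left_monogenic v m G f \<Longrightarrow> s \<le> m \<Longrightarrow>
    left_monogenic v m G ((pderiv_dir v s ^^ n) f)"
  by (induction n) (auto intro: left_monogenic_pderiv_dir)

lemma left_monogenic_iterated_partial:
  "openin (top_of_set M) G \<Longrightarrow> left_monogenic v m G f \<Longrightarrow> set l \<subseteq> {..m} \<Longrightarrow>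
    left_monogenic v m G (iterated_partial l k f)"
  by (induction l) (auto simp: iterated_partial_simps intro: left_monogenic_power_pderiv)

lemma nabla_unit: "s \<le> m \<Longrightarrow> nabla v m (\<lambda>j. if j = s then 1 else 0) f = pderiv_dir v s f"
proof -
  have "iterated_partial l (\<lambda>j. if j = s then 1 else 0) f = (if s \<in> set l then pderiv_dir v s f else f)"
    if "distinct l" for l
    using that by (induction l) (auto simp: iterated_partial_simps)
  from this[of "[0..<Suc m]"] show "s \<le> m \<Longrightarrow> ?thesis"
    by (simp add: nabla_def iterated_partial_def del: upt_Suc)
qed

text \<open>A single constant that serves all first-order derivatives at once.\<close>

definition gradient_const :: real where
  "gradient_const = (\<Sum>s\<le>m. cauchy_const c M v m (\<lambda>j. if j = s then 1 else 0))"

lemma cauchy_const_nonneg: "cauchy_const c M v m h \<ge> 0"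
proof -
  have "continuous_on (hsphere M 0 1) (nabla v m h (cauchy_kernel c m))"
    by (rule continuous_on_subset[OF smooth_on_continuous])
      (use cauchy_type_kernel_nabla[of h] in \<open>auto simp: cauchy_type_kernel_def hsphere_def\<close>)
  then show ?thesis
    unfolding cauchy_const_def using sigma_pos[of m] subspace_0[OF subspace_M]
    by (intro mult_nonneg_nonneg max_norm_on_sphere_nonneg) auto
qed

lemma gradient_const_nonneg: "gradient_const \<ge> 0"
  unfolding gradient_const_def by (intro sum_nonneg cauchy_const_nonneg)

lemma gradient_estimate:
  assumes p: "p \<in> M" and R: "R > 0" and G: "hcball p R \<subseteq> G" and f: "left_monogenic v m G f"
    and s: "s \<le> m" and A: "\<And>y. y \<in> hcball p R \<Longrightarrow> norm (f y) \<le> A"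
  shows "norm (pderiv_dir v s f p) \<le> gradient_const / R * A"
proof -
  let ?h = "\<lambda>j. if j = s then 1 else 0 :: nat"
  have h: "mlength m ?h = 1" using s by (simp add: mlength_def)
  have "norm (pderiv_dir v s f p) \<le> cauchy_const c M v m ?h / R * max_norm_on_sphere M p R f"
    using nabla_estimate[OF p R G f, of ?h] by (simp add: nabla_unit[OF s] h)
  also have "\<dots> \<le> gradient_const / R * A"
  proof (intro mult_mono divide_right_mono)
    show "cauchy_const c M v m ?h \<le> gradient_const"
      unfolding gradient_const_def using s cauchy_const_nonneg
      by (intro member_le_sum[where f="\<lambda>s. cauchy_const c M v m (\<lambda>j. if j = s then 1 else 0)"]) auto
    show "max_norm_on_sphere M p R f \<le> A"
      unfolding max_norm_on_sphere_def
      by (rule cSUP_least[OF hsphere_nonempty[OF p less_imp_le[OF R]]]) (use A hsphere_subset_hcball in blast)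
    show "0 \<le> max_norm_on_sphere M p R f"
      by (rule max_norm_on_sphere_nonneg[OF p less_imp_le[OF R]
            continuous_on_subset[OF left_monogenic_continuous(1)[OF f]]])
        (use G hsphere_subset_hcball in blast)
  qed (use R gradient_const_nonneg in auto)
  finally show ?thesis .
qed

lemma hcball_subset_hcball:
  assumes "x \<in> hcball p r" "r + \<rho> \<le> R" shows "hcball x \<rho> \<subseteq> hcball p R"
proof
  fix y assume "y \<in> hcball x \<rho>"
  then show "y \<in> hcball p R"
    using assms norm_triangle_ineq[of "y - x" "x - p"] by (auto simp: hcball_def)
qed

lemma hcball_mono: "r \<le> R \<Longrightarrow> hcball p r \<subseteq> hcball p R"
  by (auto simp: hcball_def)

text \<open>
  Iterating the first-order estimate \<open>n\<close> times, each time on balls of radius \<open>\<rho> / n\<close>, costs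
  \<open>n ^ n\<close>, which is \<open>n!\<close> up to a geometric factor.
\<close>

lemma power_pderiv_estimate:
  assumes op: "openin (top_of_set M) G" and p: "p \<in> M" and r: "r \<ge> 0" and \<rho>: "\<rho> > 0"
    and G: "hcball p (r + \<rho>) \<subseteq> G" and f: "left_monogenic v m G f" and s: "s \<le> m"
    and A: "\<And>y. y \<in> hcball p (r + \<rho>) \<Longrightarrow> norm (f y) \<le> A"
    and y: "y \<in> hcball p r"
  shows "norm ((pderiv_dir v s ^^ n) f y) \<le> A * ((gradient_const * exp 1 / \<rho>) ^ n * fact n)"
proof (cases "n = 0")
  case True
  then show ?thesis using A[of y] y \<rho> by (auto simp: hcball_def)
next
  case False
  define \<delta> where "\<delta> = \<rho> / real n"
  have \<delta>: "\<delta> > 0" "real n * \<delta> = \<rho>" using \<rho> False by (auto simp: \<delta>_def)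
  have "p \<in> hcball p (r + \<rho>)" using p r \<rho> by (simp add: hcball_def)
  then have A0: "A \<ge> 0" using A norm_ge_zero order_trans by blast
  have "norm ((pderiv_dir v s ^^ j) f z) \<le> A * (gradient_const / \<delta>) ^ j"
    if "j \<le> n" "z \<in> hcball p (r + real (n - j) * \<delta>)" for j z
    using that
  proof (induction j arbitrary: z)
    case 0
    then show ?case using A[of z] \<delta>(2) by simp
  next
    case (Suc j)
    have sub: "hcball z \<delta> \<subseteq> hcball p (r + real (n - j) * \<delta>)"
      by (rule hcball_subset_hcball[OF Suc.prems(2)]) (use Suc.prems(1) in \<open>simp add: of_nat_diff algebra_simps\<close>)
    have "real (n - j) * \<delta> \<le> real n * \<delta>" using \<delta> by (intro mult_right_mono) auto
    then have sub': "hcball p (r + real (n - j) * \<delta>) \<subseteq> G"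
      using G \<delta>(2) by (auto simp: hcball_def subset_iff)
    have "norm (pderiv_dir v s ((pderiv_dir v s ^^ j) f) z) \<le> gradient_const / \<delta> * (A * (gradient_const / \<delta>) ^ j)"
    proof (rule gradient_estimate[OF _ \<delta>(1) _ left_monogenic_power_pderiv[OF op f s] s])
      show "z \<in> M" using Suc.prems(2) by (simp add: hcball_def)
      show "hcball z \<delta> \<subseteq> G" using sub sub' by blast
      show "norm ((pderiv_dir v s ^^ j) f y) \<le> A * (gradient_const / \<delta>) ^ j" if "y \<in> hcball z \<delta>" for y
        by (rule Suc.IH) (use Suc.prems(1) that sub in auto)
    qed
    then show ?case by (simp add: mult.commute mult.left_commute)
  qed
  from this[of n y] have "norm ((pderiv_dir v s ^^ n) f y) \<le> A * (gradient_const / \<delta>) ^ n"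
    using y by simp
  also have "(gradient_const / \<delta>) ^ n = (gradient_const / \<rho>) ^ n * real n ^ n"
    by (simp add: \<delta>_def power_mult_distrib power_divide)
  also have "A * \<dots> \<le> A * ((gradient_const / \<rho>) ^ n * (exp 1 ^ n * fact n))"
    using A0 \<rho> gradient_const_nonneg power_self_le_exp_fact[of n]
    by (intro mult_left_mono) auto
  finally show ?thesis by (simp add: power_mult_distrib power_divide mult.assoc)
qed

text \<open>
  Each coordinate has its own radius \<open>\<rho>\<close> to spend, so the factorials of the single orders appear
  and not the larger factorial of the total order.
\<close>

lemma iterated_partial_estimate:
  assumes op: "openin (top_of_set M) G" and p: "p \<in> M" and \<rho>: "\<rho> > 0" and f: "left_monogenic v m G f"
    and "distinct l" "set l \<subseteq> {..m}" "r \<ge> 0" "hcball p (r + real (length l) * \<rho>) \<subseteq> G"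
    and "\<And>y. y \<in> hcball p (r + real (length l) * \<rho>) \<Longrightarrow> norm (f y) \<le> A"
    and "y \<in> hcball p r"
  shows "norm (iterated_partial l k f y) \<le> A * (\<Prod>s\<in>set l. (gradient_const * exp 1 / \<rho>) ^ k s * fact (k s))"
  using assms(5-)
proof (induction l arbitrary: r y)
  case Nil
  then show ?case by (simp add: iterated_partial_simps)
next
  case (Cons s l)
  have len: "r + \<rho> + real (length l) * \<rho> = r + real (length (s # l)) * \<rho>" by (simp add: algebra_simps)
  have "hcball p (r + \<rho>) \<subseteq> hcball p (r + real (length (s # l)) * \<rho>)"
    by (rule hcball_mono) (use \<rho> in \<open>simp add: len[symmetric] del: list.size\<close>)
  then have sub: "hcball p (r + \<rho>) \<subseteq> G" using Cons.prems(4) by blast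
  have "norm ((pderiv_dir v s ^^ k s) (iterated_partial l k f) y) \<le>
    A * (\<Prod>s\<in>set l. (gradient_const * exp 1 / \<rho>) ^ k s * fact (k s)) *
      ((gradient_const * exp 1 / \<rho>) ^ k s * fact (k s))"
  proof (rule power_pderiv_estimate[OF op p Cons.prems(3) \<rho> sub])
    show "left_monogenic v m G (iterated_partial l k f)"
      by (rule left_monogenic_iterated_partial[OF op f]) (use Cons.prems in auto)
    show "norm (iterated_partial l k f z) \<le> A * (\<Prod>s\<in>set l. (gradient_const * exp 1 / \<rho>) ^ k s * fact (k s))"
      if "z \<in> hcball p (r + \<rho>)" for z
    proof (rule Cons.IH[OF _ _ _ _ _ that])
      show "hcball p (r + \<rho> + real (length l) * \<rho>) \<subseteq> G" unfolding len by (rule Cons.prems(4))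
      show "norm (f y) \<le> A" if "y \<in> hcball p (r + \<rho> + real (length l) * \<rho>)" for y
        using Cons.prems(5) that unfolding len .
    qed (use Cons.prems \<rho> in auto)
  qed (use Cons.prems in auto)
  then show ?case
    using Cons.prems(1) by (simp add: iterated_partial_simps mult.commute mult.left_commute)
qed

text \<open>Taylor's theorem for each component; the remainder is at most \<open>A / 2 ^ n\<close>.\<close>

lemma taylor_along_line:
  assumes op: "openin (top_of_set M) G" and p: "p \<in> M" and f: "left_monogenic v m G f" and s: "s \<le> m"
    and G: "hcball p \<rho> \<subseteq> G" and u: "\<bar>u\<bar> \<le> \<rho>" and B: "B \<ge> 0" "B * \<bar>u\<bar> \<le> 1/2"
    and A: "\<And>n y. y \<in> hcball p \<rho> \<Longrightarrow> norm ((pderiv_dir v s ^^ n) f y) \<le> A * (B ^ n * fact n)"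
  shows "((\<lambda>n. (u ^ n / fact n) *\<^sub>R (pderiv_dir v s ^^ n) f p) has_sum f (p + u *\<^sub>R v s)) UNIV"
proof -
  let ?D = "\<lambda>n x. (pderiv_dir v s ^^ n) f x"
  have line: "p + t *\<^sub>R v s \<in> hcball p \<rho>" if "\<bar>t\<bar> \<le> \<bar>u\<bar>" for t
    using that u p s by (simp add: hcball_def M_add_line norm_v)
  have "norm (f (p + 0 *\<^sub>R v s)) \<le> A" using A[OF line[of 0], of 0] by simp
  then have A0: "A \<ge> 0" using norm_ge_zero order_trans by blast
  have term_le: "norm ((u ^ n / fact n) *\<^sub>R ?D n (p + t *\<^sub>R v s)) \<le> A * (1/2) ^ n" if "\<bar>t\<bar> \<le> \<bar>u\<bar>" for n t
  proof -
    have "norm ((u ^ n / fact n) *\<^sub>R ?D n (p + t *\<^sub>R v s)) = \<bar>u\<bar> ^ n / fact n * norm (?D n (p + t *\<^sub>R v s))"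
      by (simp add: power_abs)
    also have "\<dots> \<le> \<bar>u\<bar> ^ n / fact n * (A * (B ^ n * fact n))"
      by (intro mult_left_mono A line that) auto
    also have "\<dots> = A * (B * \<bar>u\<bar>) ^ n" by (simp add: power_mult_distrib)
    also have "\<dots> \<le> A * (1/2) ^ n" using A0 B by (intro mult_left_mono power_mono) auto
    finally show ?thesis .
  qed
  have "((\<lambda>n. \<Sum>i<n. (u ^ i / fact i) *\<^sub>R ?D i p) \<longlongrightarrow> f (p + u *\<^sub>R v s)) sequentially"
  proof (subst tendsto_componentwise_iff, rule ballI)
    fix b :: 'a assume b: "b \<in> Basis"
    have err: "\<bar>(\<Sum>i<n. (u ^ i / fact i) *\<^sub>R ?D i p) \<bullet> b - f (p + u *\<^sub>R v s) \<bullet> b\<bar> \<le> A * (1/2) ^ n" for n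
    proof -
      let ?diff = "\<lambda>n t. ?D n (p + t *\<^sub>R v s) \<bullet> b"
      have "\<exists>t. \<bar>t\<bar> \<le> \<bar>u\<bar> \<and> f (p + u *\<^sub>R v s) \<bullet> b = (\<Sum>i<n. ?diff i 0 / fact i * u ^ i) + ?diff n t / fact n * u ^ n"
      proof (rule Maclaurin_bi_le[where diff="?diff" and f="\<lambda>u. f (p + u *\<^sub>R v s) \<bullet> b"])
        show "\<forall>i t. i < n \<and> \<bar>t\<bar> \<le> \<bar>u\<bar> \<longrightarrow> ((\<lambda>t. ?diff i t) has_real_derivative ?diff (Suc i) t) (at t)"
        proof (intro allI impI)
          fix i t assume "i < n \<and> \<bar>t\<bar> \<le> \<bar>u\<bar>"
          then have "p + t *\<^sub>R v s \<in> G" using line G by blast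
          from left_monogenic_has_partial[OF left_monogenic_power_pderiv[OF op f s] s this, of i]
          show "((\<lambda>t. ?diff i t) has_real_derivative ?diff (Suc i) t) (at t)"
            by (simp add: real_derivative_along_line)
        qed
      qed simp
      then obtain t where t: "\<bar>t\<bar> \<le> \<bar>u\<bar>"
        "f (p + u *\<^sub>R v s) \<bullet> b = (\<Sum>i<n. ?diff i 0 / fact i * u ^ i) + ?diff n t / fact n * u ^ n" by blast
      have "(\<Sum>i<n. (u ^ i / fact i) *\<^sub>R ?D i p) \<bullet> b = (\<Sum>i<n. ?diff i 0 / fact i * u ^ i)"
        by (simp add: inner_sum_left mult.commute)
      then have "\<bar>(\<Sum>i<n. (u ^ i / fact i) *\<^sub>R ?D i p) \<bullet> b - f (p + u *\<^sub>R v s) \<bullet> b\<bar> =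
          \<bar>((u ^ n / fact n) *\<^sub>R ?D n (p + t *\<^sub>R v s)) \<bullet> b\<bar>"
        using t(2) by (simp add: mult.commute)
      also have "\<dots> \<le> norm ((u ^ n / fact n) *\<^sub>R ?D n (p + t *\<^sub>R v s))" by (rule Basis_le_norm[OF b])
      also have "\<dots> \<le> A * (1/2) ^ n" by (rule term_le[OF t(1)])
      finally show ?thesis .
    qed
    have "(\<lambda>n. A * (1/2) ^ n) \<longlonglongrightarrow> A * 0"
      by (intro tendsto_intros LIMSEQ_power_zero) simp
    then have lim: "(\<lambda>n. A * (1/2) ^ n) \<longlonglongrightarrow> 0" by simp
    have "(\<lambda>n. (\<Sum>i<n. (u ^ i / fact i) *\<^sub>R ?D i p) \<bullet> b - f (p + u *\<^sub>R v s) \<bullet> b) \<longlonglongrightarrow> 0"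
      by (rule Lim_null_comparison[OF always_eventually lim]) (intro allI, simp only: real_norm_def err)
    then show "(\<lambda>n. (\<Sum>i<n. (u ^ i / fact i) *\<^sub>R ?D i p) \<bullet> b) \<longlonglongrightarrow> f (p + u *\<^sub>R v s) \<bullet> b"
      by (rule LIM_zero_cancel)
  qed
  moreover have "summable (\<lambda>n. norm ((u ^ n / fact n) *\<^sub>R ?D n p))"
    by (rule summable_comparison_test'[of "\<lambda>n. A * (1/2) ^ n" 0])
      (use term_le[of 0] in \<open>auto intro!: summable_mult summable_geometric\<close>)
  ultimately show ?thesis
    unfolding sums_def[symmetric] by (intro norm_summable_imp_has_sum)
qed

text \<open>
  Multivariate Taylor expansion, one coordinate after the other; the product form of the
  estimate makes the resulting multiple series absolutely summable.
\<close>

lemma taylor_multivariate: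
  assumes op: "openin (top_of_set M) G" and f: "left_monogenic v m G f" and \<rho>: "\<rho> > 0"
    and y: "\<And>s. s \<le> m \<Longrightarrow> \<bar>y s\<bar> \<le> \<rho>" "\<And>s. s \<le> m \<Longrightarrow> gradient_const * exp 1 / \<rho> * \<bar>y s\<bar> \<le> 1/2"
    and "distinct l" "set l \<subseteq> {..m}" "p \<in> M" "hcball p (2 * real (length l) * \<rho>) \<subseteq> G"
    and "\<And>x. x \<in> hcball p (2 * real (length l) * \<rho>) \<Longrightarrow> norm (f x) \<le> A"
  shows "((\<lambda>k. (\<Prod>s\<in>set l. y s ^ k s) *\<^sub>R (1 / (\<Prod>s\<in>set l. fact (k s))) *\<^sub>R iterated_partial l k f p)
    has_sum f (p + (\<Sum>s\<in>set l. y s *\<^sub>R v s))) (multi_indices (set l))"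
  using assms(6-)
proof (induction l arbitrary: p)
  case Nil
  then show ?case by (simp add: multi_indices_empty iterated_partial_simps has_sum_finiteI)
next
  case (Cons s l)
  let ?B = "gradient_const * exp 1 / \<rho>"
  have s: "s \<le> m" "s \<notin> set l" "distinct l" "set l \<subseteq> {..m}" using Cons.prems by auto
  define p' where "p' = p + y s *\<^sub>R v s"
  have p'M: "p' \<in> M" using Cons.prems s by (simp add: p'_def M_add_line)
  have len: "2 * real (length (s # l)) * \<rho> = 2 * \<rho> + 2 * real (length l) * \<rho>" by (simp add: algebra_simps)
  have "p' \<in> hcball p (2 * \<rho>)"
    using y(1)[OF s(1)] \<rho> p'M s(1) by (simp add: hcball_def p'_def norm_v)
  then have sub: "hcball p' (2 * real (length l) * \<rho>) \<subseteq> hcball p (2 * real (length (s # l)) * \<rho>)"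
    by (rule hcball_subset_hcball) (simp only: len order_refl)
  let ?c = "\<lambda>k. (\<Prod>s\<in>set l. y s ^ k s) * (1 / (\<Prod>s\<in>set l. fact (k s)))"
  let ?g = "\<lambda>k. iterated_partial l k f"
  let ?T = "\<lambda>k n. (y s ^ n / fact n) *\<^sub>R (pderiv_dir v s ^^ n) (?g k) p"
  let ?P = "\<lambda>k. \<Prod>s\<in>set l. ?B ^ k s * fact (k s)"
  have B: "?B \<ge> 0" using gradient_const_nonneg \<rho> by simp
  have IH: "((\<lambda>k. ?c k *\<^sub>R ?g k p') has_sum f (p' + (\<Sum>s\<in>set l. y s *\<^sub>R v s))) (multi_indices (set l))"
    using Cons.IH[OF s(3,4) p'M] sub Cons.prems(4,5) by (simp add: subset_iff)
  have sub2: "hcball p (2 * \<rho> + real (length l) * \<rho>) \<subseteq> hcball p (2 * real (length (s # l)) * \<rho>)"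
    unfolding len by (rule hcball_mono) (use \<rho> in simp)
  have sub1: "hcball p (\<rho> + \<rho>) \<subseteq> hcball p (2 * real (length (s # l)) * \<rho>)"
    unfolding len by (rule hcball_mono) (use \<rho> in simp)
  have g_bound: "norm (?g k z) \<le> A * ?P k" if "z \<in> hcball p (\<rho> + \<rho>)" for k z
  proof (rule iterated_partial_estimate[OF op Cons.prems(3) \<rho> f s(3,4), where r="2 * \<rho>"])
    show "hcball p (2 * \<rho> + real (length l) * \<rho>) \<subseteq> G" using sub2 Cons.prems(4) by blast
    show "norm (f y) \<le> A" if "y \<in> hcball p (2 * \<rho> + real (length l) * \<rho>)" for y
      using Cons.prems(5) that sub2 by blast
  qed (use \<rho> that in auto)
  have g_mono: "left_monogenic v m G (?g k)" for k
    by (rule left_monogenic_iterated_partial[OF op f s(4)])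
  have Dg: "norm ((pderiv_dir v s ^^ n) (?g k) z) \<le> A * ?P k * (?B ^ n * fact n)" if "z \<in> hcball p \<rho>" for k n z
    by (rule power_pderiv_estimate[OF op Cons.prems(3) _ \<rho> _ g_mono s(1) g_bound that])
      (use \<rho> sub1 Cons.prems(4) in auto)
  (* the first coordinate is expanded about p, inside the expansion in the others about p' *)
  have row: "((\<lambda>n. ?c k *\<^sub>R ?T k n) has_sum ?c k *\<^sub>R ?g k p') UNIV" for k
  proof -
    have "hcball p \<rho> \<subseteq> hcball p (\<rho> + \<rho>)" using \<rho> by (auto simp: hcball_def)
    then have "(?T k has_sum ?g k p') UNIV"
      unfolding p'_def
      by (intro taylor_along_line[OF op Cons.prems(3) g_mono s(1) _ y(1)[OF s(1)] B y(2)[OF s(1)] Dg])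
        (use sub1 Cons.prems(4) in auto)
    then show ?thesis by (rule has_sum_scaleR)
  qed
  have "norm (f p) \<le> A"
    by (rule Cons.prems(5)) (use Cons.prems(3) \<rho> in \<open>simp add: hcball_def\<close>)
  then have A0: "A \<ge> 0" using norm_ge_zero order_trans by blast
  have bound: "norm (?c k *\<^sub>R ?T k n) \<le> A * ((\<Prod>s\<in>set l. (1/2) ^ k s) * (1/2) ^ n)" for k n
  proof -
    have "p \<in> hcball p \<rho>" using Cons.prems(3) \<rho> by (simp add: hcball_def)
    have "norm (?c k *\<^sub>R ?T k n) = \<bar>?c k\<bar> * (\<bar>y s\<bar> ^ n / fact n * norm ((pderiv_dir v s ^^ n) (?g k) p))"
      by (simp add: power_abs abs_mult)
    also have "\<dots> \<le> \<bar>?c k\<bar> * (\<bar>y s\<bar> ^ n / fact n * (A * ?P k * (?B ^ n * fact n)))"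
      by (intro mult_left_mono Dg \<open>p \<in> hcball p \<rho>\<close>) auto
    also have "\<dots> = A * ((\<bar>?c k\<bar> * ?P k) * (?B * \<bar>y s\<bar>) ^ n)"
    proof -
      have "a * (u ^ n / F * (A * P * (b ^ n * F))) = A * ((a * P) * (b * u) ^ n)"
        if "F \<noteq> 0" for a u F P b :: real
        using that by (simp add: power_mult_distrib)
      from this[OF fact_nonzero] show ?thesis .
    qed
    also have "\<bar>?c k\<bar> * ?P k = (\<Prod>s\<in>set l. (?B * \<bar>y s\<bar>) ^ k s)"
    proof -
      have "\<bar>?c k\<bar> = (\<Prod>s\<in>set l. \<bar>y s\<bar> ^ k s) * (1 / (\<Prod>s\<in>set l. fact (k s)))"
        by (simp add: abs_mult abs_prod power_abs prod_nonneg)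
      moreover have "?P k = (\<Prod>s\<in>set l. ?B ^ k s) * (\<Prod>s\<in>set l. fact (k s))"
        by (rule prod.distrib)
      moreover have "(\<Prod>s\<in>set l. fact (k s)) \<noteq> (0 :: real)" by simp
      moreover have "(\<Prod>s\<in>set l. (?B * \<bar>y s\<bar>) ^ k s) = (\<Prod>s\<in>set l. ?B ^ k s) * (\<Prod>s\<in>set l. \<bar>y s\<bar> ^ k s)"
        by (simp only: power_mult_distrib[of ?B] prod.distrib)
      moreover have "a * (1 / F) * (b * F) = b * a" if "F \<noteq> 0" for a b F :: real
        using that by simp
      ultimately show ?thesis by (simp only:)
    qed
    also have "A * ((\<Prod>s\<in>set l. (?B * \<bar>y s\<bar>) ^ k s) * (?B * \<bar>y s\<bar>) ^ n) \<le>
        A * ((\<Prod>s\<in>set l. (1/2) ^ k s) * (1/2) ^ n)"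
      using A0 B y(2) s(1,4)
      by (intro mult_left_mono mult_mono prod_mono power_mono conjI prod_nonneg zero_le_power
          mult_nonneg_nonneg) auto
    finally show ?thesis .
  qed
  have "(\<lambda>(k, n::nat). (\<Prod>s\<in>set l. (1/2 :: real) ^ k s) * (1/2) ^ n) summable_on multi_indices (set l) \<times> UNIV"
    by (rule summable_on_times_geometric[OF summable_on_multi_geometric]) (auto simp: prod_nonneg)
  then have "(\<lambda>x. A * (case x of (k, n::nat) \<Rightarrow> (\<Prod>s\<in>set l. (1/2 :: real) ^ k s) * (1/2) ^ n))
      summable_on multi_indices (set l) \<times> UNIV"
    by (rule summable_on_cmult_right)
  then have "(\<lambda>x. norm (case x of (k, n) \<Rightarrow> ?c k *\<^sub>R ?T k n)) summable_on multi_indices (set l) \<times> UNIV"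
    by (rule Infinite_Sum.abs_summable_on_comparison_test') (use bound in auto)
  then have summable: "(\<lambda>(k, n). ?c k *\<^sub>R ?T k n) summable_on multi_indices (set l) \<times> UNIV"
    by (rule abs_summable_summable)
  have "((\<lambda>(k, n). ?c k *\<^sub>R ?T k n) has_sum f (p' + (\<Sum>s\<in>set l. y s *\<^sub>R v s))) (multi_indices (set l) \<times> UNIV)"
    by (rule has_sum_SigmaI[OF _ IH summable]) (use row in simp)
  also have "(\<lambda>(k, n). ?c k *\<^sub>R ?T k n) = (\<lambda>x. (\<lambda>k. (\<Prod>s\<in>set (s # l). y s ^ k s) *\<^sub>R
      (1 / (\<Prod>s\<in>set (s # l). fact (k s))) *\<^sub>R iterated_partial (s # l) k f p) ((\<lambda>(k, n). k(s := n)) x))"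
  proof (rule ext, clarify)
    fix k :: "nat \<Rightarrow> nat" and n
    have "iterated_partial (s # l) (k(s := n)) f = (pderiv_dir v s ^^ n) (?g k)"
    proof -
      have "iterated_partial l (k(s := n)) f = ?g k"
        by (rule iterated_partial_cong) (use s(2) in auto)
      then show ?thesis by (simp add: iterated_partial_simps)
    qed
    moreover have "(\<Prod>j\<in>set (s # l). y j ^ (k(s := n)) j) = y s ^ n * (\<Prod>s\<in>set l. y s ^ k s)"
      using prod_fun_upd_insert[of "set l" s "\<lambda>j n. y j ^ n" k n] s(2) by simp
    moreover have "(\<Prod>j\<in>set (s # l). fact ((k(s := n)) j) :: real) = fact n * (\<Prod>s\<in>set l. fact (k s))"
      using prod_fun_upd_insert[of "set l" s "\<lambda>j n. fact n :: real" k n] s(2) by simp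
    ultimately show "?c k *\<^sub>R ?T k n = (\<Prod>j\<in>set (s # l). y j ^ (k(s := n)) j) *\<^sub>R
      (1 / (\<Prod>j\<in>set (s # l). fact ((k(s := n)) j))) *\<^sub>R iterated_partial (s # l) (k(s := n)) f p"
      by (simp only:) (simp add: mult.commute)
  qed
  also have "(\<dots> has_sum f (p' + (\<Sum>s\<in>set l. y s *\<^sub>R v s))) (multi_indices (set l) \<times> UNIV) \<longleftrightarrow>
      ((\<lambda>k. (\<Prod>s\<in>set (s # l). y s ^ k s) *\<^sub>R (1 / (\<Prod>s\<in>set (s # l). fact (k s))) *\<^sub>R
        iterated_partial (s # l) k f p) has_sum f (p' + (\<Sum>s\<in>set l. y s *\<^sub>R v s))) (multi_indices (insert s (set l)))"
    by (rule has_sum_reindex_bij_betw[OF bij_betw_multi_indices_insert[OF s(2)]])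
  also have "p' + (\<Sum>s\<in>set l. y s *\<^sub>R v s) = p + (\<Sum>s\<in>set (s # l). y s *\<^sub>R v s)"
    using s(2) by (simp add: p'_def)
  finally show ?case by simp
qed

theorem real_analytic_left_monogenic:
  assumes op: "openin (top_of_set M) G" and f: "left_monogenic v m G f"
  shows "real_analytic M v m G f"
  unfolding real_analytic_def
proof
  fix p assume pG: "p \<in> G"
  then have p: "p \<in> M" using op by (auto simp: openin_open)
  obtain r\<^sub>0 where r\<^sub>0: "r\<^sub>0 > 0" "hcball p r\<^sub>0 \<subseteq> G" using hcball_subset_open[OF op pG] by blast
  obtain A where A: "\<And>y. y \<in> hcball p r\<^sub>0 \<Longrightarrow> norm (f y) \<le> A"
    using bounded_on_hcball[OF continuous_on_subset[OF left_monogenic_continuous(1)[OF f] r\<^sub>0(2)]] by blast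
  define \<rho> where "\<rho> = r\<^sub>0 / (2 * real (m + 1))"
  have \<rho>: "\<rho> > 0" "2 * real (m + 1) * \<rho> = r\<^sub>0" "\<rho> \<le> r\<^sub>0"
    using r\<^sub>0 by (auto simp: \<rho>_def field_simps)
  let ?B = "gradient_const * exp 1 / \<rho>"
  have B: "?B \<ge> 0" using gradient_const_nonneg \<rho> by simp
  define r where "r = min \<rho> (1 / (2 * (?B + 1)))"
  have r: "r > 0" "r \<le> \<rho>" "?B * r \<le> 1/2"
  proof -
    show "r > 0" "r \<le> \<rho>" using \<rho> B by (auto simp: r_def)
    have "?B * r \<le> ?B * (1 / (2 * (?B + 1)))" using B by (intro mult_left_mono) (simp_all add: r_def)
    also have "b * (1 / (2 * (b + 1))) \<le> 1/2" if "b \<ge> 0" for b :: real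
      using that by (simp add: divide_simps)
    from this[OF B] have "?B * (1 / (2 * (?B + 1))) \<le> 1/2" .
    finally show "?B * r \<le> 1/2" .
  qed
  let ?l = "[0..<Suc m]"
  have l: "set ?l = {..m}" "length ?l = m + 1" by (auto simp: lessThan_Suc_atMost[symmetric] simp del: upt_Suc)
  have sub: "hball M p r \<subseteq> G"
    using r \<rho> r\<^sub>0 by (auto simp: hball_def hcball_def subset_iff)
  have expansion: "((\<lambda>k. (\<Prod>s\<le>m. ((x - p) \<bullet> v s) ^ k s) *\<^sub>R ((1 / (\<Prod>s\<le>m. fact (k s))) *\<^sub>R iterated_partial ?l k f p))
      has_sum f x) {k. \<forall>s>m. k s = 0}" if x: "x \<in> hball M p r" for x
  proof -
    define y where "y s = (x - p) \<bullet> v s" for s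
    have y: "\<bar>y s\<bar> \<le> r" if "s \<le> m" for s
      using Cauchy_Schwarz_ineq2[of "x - p" "v s"] norm_v[OF that] x by (simp add: y_def hball_def)
    have "((\<lambda>k. (\<Prod>s\<in>set ?l. y s ^ k s) *\<^sub>R (1 / (\<Prod>s\<in>set ?l. fact (k s))) *\<^sub>R iterated_partial ?l k f p)
      has_sum f (p + (\<Sum>s\<in>set ?l. y s *\<^sub>R v s))) (multi_indices (set ?l))"
    proof (rule taylor_multivariate[OF op f \<rho>(1), where A=A])
      show "\<bar>y s\<bar> \<le> \<rho>" if "s \<le> m" for s using y[OF that] r by simp
      show "?B * \<bar>y s\<bar> \<le> 1/2" if "s \<le> m" for s
        using mult_left_mono[OF y[OF that] B] r(3) by linarith
    qed (use p l \<rho>(2) r\<^sub>0(2) A in \<open>simp_all del: upt_Suc\<close>)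
    moreover have "p + (\<Sum>s\<le>m. y s *\<^sub>R v s) = x"
    proof -
      have "x - p \<in> M" using x p subspace_M by (auto simp: hball_def intro: subspace_diff)
      then have "(\<Sum>s\<le>m. y s *\<^sub>R v s) = x - p"
        unfolding y_def by (rule frame_expansion[symmetric])
      then show ?thesis by simp
    qed
    moreover have "multi_indices {..m} = {k. \<forall>s>m. k s = 0}"
      by (auto simp: multi_indices_def not_le)
    ultimately show ?thesis by (simp only: l(1) y_def)
  qed
  show "\<exists>r>0. \<exists>a. hball M p r \<subseteq> G \<and> (\<forall>x\<in>hball M p r.
      ((\<lambda>k. (\<Prod>s\<le>m. ((x - p) \<bullet> v s) ^ k s) *\<^sub>R a k) has_sum f x) {k. \<forall>s>m. k s = 0})"
    by (intro exI conjI ballI) (rule r(1) sub expansion, assumption?)+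
qed

end

section \<open>The theorem for hypercomplex bases\<close>

lemma hypercomplex_frame_of_basis:
  fixes c :: "'a::{real_algebra_1,euclidean_space} \<Rightarrow> 'a"
  assumes c: "star_involution c" and basis: "hypercomplex_basis c M v m" and on: "orthonormal_completion v m d"
  shows "hypercomplex_frame v m M c"
proof (intro hypercomplex_frame.intro orthonormal_frame.intro hypercomplex_frame_axioms.intro)
  have lin: "linear c" and invol: "\<And>x. c (c x) = x" and anti: "\<And>x y. c (x * y) = c y * c x"
    using c by (auto simp: star_involution_def)
  show "linear c" by (rule lin)
  show orth: "v i \<bullet> v j = (if i = j then 1 else 0)" if "i \<le> m" "j \<le> m" for i j
    using on that by (auto simp: orthonormal_completion_def)
  show M: "M = span (v ` {..m})"
    using basis by (simp add: hypercomplex_basis_def ordered_basis_def)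
  have c1: "c 1 = 1"
  proof -
    have "c (c 1) = c (c 1) * c 1" using anti[of 1 "c 1"] by (simp only: mult_1)
    then show ?thesis by (simp add: invol)
  qed
  have v0: "v 0 = 1"
    using basis unfolding hypercomplex_basis_def by blast
  have v: "v s \<in> imag_units c" if "1 \<le> s" "s \<le> m" for s
    using basis that unfolding hypercomplex_basis_def by (meson atLeastAtMost_iff)
  have ac: "v s * v t = - (v t * v s)" if "1 \<le> s" "s \<le> m" "1 \<le> t" "t \<le> m" "s \<noteq> t" for s t
    using basis that unfolding hypercomplex_basis_def by (meson atLeastAtMost_iff)
  have cv: "c (v s) = - v s" if "1 \<le> s" "s \<le> m" for s
    using v[OF that] by (simp add: imag_units_def tr_def add_eq_0_iff)
  have vv: "v s * v s = - 1" if "1 \<le> s" "s \<le> m" for s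
  proof -
    have "- (v s * v s) = 1"
      using v[OF that] cv[OF that] by (simp add: imag_units_def nm_def)
    from arg_cong[OF this, of uminus] show ?thesis by simp
  qed
  show "c (v s) * v s = 1" if "s \<le> m" for s
    using vv[of s] cv[of s] v0 c1 that by (cases "s = 0") auto
  show "c (v s) * v t + c (v t) * v s = 0" if "s \<le> m" "t \<le> m" "s \<noteq> t" for s t
    using cv[of s] cv[of t] ac[of s t] v0 c1 that by (cases "s = 0"; cases "t = 0") auto
  show "c x \<in> M" if "x \<in> M" for x
  proof -
    have "c ` span (v ` {..m}) = span (c ` v ` {..m})"
      by (rule linear_span_image[OF lin, symmetric])
    also have "\<dots> \<subseteq> span (v ` {..m})"
    proof (rule span_minimal)
      show "c ` v ` {..m} \<subseteq> span (v ` {..m})"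
      proof clarify
        fix s assume "s \<le> m"
        then show "c (v s) \<in> span (v ` {..m})"
          using cv[of s] v0 c1 span_base[of "v s" "v ` {..m}"] by (cases "s = 0") (auto simp: span_neg)
      qed
    qed simp
    finally show ?thesis using that M by blast
  qed
qed

theorem theorem3p19:
  fixes c :: "'a::{real_algebra_1,euclidean_space} \<Rightarrow> 'a"
    and M G :: "'a set"
    and v :: "nat \<Rightarrow> 'a"
    and m d :: nat
    and \<phi> :: "'a \<Rightarrow> 'a"
  assumes "star_involution c"
    and "imag_units c \<noteq> {}"
    and "hypercomplex_subspace c M"
    and "hypercomplex_basis c M v m"
    and "orthonormal_completion v m d"
    and "domain_in M G"
    and "left_monogenic v m G \<phi>"
  shows "harmonic_wrt v m G \<phi> \<and> real_analytic M v m G \<phi> \<and>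
    (\<forall>h :: nat \<Rightarrow> nat.
       left_monogenic v m G (nabla v m h \<phi>) \<and>
       real_analytic M v m G (nabla v m h \<phi>) \<and>
       (\<forall>p\<in>M. \<forall>R>0. closure (hball M p R) \<subseteq> G \<longrightarrow>
          (\<forall>x\<in>hball M p R.
             nabla v m h \<phi> x =
               (-1) ^ mlength m h *\<^sub>R
                 sphere_integral v m p R (\<lambda>y. nabla v m h (cauchy_kernel c m) (y - x)) \<phi>) \<and>
          norm (nabla v m h \<phi> p) \<le>
            cauchy_const c M v m h / R ^ mlength m h * max_norm_on_sphere M p R \<phi>))"
proof -
  interpret hypercomplex_frame v m M c
    by (rule hypercomplex_frame_of_basis[OF assms(1,4,5)])
  have G: "openin (top_of_set M) G" using assms(6) by (simp add: domain_in_def)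
  note f = assms(7)
  show ?thesis
  proof (intro conjI allI ballI impI)
    show "harmonic_wrt v m G \<phi>" by (rule harmonic_left_monogenic[OF G f])
    show "real_analytic M v m G \<phi>" by (rule real_analytic_left_monogenic[OF G f])
    fix h
    show mono: "left_monogenic v m G (nabla v m h \<phi>)" by (rule left_monogenic_nabla[OF G f])
    show "real_analytic M v m G (nabla v m h \<phi>)" by (rule real_analytic_left_monogenic[OF G mono])
    fix p R assume p: "p \<in> M" and R: "(0::real) < R" and sub: "closure (hball M p R) \<subseteq> G"
    have ball: "hcball p R \<subseteq> G" using sub closure_hball[OF p R] by simp
    show "norm (nabla v m h \<phi> p) \<le>
        cauchy_const c M v m h / R ^ mlength m h * max_norm_on_sphere M p R \<phi>"
      by (rule nabla_estimate[OF p R ball f])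
    fix x assume "x \<in> hball M p R"
    then show "nabla v m h \<phi> x = (-1) ^ mlength m h *\<^sub>R
        sphere_integral v m p R (\<lambda>y. nabla v m h (cauchy_kernel c m) (y - x)) \<phi>"
      by (rule nabla_cauchy_formula[OF p R ball f])
  qed
qed

end
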